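(* Let $n\ge2$, let $D\subset\mathbb{R}^l$ be a nonempty compact set, and consider the system $$\dot x_1=u,\qquad \dot x_i=x_{i-1}+g_i(d,x_1,\dots,x_{i-1},u)\quad(i=2,\dots,n),\qquad x=(x_1,\dots,x_n)'\in\mathbb{R}^n,\ u\in\mathbb{R},\ d\in D,\tag{S}$$ where all mappings $g_i:D\times\mathbb{R}^{i-1}\times\mathbb{R}\to\mathbb{R}$ $(i=2,\dots,n)$ are locally Lipschitz. Assume that there exists a smooth non-decreasing function $L:[0,+\infty)\to[0,+\infty)$ such that, with $\underline{x}_{i-1}=(x_1,\dots,x_{i-1})'\in\mathbb{R}^{i-1}$, $$|g_i(d,\underline{x}_{i-1},u)|\le L(|(\underline{x}_{i-1},u)|)\,|\underline{x}_{i-1}|^2+L(|(\underline{x}_{i-1},u)|)\,|\underline{x}_{i-1}|\,|u|$$ for all $(d,x,u)\in D\times\mathbb{R}^n\times\mathbb{R}$ and $i=2,\dots,n$. Then there exist a bounded function $k:\mathbb{R}^n\to\mathbb{R}$ with $k(0)=0$, continuous at $0\in\mathbb{R}^n$, and a constant $r>0$, such that $0\in\mathbb{R}^n$ is robustly globally asymptotically stable (RGAS) for the closed-loop sampled-data system consisting of (S) with $$u(t)=k(x(\tau_i)),\ t\in[\tau_i,\tau_{i+1}),\qquad \tau_0=0,\quad \tau_{i+1}=\tau_i+r\exp(-w(\tau_i)),\qquad w(t)\in[0,+\infty).\tag{C}$$ More precisely, let $Q_i\in\mathbb{R}^{i\times n}$ be given by $Q_ix=(x_1,\dots,x_i)'$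 for $i=1,\dots,n$; let $b_1=1\in\mathbb{R}$, $b_i=(1,0,\dots,0)'\in\mathbb{R}^i$ for $i=2,\dots,n$; let $A_1=[0]\in\mathbb{R}^{1\times1}$ and, for $i=2,\dots,n$, $A_i=(a_{k,j})_{k,j=1,\dots,i}\in\mathbb{R}^{i\times i}$ with $a_{k,j}=1$ if $j=k-1$, $k=2,\dots,i$, and $a_{k,j}=0$ otherwise. Let $K_0>0$ and $\omega_i>0$ $(i=0,\dots,n-1)$ be arbitrary constants, let $P_i\in\mathbb{R}^{i\times i}$ $(i=1,\dots,n-1)$ be arbitrary symmetric positive definite matrices and let $p_i\in\mathbb{R}^i$ $(i=1,\dots,n-1)$ be arbitrary vectors such that the matrices $P_i(A_i+b_ip_i')+(A_i'+p_ib_i')P_i$ $(i=1,\dots,n-1)$ are negative definite. Define $c_i=-(A_i'+p_ib_i')^{-1}(0,\dots,0,1)'\in\mathbb{R}^i$ for $i=1,\dots,n-1$. Then there exist constants $r>0$ and $K_i>0$, $R_i>0$ $(i=1,\dots,n-1)$ such that $0\in\mathbb{R}^n$ is RGAS for the closed-loop sampled-data system (S) with (C), where $k:\mathbb{R}^n\to\mathbb{R}$ is defined by $$k(x)=p_i'Q_ix-K_i\,c_i'b_i\,\mathrm{sat}\big(\omega_i(x_{i+1}+c_i'Q_ix)\big),$$ where $i=i(x)\in\{1,\dots,n-1\}$ is the largest integer such that $x'Q_i'P_iQ_ix<R_i^2$, and $$k(x)=-K_0\,\mathrm{sat}(\omega_0x_1)\quad\text{if}\quad \min_{l=1,\dots,n-1}\big(x'Q_l'P_lQ_lx-R_l^2\big)\ge0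 .$$
   Context: A prime denotes transpose, $|\cdot|$ is the Euclidean norm, $\mathrm{sat}(s)=s/\max(1,|s|)$ for $s\in\mathbb{R}$. For a set $U$, $L^\infty_{loc}([0,+\infty);U)$ denotes the space of measurable and locally essentially bounded functions defined on $[0,+\infty)$ and taking values in $U$. Sampled-data systems. Consider a system with state $\xi\in\mathbb{R}^N$ of the form $\dot\xi(t)=F(d(t),\xi(t),\xi(\tau_i))$ for $t\in[\tau_i,\tau_{i+1})$, with $\tau_0=0$, $\tau_{i+1}=\tau_i+\rho\exp(-w(\tau_i))$, $i=0,1,\dots$, where $\rho>0$ is a constant. The admissible inputs are all $d\in L^\infty_{loc}([0,+\infty);D)$ and $w\in L^\infty_{loc}([0,+\infty);[0,+\infty))$. For each initial condition $\xi(0)=\xi_0$ and inputs $(d,w)$, the unique solution is denoted $\xi(t,\xi_0,d,w)$; it is defined on $[0,t_{\max})$, where $t_{\max}\in(0,+\infty]$ is its maximal existence time, and if $t_{\max}<+\infty$ then $\limsup_{t\to t_{\max}^-}|\xi(t)|=+\infty$. Definition (RGAS). $0\in\mathbb{R}^N$ is robustly globally asymptotically stable (RGAS) for the sampled-data system if: (P1) for every $\varepsilon>0$, $\sup\{|\xi(t,\xi_0,d,w)|:\ t\ge0,\ |\xi_0|\le\varepsilon,\ (d,w)\text{ admissible inputs}\}<+\infty$; (P2) for every $\varepsilon>0$ there is $\delta(\varepsilon)>0$ such that $|\xi_0|\le\delta(\varepsilon)$ implies $|\xi(t,\xi_0,d,w)|\le\varepsilon$ for all $t\ge0$ and all admissible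 inputs $(d,w)$; (P3) for every $\varepsilon>0$ and $R_0\ge0$ there is $\tau(\varepsilon,R_0)\ge0$ such that $|\xi_0|\le R_0$ implies $|\xi(t,\xi_0,d,w)|\le\varepsilon$ for all $t\ge\tau(\varepsilon,R_0)$ and all admissible inputs $(d,w)$. *)

theory Defs
  imports "HOL-Analysis.Analysis" "Jordan_Normal_Form.Gauss_Jordan_Elimination"
begin

text \<open>
  Since the dimension of the state and the sizes of the matrices vary inside the statement,
  vectors and matrices are those of \<open>Jordan_Normal_Form\<close>, relativised to their carriers.
  Components are numbered from 0 there: the coordinate \<open>x\<^sub>j\<close> of the mathematical text is
  \<open>x $ (j - 1)\<close>. All other indices (of \<open>g\<close>, \<open>P\<close>, \<open>p\<close>, \<open>c\<close>, \<open>K\<close>, \<open>R\<close>, \<open>\<omega>\<close>) are kept.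
\<close>

unbundle no vec_syntax
unbundle no inner_syntax

type_synonym rvec = "real Matrix.vec"
type_synonym rmat = "real Matrix.mat"

definition vnorm :: "rvec \<Rightarrow> real" where
  "vnorm v = sqrt (v \<bullet> v)"

definition sat :: "real \<Rightarrow> real" where
  "sat s = s / max 1 \<bar>s\<bar>"


text \<open>
  Inputs are genuine functions rather than classes modulo null sets, because the sampling
  rule evaluates \<open>w\<close> at the sampling times.
\<close>

definition Linf_loc :: "'a::euclidean_space set \<Rightarrow> (real \<Rightarrow> 'a) set" where
  "Linf_loc U = {f. f \<in> borel_measurable (lebesgue_on {0..}) \<and> (\<forall>t\<ge>0. f t \<in> U) \<and>
      (\<forall>T. \<exists>C. AE t in lebesgue_on {0..T}. norm (f t) \<le> C)}"

primrec sample_time :: "real \<Rightarrow> (real \<Rightarrow> real) \<Rightarrow> nat \<Rightarrow> real" where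
  "sample_time \<rho> w 0 = 0"
| "sample_time \<rho> w (Suc i) = sample_time \<rho> w i + \<rho> * exp (- w (sample_time \<rho> w i))"

text \<open>
  The differential equation only prescribes the state before \<open>sup\<^sub>i \<tau>\<^sub>i\<close>. This supremum is
  infinite when \<open>w\<close> is locally bounded, but it can be finite for a \<open>w\<close> that is merely
  locally essentially bounded.
\<close>

definition sample_horizon :: "real \<Rightarrow> (real \<Rightarrow> real) \<Rightarrow> ereal" where
  "sample_horizon \<rho> w = (SUP i. ereal (sample_time \<rho> w i))"

text \<open>
  Solution on \<open>[0,T)\<close> in the sense of Caratheodory: on each sampling interval the state is
  absolutely continuous and the differential equation holds almost everywhere, expressed by
  the equivalent integral equation.
\<close>

definition sd_solution ::
  "('d \<Rightarrow> rvec \<Rightarrow> rvec \<Rightarrow> rvec) \<Rightarrow> nat \<Rightarrow> real \<Rightarrow> (real \<Rightarrow> 'd) \<Rightarrow> (real \<Rightarrow> real)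
    \<Rightarrow> rvec \<Rightarrow> ereal \<Rightarrow> (real \<Rightarrow> rvec) \<Rightarrow> bool" where
  "sd_solution F N \<rho> d w \<xi>0 T \<xi> \<longleftrightarrow>
     0 < T \<and> T \<le> sample_horizon \<rho> w \<and> \<xi> 0 = \<xi>0 \<and>
     (\<forall>t. 0 \<le> t \<and> ereal t < T \<longrightarrow> \<xi> t \<in> carrier_vec N) \<and>
     (\<forall>i t j. sample_time \<rho> w i \<le> t \<and> t \<le> sample_time \<rho> w (Suc i) \<and> ereal t < T \<and> j < N \<longrightarrow>
        (let f = (\<lambda>s. F (d s) (\<xi> s) (\<xi> (sample_time \<rho> w i)) $ j) in
           f absolutely_integrable_on {sample_time \<rho> w i..t} \<and>
           \<xi> t $ j = \<xi> (sample_time \<rho> w i) $ j + integral {sample_time \<rho> w i..t} f))"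

text \<open>
  The first conjunct is the requirement, implicit in
  evaluating \<open>\<xi>(t,\<xi>\<^sub>0,d,w)\<close> for all \<open>t \<ge> 0\<close>, that no solution ceases to exist
  (\<open>sample_horizon \<rho> w\<close> is infinite unless the sampling times accumulate).
  The estimates are demanded of every solution, on whatever interval \<open>[0,T)\<close> it is given.
\<close>

definition RGAS ::
  "('d::euclidean_space \<Rightarrow> rvec \<Rightarrow> rvec \<Rightarrow> rvec) \<Rightarrow> nat \<Rightarrow> real \<Rightarrow> 'd set \<Rightarrow> bool" where
  "RGAS F N \<rho> D \<longleftrightarrow>
     (\<forall>\<xi>0\<in>carrier_vec N. \<forall>d\<in>Linf_loc D. \<forall>w\<in>Linf_loc {0..}.
        \<exists>\<xi>. sd_solution F N \<rho> d w \<xi>0 (sample_horizon \<rho> w) \<xi>) \<and>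
     (\<forall>\<epsilon>>0. bdd_above {vnorm (\<xi> t) | \<xi> t \<xi>0 d w T.
        0 \<le> t \<and> ereal t < T \<and> \<xi>0 \<in> carrier_vec N \<and> vnorm \<xi>0 \<le> \<epsilon> \<and>
        d \<in> Linf_loc D \<and> w \<in> Linf_loc {0..} \<and> sd_solution F N \<rho> d w \<xi>0 T \<xi>}) \<and>
     (\<forall>\<epsilon>>0. \<exists>\<delta>>0. \<forall>\<xi>0\<in>carrier_vec N. vnorm \<xi>0 \<le> \<delta> \<longrightarrow>
        (\<forall>d\<in>Linf_loc D. \<forall>w\<in>Linf_loc {0..}. \<forall>T \<xi>. sd_solution F N \<rho> d w \<xi>0 T \<xi> \<longrightarrow>
           (\<forall>t\<ge>0. ereal t < T \<longrightarrow> vnorm (\<xi> t) \<le> \<epsilon>))) \<and>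
     (\<forall>\<epsilon>>0. \<forall>R0\<ge>0. \<exists>\<tau>\<ge>0. \<forall>\<xi>0\<in>carrier_vec N. vnorm \<xi>0 \<le> R0 \<longrightarrow>
        (\<forall>d\<in>Linf_loc D. \<forall>w\<in>Linf_loc {0..}. \<forall>T \<xi>. sd_solution F N \<rho> d w \<xi>0 T \<xi> \<longrightarrow>
           (\<forall>t\<ge>\<tau>. ereal t < T \<longrightarrow> vnorm (\<xi> t) \<le> \<epsilon>)))"


text \<open>\<open>\<Delta>\<close> is the Euclidean distance of \<open>D \<times> \<real>\<^sup>m \<times> \<real>\<close>.\<close>

definition locally_Lipschitz ::
  "'d::euclidean_space set \<Rightarrow> nat \<Rightarrow> ('d \<Rightarrow> rvec \<Rightarrow> real \<Rightarrow> real) \<Rightarrow> bool" where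
  "locally_Lipschitz D m h \<longleftrightarrow>
     (let \<Delta> = (\<lambda>d y u d' y' u'. sqrt ((dist d d')\<^sup>2 + (vnorm (y - y'))\<^sup>2 + (u - u')\<^sup>2)) in
      \<forall>d0\<in>D. \<forall>y0\<in>carrier_vec m. \<forall>u0. \<exists>\<epsilon>>0. \<exists>C.
        \<forall>d\<in>D. \<forall>d'\<in>D. \<forall>y\<in>carrier_vec m. \<forall>y'\<in>carrier_vec m. \<forall>u u'.
          \<Delta> d y u d0 y0 u0 < \<epsilon> \<and> \<Delta> d' y' u' d0 y0 u0 < \<epsilon> \<longrightarrow>
          \<bar>h d y u - h d' y' u'\<bar> \<le> C * \<Delta> d y u d' y' u')"

text \<open>\<open>DL m\<close> is the \<open>m\<close>-th derivative, one-sided at 0.\<close>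

definition smooth_on_nonneg :: "(real \<Rightarrow> real) \<Rightarrow> bool" where
  "smooth_on_nonneg L \<longleftrightarrow> (\<exists>DL. (\<forall>s\<ge>0. DL 0 s = L s) \<and>
     (\<forall>m::nat. \<forall>s\<ge>0. (DL m has_real_derivative DL (Suc m) s) (at s within {0..})))"

text \<open>
  Right-hand side of the closed loop, as a function of the disturbance, the current state
  and the last sampled state; component \<open>j\<close> is the equation for \<open>x\<^sub>j\<^sub>+\<^sub>1\<close>.
\<close>

definition closed_loop ::
  "nat \<Rightarrow> (nat \<Rightarrow> 'd \<Rightarrow> rvec \<Rightarrow> real \<Rightarrow> real) \<Rightarrow> (rvec \<Rightarrow> real)
    \<Rightarrow> 'd \<Rightarrow> rvec \<Rightarrow> rvec \<Rightarrow> rvec" where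
  "closed_loop n g k d x xs = Matrix.vec n (\<lambda>j.
     if j = 0 then k xs else x $ (j - 1) + g (j + 1) d (vec_first x j) (k xs))"


definition pos_def :: "nat \<Rightarrow> rmat \<Rightarrow> bool" where
  "pos_def m M \<longleftrightarrow> M \<in> carrier_mat m m \<and> (\<forall>v\<in>carrier_vec m. v \<noteq> 0\<^sub>v m \<longrightarrow> v \<bullet> (M *\<^sub>v v) > 0)"

definition neg_def :: "nat \<Rightarrow> rmat \<Rightarrow> bool" where
  "neg_def m M \<longleftrightarrow> M \<in> carrier_mat m m \<and> (\<forall>v\<in>carrier_vec m. v \<noteq> 0\<^sub>v m \<longrightarrow> v \<bullet> (M *\<^sub>v v) < 0)"

definition Qmat :: "nat \<Rightarrow> nat \<Rightarrow> rmat" where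
  "Qmat n i = Matrix.mat i n (\<lambda>(k, j). if k = j then 1 else 0)"

definition Amat :: "nat \<Rightarrow> rmat" where
  "Amat i = Matrix.mat i i (\<lambda>(k, j). if k = Suc j then 1 else 0)"

definition bvec :: "nat \<Rightarrow> rvec" where
  "bvec i = unit_vec i 0"

text \<open>The matrix \<open>u v'\<close> of two column vectors of dimension \<open>m\<close>.\<close>

definition outer :: "nat \<Rightarrow> rvec \<Rightarrow> rvec \<Rightarrow> rmat" where
  "outer m u v = mat_of_cols m [u] * mat_of_rows m [v]"

definition lyap_mat :: "nat \<Rightarrow> rmat \<Rightarrow> rvec \<Rightarrow> rmat" where
  "lyap_mat i P p = P * (Amat i + outer i (bvec i) p)
     + ((Amat i)\<^sup>T + outer i p (bvec i)) * P"

text \<open>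
  \<open>mat_inverse\<close> returns an option; the inverse exists whenever \<open>lyap_mat i P p\<close> is
  negative definite for a symmetric positive definite \<open>P\<close>.
\<close>

definition cvec :: "nat \<Rightarrow> rvec \<Rightarrow> rvec" where
  "cvec i p = - (the (mat_inverse ((Amat i)\<^sup>T + outer i p (bvec i))) *\<^sub>v unit_vec i (i - 1))"

definition feedback ::
  "nat \<Rightarrow> real \<Rightarrow> (nat \<Rightarrow> real) \<Rightarrow> (nat \<Rightarrow> real) \<Rightarrow> (nat \<Rightarrow> real) \<Rightarrow> (nat \<Rightarrow> rmat)
    \<Rightarrow> (nat \<Rightarrow> rvec) \<Rightarrow> rvec \<Rightarrow> real" where
  "feedback n K0 K R \<omega> P p x =
     (let q = (\<lambda>i. x \<bullet> (((Qmat n i)\<^sup>T * P i * Qmat n i) *\<^sub>v x)) in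
      if Min ((\<lambda>l. q l - (R l)\<^sup>2) ` {1..n - 1}) \<ge> 0
      then - K0 * sat (\<omega> 0 * x $ 0)
      else let i = Max {i \<in> {1..n - 1}. q i < (R i)\<^sup>2}; c = cvec i (p i); Q = Qmat n i in
           p i \<bullet> (Q *\<^sub>v x) - K i * (c \<bullet> bvec i) * sat (\<omega> i * (x $ i + c \<bullet> (Q *\<^sub>v x))))"

end

theory Submission
  imports Defs "Jordan_Normal_Form.Determinant"
begin

text \<open>
  The active stage never decreases: if \<open>x'Q\<^sub>i'P\<^sub>iQ\<^sub>ix < R\<^sub>i\<^sup>2\<close> holds at a sampling time, it holds at the
  next one, provided \<open>R\<^sub>i\<close> is a fixed multiple of a small \<open>K\<^sub>i\<close> and \<open>r\<close> is small. While stage \<open>i\<close> is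
  active, put \<open>z = Q\<^sub>ix\<close> and \<open>y = x\<^sub>i\<^sub>+\<^sub>1 + c\<^sub>i'z\<close>. The linearization gives \<open>y\<close> the derivative
  \<open>c\<^sub>i'b\<^sub>i v\<close>, where \<open>v = u - p\<^sub>i'z\<close>, and \<open>W = z'P\<^sub>iz + \<mu>K\<^sub>i\<Phi>(y)\<close>, with \<open>\<Phi>\<close> the Huber function whose derivative is
  \<open>sat(\<omega>\<^sub>iy)\<close>, decreases over a step of length \<open>h\<close> by at least \<open>h\<beta>(|z|\<^sup>2 + sat(\<omega>\<^sub>iy)\<^sup>2)\<close>. The nonlinearities are
  quadratic in \<open>(z, u)\<close>, and this vector is of order \<open>K\<^sub>i\<close> in the region of stage \<open>i\<close>, so they are
  absorbed. Outside the region of stage \<open>i + 1\<close> the dissipation is bounded below, so stage \<open>i\<close>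
  is left in finite time; in the last stage \<open>W\<close> is a Lyapunov function for the whole state.
\<close>

section \<open>Vectors as real sequences\<close>

text \<open>The delicate point is the order in which constants are fixed. Because \<open>v\<close>
  carries the factor \<open>K\<^sub>i\<close>, the function \<open>K\<^sub>i\<Phi>(y)\<close>
  contributes exactly \<open>-v\<^sup>2\<close> at first order, so \<open>\<mu>\<close> and the
  tolerated size of all errors do not depend on \<open>K\<^sub>i\<close>; only afterwards is
  \<open>K\<^sub>i\<close> taken so small that the whole region of stage i meets this tolerance.
  Stage i involves only the first i + 1 coordinates, so the stages are tuned independently, and r is
  a minimum of finitely many bounds. Sampled states are compared with an Euler step of length h. The
  error \<open>h C m (h + m)\<close>, with \<open>m = |z| + |u|\<close>, is proportional to m;
  multiplied by a gradient it becomes quadratic and hence comparable with the dissipation. Decrease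
  is counted in elapsed time and not in steps, since steps may be arbitrarily short and sampling
  times may accumulate. The energy at the entry into a stage is bounded through the state over
  finite time, using that the control is bounded and the system triangular. States are sequences
  read up to a cutoff, so all stages read the same state without projections, and the sum norm gains
  one term per coordinate.\<close>

definition l1 :: "nat \<Rightarrow> (nat \<Rightarrow> real) \<Rightarrow> real" where
  "l1 i x = (\<Sum>k<i. \<bar>x k\<bar>)"

definition lin :: "nat \<Rightarrow> (nat \<Rightarrow> real) \<Rightarrow> (nat \<Rightarrow> real) \<Rightarrow> real" where
  "lin i p x = (\<Sum>k<i. p k * x k)"

definition bil :: "nat \<Rightarrow> (nat \<Rightarrow> nat \<Rightarrow> real) \<Rightarrow> (nat \<Rightarrow> real) \<Rightarrow> (nat \<Rightarrow> real) \<Rightarrow> real" where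
  "bil i P x y = (\<Sum>k<i. \<Sum>l<i. P k l * x k * y l)"

text \<open>The linear part of (S): a chain of integrators driven by \<open>u\<close>. For
  \<open>u = lin i p x\<close> its first \<open>i\<close> entries are those of
  \<open>A\<^sub>i + b\<^sub>i p\<^sub>i'\<close> applied to \<open>x\<close>.\<close>

definition shift :: "real \<Rightarrow> (nat \<Rightarrow> real) \<Rightarrow> nat \<Rightarrow> real" where
  "shift u x j = (if j = 0 then u else x (j - 1))"

text \<open>Equal to \<open>\<omega> * y\<^sup>2 / 2\<close> where the saturation is inactive and to
  \<open>\<bar>y\<bar> - 1 / (2 * \<omega>)\<close> elsewhere. The form with \<open>sat\<close>
  joins the two cases and displays the proximal point
  \<open>y - sat (\<omega> * y) / \<omega>\<close>.\<close>

definition huber :: "real \<Rightarrow> real \<Rightarrow> real" where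
  "huber \<omega> y = (sat (\<omega> * y))\<^sup>2 / (2 * \<omega>) + \<bar>y - sat (\<omega> * y) / \<omega>\<bar>"

lemma l1_nonneg [simp]: "0 \<le> l1 i x"
  by (simp add: l1_def sum_nonneg)

lemma l1_0 [simp]: "l1 0 x = 0"
  by (simp add: l1_def)

lemma l1_Suc: "l1 (Suc i) x = l1 i x + \<bar>x i\<bar>"
  by (simp add: l1_def)

lemma l1_mono: "i \<le> j \<Longrightarrow> l1 i x \<le> l1 j x"
  unfolding l1_def by (rule sum_mono2) auto

lemma abs_le_l1: "k < i \<Longrightarrow> \<bar>x k\<bar> \<le> l1 i x"
  unfolding l1_def by (rule member_le_sum) auto

lemma l1_add: "l1 i (\<lambda>k. x k + y k) \<le> l1 i x + l1 i y"
  unfolding l1_def sum.distrib[symmetric] by (intro sum_mono) auto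

lemma l1_bound: "(\<And>k. k < i \<Longrightarrow> \<bar>x k\<bar> \<le> b) \<Longrightarrow> l1 i x \<le> real i * b"
  unfolding l1_def using sum_bounded_above[of "{..<i}" "\<lambda>k. \<bar>x k\<bar>" b] by simp

lemma l1_cong: "(\<And>k. k < i \<Longrightarrow> x k = y k) \<Longrightarrow> l1 i x = l1 i y"
  unfolding l1_def by (intro sum.cong) auto

lemma l1_shift: "l1 i (shift u x) \<le> l1 i x + \<bar>u\<bar>"
proof -
  have "l1 (Suc i) (shift u x) = \<bar>u\<bar> + l1 i x" for i
    by (induction i) (simp_all add: l1_Suc shift_def)
  moreover have "l1 i (shift u x) \<le> l1 (Suc i) (shift u x)"
    by (rule l1_mono) simp
  ultimately show ?thesis by simp
qed

lemma lin_0 [simp]: "lin 0 p x = 0"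
  by (simp add: lin_def)

lemma lin_add: "lin i p (\<lambda>k. x k + y k) = lin i p x + lin i p y"
  by (simp add: lin_def sum.distrib algebra_simps)

lemma lin_scale: "lin i p (\<lambda>k. t * x k) = t * lin i p x"
  by (simp add: lin_def sum_distrib_left algebra_simps)

lemma lin_cong: "(\<And>k. k < i \<Longrightarrow> x k = y k) \<Longrightarrow> lin i p x = lin i p y"
  unfolding lin_def by (intro sum.cong) auto

lemma lin_sup_bound:
  assumes "\<And>k. k < i \<Longrightarrow> \<bar>x k\<bar> \<le> b"
  shows "\<bar>lin i p x\<bar> \<le> l1 i p * b"
proof -
  have "\<bar>lin i p x\<bar> \<le> (\<Sum>k<i. \<bar>p k * x k\<bar>)" unfolding lin_def by (rule sum_abs)
  also have "\<dots> \<le> (\<Sum>k<i. \<bar>p k\<bar> * b)"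
    by (intro sum_mono) (auto simp: abs_mult intro!: mult_left_mono assms)
  finally show ?thesis by (simp add: l1_def sum_distrib_right)
qed

lemma lin_bound: "\<bar>lin i p x\<bar> \<le> l1 i p * l1 i x"
  by (rule lin_sup_bound) (rule abs_le_l1)

lemma bil_add_right: "bil i P x (\<lambda>k. y k + z k) = bil i P x y + bil i P x z"
  by (simp add: bil_def sum.distrib algebra_simps)

lemma bil_scale_right: "bil i P x (\<lambda>k. t * y k) = t * bil i P x y"
  by (simp add: bil_def sum_distrib_left algebra_simps)

lemma bil_add_left: "bil i P (\<lambda>k. y k + z k) x = bil i P y x + bil i P z x"
  by (simp add: bil_def sum.distrib algebra_simps)

lemma bil_scale_left: "bil i P (\<lambda>k. t * y k) x = t * bil i P y x"
  by (simp add: bil_def sum_distrib_left algebra_simps)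

lemma bil_cong:
  "(\<And>k. k < i \<Longrightarrow> x k = x' k) \<Longrightarrow> (\<And>k. k < i \<Longrightarrow> y k = y' k) \<Longrightarrow> bil i P x y = bil i P x' y'"
  unfolding bil_def by (intro sum.cong) auto

lemma bil_commute:
  assumes "\<And>k l. k < i \<Longrightarrow> l < i \<Longrightarrow> P k l = P l k"
  shows "bil i P x y = bil i P y x"
  unfolding bil_def by (subst sum.swap) (auto intro!: sum.cong simp: assms)

lemma bil_bound: "\<bar>bil i P x y\<bar> \<le> (\<Sum>k<i. l1 i (P k)) * l1 i x * l1 i y"
proof -
  have "bil i P x y = (\<Sum>k<i. x k * lin i (P k) y)"
    by (simp add: bil_def lin_def sum_distrib_left algebra_simps)
  then have "\<bar>bil i P x y\<bar> \<le> (\<Sum>k<i. \<bar>x k * lin i (P k) y\<bar>)" by simp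
  also have "\<dots> \<le> (\<Sum>k<i. l1 i x * (l1 i (P k) * l1 i y))"
    unfolding abs_mult by (intro sum_mono mult_mono lin_bound abs_le_l1) auto
  finally show ?thesis by (simp add: sum_distrib_left sum_distrib_right algebra_simps)
qed

text \<open>Compactness and homogeneity: \<open>q\<close> attains a positive minimum on the unit
  sphere of \<open>l1 i\<close>, and scaling carries it to all \<open>x\<close>. This turns the
  definiteness of \<open>P\<^sub>i\<close> and of the Lyapunov matrix into the quantitative
  constants of a stage.\<close>

lemma homogeneous_lower_bound:
  fixes q :: "(nat \<Rightarrow> real) \<Rightarrow> real"
  assumes cont: "continuous_on UNIV q"
    and hom: "\<And>t x. q (\<lambda>k. t * x k) = t\<^sup>2 * q x"
    and dep: "\<And>x y. (\<And>k. k < i \<Longrightarrow> x k = y k) \<Longrightarrow> q x = q y"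
    and pos: "\<And>x. \<exists>k<i. x k \<noteq> 0 \<Longrightarrow> 0 < q x"
  shows "\<exists>a>0. \<forall>x. a * (l1 i x)\<^sup>2 \<le> q x"
proof -
  have q0: "q x = 0" if "l1 i x = 0" for x
  proof -
    have "x k = 0" if "k < i" for k
      using abs_le_l1[OF that, of x] \<open>l1 i x = 0\<close> by simp
    then have "q x = q (\<lambda>k. 0 * x k)" by (intro dep) simp
    then show ?thesis using hom[of 0 x] by simp
  qed
  show ?thesis
  proof (cases "i = 0")
    case True
    then show ?thesis using q0 by (intro exI[of _ 1]) (auto simp: l1_def)
  next
    case False
    \<comment> \<open>All coordinates from \<open>i\<close> on are pinned to 0, so the box is
      compact in the product topology; by \<open>dep\<close> this loses no value of
      \<open>q\<close>.\<close>
    define B where "B = (\<Pi>\<^sub>E k\<in>UNIV. if k < i then {-1..1::real} else {0})"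
    define S where "S = B \<inter> {x. l1 i x = 1}"
    have "compactin (product_topology (\<lambda>_. euclidean) UNIV) B"
      unfolding B_def compactin_PiE by (auto simp: compactin_euclidean_iff)
    then have "compact B"
      by (simp add: euclidean_product_topology compactin_euclidean_iff)
    moreover have "closed {x. l1 i x = 1}"
      unfolding l1_def
      by (intro closed_Collect_eq continuous_intros continuous_on_product_coordinates)
    ultimately have S: "compact S" unfolding S_def by (rule compact_Int_closed)
    have "l1 i (\<lambda>k. if k = 0 then 1 else 0) = 1"
      using False by (auto simp: l1_def if_distrib cong: if_cong)
    then have "(\<lambda>k. if k = 0 then 1 else 0) \<in> S"
      using False by (auto simp: S_def B_def)
    then have "S \<noteq> {}" by blast
    then obtain x0 where x0: "x0 \<in> S" "\<And>y. y \<in> S \<Longrightarrow> q x0 \<le> q y"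
      using continuous_attains_inf[OF S _ continuous_on_subset[OF cont]] by auto
    have "\<exists>k<i. x0 k \<noteq> 0"
    proof (rule ccontr)
      assume "\<not> ?thesis"
      then have "l1 i x0 = 0" by (simp add: l1_def)
      with x0(1) show False by (simp add: S_def)
    qed
    then have q: "0 < q x0" by (rule pos)
    have "q x0 * (l1 i x)\<^sup>2 \<le> q x" for x
    proof (cases "l1 i x = 0")
      case True
      then show ?thesis using q0 by simp
    next
      case False
      then have N: "0 < l1 i x" by (simp add: less_le)
      define y where "y k = (if k < i then inverse (l1 i x) * x k else 0)" for k
      have "l1 i y = inverse (l1 i x) * l1 i x"
        unfolding l1_def[of i y] l1_def[of i x] sum_distrib_left
        by (intro sum.cong) (use N in \<open>auto simp: y_def abs_mult l1_def[symmetric]\<close>)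
      then have l: "l1 i y = 1" using N by simp
      then have "\<bar>y k\<bar> \<le> 1" if "k < i" for k using abs_le_l1[OF that, of y] by simp
      then have "y \<in> S"
        unfolding S_def B_def using l by (auto simp: abs_le_iff y_def)
      then have "q x0 \<le> q y" by (rule x0(2))
      also have "q y = q (\<lambda>k. inverse (l1 i x) * x k)" by (intro dep) (simp add: y_def)
      also have "\<dots> = q x / (l1 i x)\<^sup>2" unfolding hom by (simp add: field_simps)
      finally show ?thesis using N by (simp add: field_simps)
    qed
    then show ?thesis using q by blast
  qed
qed

section \<open>Saturation and the Huber function\<close>

lemma sat_id: "\<bar>s\<bar> \<le> 1 \<Longrightarrow> sat s = s"
  by (simp add: sat_def)

lemma sat_ge: "1 \<le> s \<Longrightarrow> sat s = 1"
  by (simp add: sat_def)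

lemma sat_le: "s \<le> -1 \<Longrightarrow> sat s = -1"
  by (simp add: sat_def)

lemma abs_sat_le_1: "\<bar>sat s\<bar> \<le> 1"
  by (simp add: sat_def)

lemma abs_sat_le: "\<bar>sat s\<bar> \<le> \<bar>s\<bar>"
  using abs_sat_le_1[of s] sat_id[of s] by fastforce

lemma sat_small: "\<bar>sat s\<bar> < 1 \<Longrightarrow> sat s = s"
  using sat_ge[of s] sat_le[of s] sat_id[of s] by linarith

text \<open>The Huber function is the Moreau envelope of the absolute value.\<close>

lemma huber_le_envelope:
  assumes "0 < \<omega>"
  shows "huber \<omega> y \<le> \<omega> / 2 * (y - q)\<^sup>2 + \<bar>q\<bar>"
proof -
  have sq: "t \<le> \<omega> / 2 * t\<^sup>2 + 1 / (2 * \<omega>)" for t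
  proof -
    have "0 \<le> (\<omega> * t - 1)\<^sup>2 / (2 * \<omega>)" using assms by simp
    also have "\<dots> = \<omega> / 2 * t\<^sup>2 + 1 / (2 * \<omega>) - t"
      using assms by (simp add: field_simps power2_eq_square)
    finally show ?thesis by simp
  qed
  consider "\<bar>\<omega> * y\<bar> \<le> 1" | "1 \<le> \<omega> * y" | "\<omega> * y \<le> -1" by linarith
  then show ?thesis
  proof cases
    case 1
    then have h: "huber \<omega> y = \<omega> / 2 * y\<^sup>2"
      using assms by (simp add: huber_def sat_id power2_eq_square)
    have "\<omega> * y * q \<le> \<bar>\<omega> * y\<bar> * \<bar>q\<bar>" by (metis abs_ge_self abs_mult)
    also have "\<dots> \<le> \<bar>q\<bar>" using mult_right_mono[OF 1, of "\<bar>q\<bar>"] by simp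
    finally have "\<omega> * y * q \<le> \<bar>q\<bar>" .
    moreover have "0 \<le> \<omega> / 2 * q\<^sup>2" using assms by simp
    moreover have "\<omega> / 2 * (y - q)\<^sup>2 = \<omega> / 2 * y\<^sup>2 - \<omega> * y * q + \<omega> / 2 * q\<^sup>2"
      by (simp add: power2_eq_square field_simps)
    ultimately show ?thesis using h by linarith
  next
    case 2
    then have "1 / \<omega> \<le> y" using assms by (simp add: field_simps)
    then have "huber \<omega> y = 1 / (2 * \<omega>) + y - 1 / \<omega>"
      using 2 by (simp add: huber_def sat_ge)
    also have "\<dots> = y - 1 / (2 * \<omega>)" using assms by (simp add: field_simps)
    finally show ?thesis using sq[of "y - q"] by linarith
  next
    case 3
    then have "y \<le> - (1 / \<omega>)" using assms by (simp add: field_simps)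
    then have "huber \<omega> y = 1 / (2 * \<omega>) - y - 1 / \<omega>"
      using 3 by (simp add: huber_def sat_le)
    also have "\<dots> = - y - 1 / (2 * \<omega>)" using assms by (simp add: field_simps)
    finally show ?thesis using sq[of "q - y"] by (simp add: power2_commute)
  qed
qed

text \<open>The descent inequality of a function with \<open>\<omega>\<close>-Lipschitz derivative,
  obtained without differentiating: the point that is optimal in the envelope at \<open>y\<close> is
  a competitor at \<open>y'\<close>.\<close>

lemma huber_step:
  assumes "0 < \<omega>"
  shows "huber \<omega> y' \<le> huber \<omega> y + sat (\<omega> * y) * (y' - y) + \<omega> / 2 * (y' - y)\<^sup>2"
proof -
  define S where "S = sat (\<omega> * y)"
  have "huber \<omega> y' \<le> \<omega> / 2 * (y' - (y - S / \<omega>))\<^sup>2 + \<bar>y - S / \<omega>\<bar>"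
    by (rule huber_le_envelope[OF assms])
  also have "\<omega> / 2 * (y' - (y - S / \<omega>))\<^sup>2 = \<omega> / 2 * (y' - y)\<^sup>2 + S * (y' - y) + S\<^sup>2 / (2 * \<omega>)"
    using assms by (simp add: power2_eq_square field_simps)
  finally show ?thesis by (simp add: huber_def S_def)
qed

lemma huber_ge_sat: "0 < \<omega> \<Longrightarrow> (sat (\<omega> * y))\<^sup>2 / (2 * \<omega>) \<le> huber \<omega> y"
  by (simp add: huber_def)

lemma huber_le_abs: "0 < \<omega> \<Longrightarrow> huber \<omega> y \<le> \<bar>y\<bar>"
  using huber_le_envelope[of \<omega> y y] by simp

section \<open>One sampling step with an active linear stage\<close>

text \<open>
  \<open>c\<close> is chosen such that \<open>y = x\<^sub>i + c\<cdot>x\<close> has the derivative \<open>c 0 * v\<close> along the linearization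
  when \<open>u = p\<cdot>x + v\<close>.
\<close>

locale stage =
  fixes i :: nat and P :: "nat \<Rightarrow> nat \<Rightarrow> real" and p c :: "nat \<Rightarrow> real" and \<omega> a aP :: real
  assumes i: "1 \<le> i" and sym: "\<And>k l. k < i \<Longrightarrow> l < i \<Longrightarrow> P k l = P l k"
    and \<omega>: "0 < \<omega>" and a: "0 < a" and aP: "0 < aP"
    and posP: "\<And>x. aP * (l1 i x)\<^sup>2 \<le> bil i P x x"
    and negP: "\<And>x. bil i P x (shift (lin i p x) x) \<le> - 2 * a * (l1 i x)\<^sup>2"
    and cM: "\<And>x. x (i - 1) + lin i c (shift (lin i p x) x) = 0"
    and c0: "c 0 \<noteq> 0"
begin

definition V :: "(nat \<Rightarrow> real) \<Rightarrow> real" where "V x = bil i P x x"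
definition y :: "(nat \<Rightarrow> real) \<Rightarrow> real" where "y x = x i + lin i c x"
definition bP :: real where "bP = (\<Sum>k<i. l1 i (P k))"

lemma bP_nonneg: "0 \<le> bP" by (simp add: bP_def sum_nonneg)

lemma V_le: "V x \<le> bP * (l1 i x)\<^sup>2"
  using bil_bound[of i P x x] by (simp add: V_def bP_def power2_eq_square algebra_simps)

text \<open>An Euler step with an error: expanding both parts of the energy leaves the linear closed
  loop, the input \<open>v\<close>, and remainders. All remainders are forced into the shape
  \<open>e * s\<^sup>2\<close> with \<open>s = l1 i x + \<bar>v\<bar>\<close>, so that a small
  \<open>e\<close> lets the dissipation absorb them. The two estimates stay separate because the
  weight of the second is still free.\<close>

lemma step_estimate:
  fixes C h e K u v m s C1 C8 :: real and x x' :: "nat \<Rightarrow> real"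
  assumes C: "0 \<le> C" and h: "0 < h" "h \<le> e" and K: "0 < K" "K \<le> 1" and e: "e \<le> 1"
    and u: "u = lin i p x + v" and v: "v = - K * c 0 * sat (\<omega> * y x)"
    and m: "m = l1 i x + \<bar>u\<bar>" "m \<le> e"
    and step: "\<And>j. j \<le> i \<Longrightarrow> \<bar>x' j - x j - h * shift u x j\<bar> \<le> h * (C * m * e)"
    and s: "s = l1 i x + \<bar>v\<bar>"
    and C1: "C1 = 1 + l1 i p" and C8: "C8 = C * (1 + l1 i c) * C1"
  shows "V x' \<le> V x + h * (- 4 * a * (l1 i x)\<^sup>2 + 2 * bP * l1 i x * \<bar>v\<bar>
            + (2 * bP * i * C * C1 + bP * (1 + i * C)\<^sup>2 * C1\<^sup>2) * e * s\<^sup>2)" (is ?V)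
    and "K * huber \<omega> (y x') \<le> K * huber \<omega> (y x)
            + h * (- v\<^sup>2 + (C8 / \<bar>c 0\<bar> + \<omega> / 2 * (\<bar>c 0\<bar> + C8)\<^sup>2) * e * s\<^sup>2)" (is ?H)
proof -
  \<comment> \<open>\<open>w\<close> is the mean velocity over the step, and \<open>E\<close> below
    its deviation from the linear field at the start.\<close>
  define w where "w j = (x' j - x j) / h" for j
  define E where "E j = w j - shift u x j" for j
  define b where "b j = (if j = 0 then 1 else 0 :: real)" for j :: nat
  define Mz where "Mz = shift (lin i p x) x"
  have x': "x' j = x j + h * w j" for j using h by (simp add: w_def)
  have E: "\<bar>E j\<bar> \<le> C * m * e" if "j \<le> i" for j
  proof -
    have "h * \<bar>E j\<bar> = \<bar>x' j - x j - h * shift u x j\<bar>"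
      using abs_mult[of h "E j"] h by (simp add: E_def x' right_diff_distrib)
    then have "h * \<bar>E j\<bar> \<le> h * (C * m * e)" using step[OF that] by simp
    then show ?thesis using h by simp
  qed
  have w: "w j = (Mz j + v * b j) + E j" for j
    by (simp add: E_def Mz_def shift_def b_def u)
  have s0: "0 \<le> s" "l1 i x \<le> s" "\<bar>v\<bar> \<le> s" and m0: "0 \<le> m" and e0: "0 \<le> e" using s m h by auto
  have C1': "1 \<le> C1" by (simp add: C1)
  have C8': "0 \<le> C8" using C C1' by (simp add: C8)
  \<comment> \<open>The step error is given in terms of \<open>u\<close>, the dissipation in terms
    of \<open>v\<close>; since \<open>u\<close> is linear feedback plus \<open>v\<close>, the
    exchange costs the factor \<open>C1\<close>.\<close>
  have ms: "m \<le> C1 * s"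
  proof -
    have "m \<le> l1 i x + l1 i p * l1 i x + \<bar>v\<bar>" using lin_bound[of i p x] m u by linarith
    also have "\<dots> = s + l1 i p * l1 i x" by (simp add: s)
    also have "\<dots> \<le> s + l1 i p * s" by (intro add_left_mono mult_left_mono s0) simp
    finally show ?thesis by (simp add: C1 algebra_simps)
  qed
  have lE: "l1 i E \<le> i * (C * m * e)" by (rule l1_bound) (simp add: E)
  have lw: "l1 i w \<le> (1 + i * C) * m"
  proof -
    have "w = (\<lambda>j. shift u x j + E j)" by (simp add: E_def fun_eq_iff)
    then have "l1 i w \<le> l1 i (shift u x) + l1 i E" using l1_add[of i "shift u x" E] by simp
    also have "\<dots> \<le> m + i * (C * m * e)" using l1_shift[of i u x] m lE by linarith
    also have "\<dots> \<le> m + i * (C * m * 1)" using e C m0 by (intro add_left_mono mult_left_mono) auto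
    finally show ?thesis by (simp add: algebra_simps)
  qed
  have lb: "l1 i b \<le> 1" using i by (simp add: l1_def b_def if_distrib cong: if_cong)
  show ?V
  proof -
    have "V x' = V x + h * (2 * bil i P x w) + h * (h * bil i P w w)"
      using bil_commute[where i=i and P=P and x=w and y=x, OF sym]
      by (simp add: V_def x'[abs_def] bil_add_right bil_add_left bil_scale_right bil_scale_left algebra_simps)
    moreover have "bil i P x w = bil i P x Mz + v * bil i P x b + bil i P x E"
      unfolding w[abs_def] bil_add_right bil_scale_right ..
    moreover have "bil i P x Mz \<le> - 2 * a * (l1 i x)\<^sup>2" unfolding Mz_def by (rule negP)
    moreover have "v * bil i P x b \<le> bP * l1 i x * \<bar>v\<bar>"
    proof -
      have "v * bil i P x b \<le> \<bar>v\<bar> * \<bar>bil i P x b\<bar>" by (metis abs_ge_self abs_mult)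
      also have "\<dots> \<le> \<bar>v\<bar> * (bP * l1 i x * l1 i b)"
        by (intro mult_left_mono) (simp_all add: bil_bound bP_def)
      also have "\<dots> \<le> \<bar>v\<bar> * (bP * l1 i x * 1)"
        using bP_nonneg by (intro mult_left_mono lb) auto
      finally show ?thesis by (simp add: algebra_simps)
    qed
    moreover have "bil i P x E \<le> bP * i * C * C1 * e * s\<^sup>2"
    proof -
      have "bil i P x E \<le> bP * l1 i x * l1 i E" using bil_bound[of i P x E] by (simp add: bP_def)
      also have "\<dots> \<le> bP * s * (i * (C * (C1 * s) * e))"
        using bP_nonneg s0 C m0 e0 ms lE C1'
        by (intro mult_mono order_trans[OF lE] mult_nonneg_nonneg) (auto intro: mult_left_mono mult_right_mono)
      finally show ?thesis by (simp add: power2_eq_square algebra_simps)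
    qed
    \<comment> \<open>The second-order term has a factor \<open>h\<close> to spare, and
      \<open>h \<le> e\<close> turns it into one more remainder.\<close>
    moreover have "h * bil i P w w \<le> bP * (1 + i * C)\<^sup>2 * C1\<^sup>2 * e * s\<^sup>2"
    proof -
      have "\<bar>bil i P w w\<bar> \<le> bP * l1 i w * l1 i w" using bil_bound[of i P w w] by (simp add: bP_def)
      also have "\<dots> = bP * (l1 i w)\<^sup>2" by (simp add: power2_eq_square)
      also have "\<dots> \<le> bP * ((1 + i * C) * (C1 * s))\<^sup>2"
        using bP_nonneg ms lw C
        by (intro mult_left_mono power_mono order_trans[OF lw]) auto
      finally have *: "\<bar>bil i P w w\<bar> \<le> bP * ((1 + i * C) * (C1 * s))\<^sup>2" .
      have "h * bil i P w w \<le> h * \<bar>bil i P w w\<bar>" using h by simp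
      also have "\<dots> \<le> e * (bP * ((1 + i * C) * (C1 * s))\<^sup>2)"
        using h e0 * by (intro mult_mono) auto
      finally show ?thesis unfolding power_mult_distrib by (simp only: mult_ac)
    qed
    ultimately have "V x' \<le> V x + h * (2 * (- 2 * a * (l1 i x)\<^sup>2 + bP * l1 i x * \<bar>v\<bar> + bP * i * C * C1 * e * s\<^sup>2))
          + h * (bP * (1 + i * C)\<^sup>2 * C1\<^sup>2 * e * s\<^sup>2)"
      using h by (intro order_trans[OF eq_refl add_mono[OF add_mono[OF order_refl mult_left_mono] mult_left_mono]]) auto
    then show ?thesis by (simp add: algebra_simps)
  qed
  show ?H
  proof -
    define S where "S = sat (\<omega> * y x)"
    define err where "err = E i + lin i c E"
    have vS: "v = - K * c 0 * S" by (simp add: v S_def)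
    have "lin i c (\<lambda>j. v * b j) = v * c 0"
      unfolding lin_scale using i by (simp add: lin_def b_def if_distrib cong: if_cong)
    then have linw: "lin i c w = lin i c Mz + v * c 0 + lin i c E"
      unfolding w[abs_def] lin_add by simp
    have wi: "w i = x (i - 1) + E i" using i by (simp add: E_def shift_def)
    have "y x' - y x = h * (w i + lin i c w)"
      by (simp add: y_def x'[abs_def] lin_add lin_scale algebra_simps)
    \<comment> \<open>By \<open>cM\<close> the drift \<open>x (i - 1)\<close> cancels against
      \<open>c\<close> applied to the closed loop, so that at first order \<open>y\<close> is driven
      by \<open>v\<close> alone.\<close>
    also have "w i + lin i c w = c 0 * v + err"
      using cM[of x] by (simp add: linw wi err_def Mz_def)
    finally have dy: "y x' - y x = h * (c 0 * v + err)" .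
    have err: "\<bar>err\<bar> \<le> C8 * e * s"
    proof -
      have "\<bar>lin i c E\<bar> \<le> l1 i c * (C * m * e)" by (rule lin_sup_bound) (simp add: E)
      then have "\<bar>err\<bar> \<le> (1 + l1 i c) * (C * m * e)"
        using E[of i] abs_triangle_ineq[of "E i" "lin i c E"] by (simp add: err_def algebra_simps)
      also have "\<dots> \<le> (1 + l1 i c) * (C * (C1 * s) * e)"
        using ms C e0 by (intro mult_left_mono mult_right_mono) auto
      finally show ?thesis by (simp add: C8 algebra_simps)
    qed
    \<comment> \<open>As \<open>K * S\<close> equals \<open>- v / c 0\<close>, this product is again
      quadratic in \<open>s\<close>, with a constant free of \<open>K\<close>.\<close>
    have t1: "K * S * err \<le> C8 / \<bar>c 0\<bar> * e * s\<^sup>2"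
    proof -
      have "K * S = - v / c 0" using c0 by (simp add: vS)
      then have "K * S * err \<le> \<bar>v\<bar> / \<bar>c 0\<bar> * \<bar>err\<bar>"
        using abs_ge_self[of "- v / c 0 * err"] by (simp add: abs_mult)
      also have "\<dots> \<le> s / \<bar>c 0\<bar> * (C8 * e * s)"
        using s0 err by (intro mult_mono divide_right_mono) auto
      finally show ?thesis by (simp add: power2_eq_square algebra_simps)
    qed
    have t2: "K * (\<omega> / 2) * (h * (c 0 * v + err)\<^sup>2) \<le> \<omega> / 2 * (\<bar>c 0\<bar> + C8)\<^sup>2 * e * s\<^sup>2"
    proof -
      have "\<bar>c 0 * v + err\<bar> \<le> \<bar>c 0\<bar> * \<bar>v\<bar> + \<bar>err\<bar>" using abs_triangle_ineq[of "c 0 * v" err] by (simp add: abs_mult)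
      also have "\<dots> \<le> \<bar>c 0\<bar> * s + C8 * 1 * s"
        using s0 e C8' by (intro add_mono mult_left_mono order_trans[OF err] mult_right_mono) auto
      finally have "\<bar>c 0 * v + err\<bar> \<le> (\<bar>c 0\<bar> + C8) * s" by (simp add: algebra_simps)
      then have "(c 0 * v + err)\<^sup>2 \<le> ((\<bar>c 0\<bar> + C8) * s)\<^sup>2" by (rule abs_le_square_iff[THEN iffD1, OF order_trans]) simp
      then have "h * (c 0 * v + err)\<^sup>2 \<le> e * ((\<bar>c 0\<bar> + C8) * s)\<^sup>2"
        using h e0 by (intro mult_mono) auto
      then have "K * (\<omega> / 2) * (h * (c 0 * v + err)\<^sup>2) \<le> 1 * (\<omega> / 2) * (e * ((\<bar>c 0\<bar> + C8) * s)\<^sup>2)"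
        using K \<omega> h by (intro mult_mono[OF mult_right_mono]) auto
      then show ?thesis unfolding power_mult_distrib by (simp add: mult_ac)
    qed
    have "K * huber \<omega> (y x') \<le> K * (huber \<omega> (y x) + S * (y x' - y x) + \<omega> / 2 * (y x' - y x)\<^sup>2)"
      using huber_step[OF \<omega>, of "y x'" "y x"] K by (intro mult_left_mono) (auto simp: S_def)
    also have "\<dots> = K * huber \<omega> (y x) + h * (K * S * c 0 * v + K * S * err + K * (\<omega> / 2) * (h * (c 0 * v + err)\<^sup>2))"
      unfolding dy by (simp add: power2_eq_square algebra_simps)
    also have "K * S * c 0 * v = - v\<^sup>2" by (simp add: vS power2_eq_square)
    also have "K * huber \<omega> (y x) + h * (- v\<^sup>2 + K * S * err + K * (\<omega> / 2) * (h * (c 0 * v + err)\<^sup>2))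
        \<le> K * huber \<omega> (y x) + h * (- v\<^sup>2 + C8 / \<bar>c 0\<bar> * e * s\<^sup>2 + \<omega> / 2 * (\<bar>c 0\<bar> + C8)\<^sup>2 * e * s\<^sup>2)"
      using h t1 t2 by (intro add_left_mono mult_left_mono) linarith+
    finally show ?thesis by (simp add: algebra_simps)
  qed
qed

text \<open>The quantifier order is the point: \<open>\<mu>\<close> and \<open>e0\<close> are fixed
  before \<open>K\<close>, so \<open>K\<close> may later be shrunk until the region of the stage
  satisfies the smallness condition. The estimate for \<open>V\<close> alone is kept because it, and
  not the full energy, yields the invariance of that region.\<close>

lemma energy_decrease:
  assumes C: "0 \<le> C"
  shows "\<exists>C4>0. \<exists>\<mu>>0. \<exists>e0>0. e0 \<le> 1 \<and> (\<forall>K h e u v m x x'.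
    0 < K \<longrightarrow> K \<le> 1 \<longrightarrow> 0 < h \<longrightarrow> h \<le> e \<longrightarrow> m \<le> e \<longrightarrow> e \<le> e0 \<longrightarrow> u = lin i p x + v \<longrightarrow>
    v = - K * c 0 * sat (\<omega> * y x) \<longrightarrow> m = l1 i x + \<bar>u\<bar> \<longrightarrow>
    (\<forall>j\<le>i. \<bar>x' j - x j - h * shift u x j\<bar> \<le> h * (C * m * e)) \<longrightarrow>
      V x' \<le> V x + h * (- 2 * a * (l1 i x)\<^sup>2 + C4 * v\<^sup>2) \<and>
      V x' + \<mu> * (K * huber \<omega> (y x')) \<le>
        V x + \<mu> * (K * huber \<omega> (y x)) - h * (a * (l1 i x)\<^sup>2 + v\<^sup>2 / 2))"
proof -
  define C1 where "C1 = 1 + l1 i p"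
  define C8 where "C8 = C * (1 + l1 i c) * C1"
  define C7 where "C7 = 2 * bP * i * C * C1 + bP * (1 + i * C)\<^sup>2 * C1\<^sup>2"
  define C12 where "C12 = C8 / \<bar>c 0\<bar> + \<omega> / 2 * (\<bar>c 0\<bar> + C8)\<^sup>2"
  \<comment> \<open>\<open>bP\<^sup>2 / a\<close> is the price of Young's inequality for the cross
    term between \<open>x\<close> and \<open>v\<close>, and \<open>a\<close> that of the remainder.
    One unit more in \<open>\<mu>\<close> leaves \<open>- v\<^sup>2 / 2\<close> after the Huber
    remainder has taken its half.\<close>
  define C4 where "C4 = a + bP\<^sup>2 / a"
  define \<mu> where "\<mu> = C4 + 1"
  define b where "b = min a (1 / 2)"
  \<comment> \<open>With \<open>N = l1 i x\<close>, at this size the remainder of \<open>V\<close>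
    costs at most \<open>a * N\<^sup>2 + a * v\<^sup>2\<close> and that of the weighted Huber term
    at most \<open>a * N\<^sup>2 + v\<^sup>2 / 2\<close>; the minimum \<open>b\<close> serves both
    summands of the latter.\<close>
  define e0 where "e0 = min 1 (min (a / (2 * (C7 + 1))) (b / (2 * \<mu> * (C12 + 1))))"
  have C4: "0 < C4" unfolding C4_def by (intro add_pos_nonneg a divide_nonneg_pos) auto
  then have \<mu>: "0 < \<mu>" by (simp add: \<mu>_def)
  have C1: "0 \<le> C1" by (simp add: C1_def)
  then have C8: "0 \<le> C8" using C by (simp add: C8_def)
  have C7: "0 \<le> C7" unfolding C7_def using bP_nonneg C C1 by simp
  have C12: "0 \<le> C12" unfolding C12_def using C8 \<omega> by simp
  have b: "0 < b" "b \<le> a" "b \<le> 1 / 2" using a by (auto simp: b_def)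
  have e0: "0 < e0" unfolding e0_def using a b \<mu> C7 C12 by simp
  show ?thesis
  proof (rule exI[of _ C4], rule conjI[OF C4], rule exI[of _ \<mu>], rule conjI[OF \<mu>],
      rule exI[of _ e0], intro conjI e0 allI impI)
    show "e0 \<le> 1" by (simp add: e0_def)
  next
    fix K h e u v m x x'
    assume *: "0 < K" "K \<le> 1" "0 < h" "h \<le> e" "m \<le> e" "e \<le> e0" "u = lin i p x + v"
      "v = - K * c 0 * sat (\<omega> * y x)" "m = l1 i x + \<bar>u\<bar>"
      "\<forall>j\<le>i. \<bar>x' j - x j - h * shift u x j\<bar> \<le> h * (C * m * e)"
    define N where "N = l1 i x"
    define s where "s = N + \<bar>v\<bar>"
    have e1: "e \<le> 1" and e7: "e \<le> a / (2 * (C7 + 1))" and e12: "e \<le> b / (2 * \<mu> * (C12 + 1))"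
      using * by (auto simp: e0_def)
    have e: "0 < e" using * by simp
    note est = step_estimate[OF C \<open>0 < h\<close> \<open>h \<le> e\<close> \<open>0 < K\<close> \<open>K \<le> 1\<close> e1 *(7,8,9,5) _ s_def[unfolded N_def] C1_def C8_def]
    have V1: "V x' \<le> V x + h * (- 4 * a * N\<^sup>2 + 2 * bP * N * \<bar>v\<bar> + C7 * e * s\<^sup>2)"
      unfolding N_def C7_def using *(10) by (intro est(1)) auto
    have H1: "K * huber \<omega> (y x') \<le> K * huber \<omega> (y x) + h * (- v\<^sup>2 + C12 * e * s\<^sup>2)"
      unfolding C12_def using *(10) by (intro est(2)) auto
    have s2: "s\<^sup>2 \<le> 2 * (N\<^sup>2 + v\<^sup>2)"
      using sum_squares_bound[of N "\<bar>v\<bar>"] by (simp add: s_def power2_sum)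
    have "(C7 + 1) * e \<le> a / 2" using e7 C7 by (simp add: field_simps)
    then have "C7 * e \<le> a / 2" using e by (simp add: algebra_simps)
    then have "C7 * e * s\<^sup>2 \<le> a / 2 * (2 * (N\<^sup>2 + v\<^sup>2))"
      using a by (intro mult_mono s2) auto
    then have t7: "C7 * e * s\<^sup>2 \<le> a * N\<^sup>2 + a * v\<^sup>2" by (simp add: algebra_simps)
    have "0 < 2 * \<mu> * (C12 + 1)" using C12 \<mu> by simp
    then have "e * (2 * \<mu> * (C12 + 1)) \<le> b" using e12 by (simp only: pos_le_divide_eq)
    then have "\<mu> * (C12 + 1) * e \<le> b / 2" by (simp add: algebra_simps)
    moreover have "0 \<le> \<mu> * e" using \<mu> e by simp
    ultimately have "\<mu> * C12 * e \<le> b / 2" by (simp add: algebra_simps)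
    then have "\<mu> * C12 * e * s\<^sup>2 \<le> b / 2 * (2 * (N\<^sup>2 + v\<^sup>2))"
      using b by (intro mult_mono s2) auto
    also have "\<dots> = b * N\<^sup>2 + b * v\<^sup>2" by (simp add: algebra_simps)
    also have "\<dots> \<le> a * N\<^sup>2 + 1 / 2 * v\<^sup>2" using b by (intro add_mono mult_right_mono) auto
    finally have t12: "\<mu> * C12 * e * s\<^sup>2 \<le> a * N\<^sup>2 + 1 / 2 * v\<^sup>2" .
    have "0 \<le> (a * N - bP * \<bar>v\<bar>)\<^sup>2 / a" using a by simp
    also have "\<dots> = a * N\<^sup>2 + bP\<^sup>2 / a * v\<^sup>2 - 2 * bP * N * \<bar>v\<bar>"
      using a by (simp add: power2_eq_square field_simps)
    finally have t: "2 * bP * N * \<bar>v\<bar> \<le> a * N\<^sup>2 + bP\<^sup>2 / a * v\<^sup>2" by simp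
    have "- 4 * a * N\<^sup>2 + 2 * bP * N * \<bar>v\<bar> + C7 * e * s\<^sup>2 \<le> - 2 * a * N\<^sup>2 + C4 * v\<^sup>2"
      using t t7 by (simp add: C4_def algebra_simps)
    then have "h * (- 4 * a * N\<^sup>2 + 2 * bP * N * \<bar>v\<bar> + C7 * e * s\<^sup>2) \<le> h * (- 2 * a * N\<^sup>2 + C4 * v\<^sup>2)"
      using * by (intro mult_left_mono) auto
    with V1 show V2: "V x' \<le> V x + h * (- 2 * a * (l1 i x)\<^sup>2 + C4 * v\<^sup>2)" by (simp add: N_def)
    have "\<mu> * (K * huber \<omega> (y x')) \<le> \<mu> * (K * huber \<omega> (y x) + h * (- v\<^sup>2 + C12 * e * s\<^sup>2))"
      using \<mu> by (intro mult_left_mono H1) auto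
    also have "\<dots> = \<mu> * (K * huber \<omega> (y x)) + h * (\<mu> * C12 * e * s\<^sup>2 - \<mu> * v\<^sup>2)"
      by (simp add: algebra_simps)
    also have "\<dots> \<le> \<mu> * (K * huber \<omega> (y x)) + h * (a * N\<^sup>2 + 1 / 2 * v\<^sup>2 - \<mu> * v\<^sup>2)"
      using t12 * by (intro add_left_mono mult_left_mono) auto
    finally have "V x' + \<mu> * (K * huber \<omega> (y x')) \<le>
        V x + \<mu> * (K * huber \<omega> (y x)) + h * (- 2 * a * N\<^sup>2 + C4 * v\<^sup>2) + h * (a * N\<^sup>2 + 1 / 2 * v\<^sup>2 - \<mu> * v\<^sup>2)"
      using V2 by (simp add: N_def)
    then show "V x' + \<mu> * (K * huber \<omega> (y x')) \<le>
        V x + \<mu> * (K * huber \<omega> (y x)) - h * (a * (l1 i x)\<^sup>2 + v\<^sup>2 / 2)"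
      by (simp add: \<mu>_def N_def algebra_simps)
  qed
qed

end

text \<open>Together with the exact formula for the first coordinate, this is all that the Lyapunov
  argument learns from continuous time. Only the coordinates before \<open>i\<close> enter the size
  of the error, although coordinate \<open>i\<close> is estimated too. Nothing is asserted for large
  data, where the growth function gives no uniform constant.\<close>

definition close_step :: "real \<Rightarrow> nat \<Rightarrow> real \<Rightarrow> real \<Rightarrow> (nat \<Rightarrow> real) \<Rightarrow> (nat \<Rightarrow> real) \<Rightarrow> bool" where
  "close_step C i h u x x' \<longleftrightarrow> l1 i x + \<bar>u\<bar> \<le> 1 \<longrightarrow>
     (\<forall>j\<le>i. \<bar>x' j - x j - h * shift u x j\<bar> \<le> h * (C * (l1 i x + \<bar>u\<bar>) * (h + (l1 i x + \<bar>u\<bar>))))"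

text \<open>Up to a constant, the rate at which an active stage loses energy. Because of the
  saturation it stays bounded when \<open>x i\<close> alone grows, so far from 0 the guaranteed rate
  does not grow with the energy.\<close>

definition diss :: "nat \<Rightarrow> (nat \<Rightarrow> real) \<Rightarrow> real \<Rightarrow> (nat \<Rightarrow> real) \<Rightarrow> real" where
  "diss i c \<omega> x = (l1 i x)\<^sup>2 + (sat (\<omega> * (x i + lin i c x)))\<^sup>2"

lemma diss_nonneg: "0 \<le> diss i c \<omega> x"
  by (simp add: diss_def)

text \<open>A dissipation below 1 means that the saturation is inactive, so \<open>y\<close> is
  small, and \<open>x i\<close> is recovered from \<open>y\<close> and the earlier coordinates. The
  contrapositive is used as well: where the state is not small, the dissipation has a positive lower
  bound.\<close>

lemma diss_small:
  assumes "0 < \<omega>" "0 < \<epsilon>"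
  shows "\<exists>\<epsilon>'>0. \<forall>x. diss i c \<omega> x \<le> \<epsilon>' \<longrightarrow> l1 (Suc i) x \<le> \<epsilon>"
proof -
  define B where "B = 1 + 1 / \<omega> + l1 i c"
  have B: "0 < B" unfolding B_def using assms by (intro add_pos_nonneg) auto
  define s where "s = min (1 / 2) (\<epsilon> / B)"
  have s: "0 < s" "s < 1" "s * B \<le> \<epsilon>"
    using assms B by (auto simp: s_def min_def field_simps)
  show ?thesis
  proof (intro exI[of _ "s\<^sup>2"] conjI allI impI)
    fix x assume d: "diss i c \<omega> x \<le> s\<^sup>2"
    define y where "y = x i + lin i c x"
    have "(l1 i x)\<^sup>2 \<le> s\<^sup>2" using d unfolding diss_def by (smt (verit) zero_le_power2)
    then have N: "l1 i x \<le> s" using s by (simp add: power2_le_iff_abs_le)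
    have "(sat (\<omega> * y))\<^sup>2 \<le> s\<^sup>2" using d unfolding diss_def y_def by (smt (verit) zero_le_power2)
    then have S: "\<bar>sat (\<omega> * y)\<bar> \<le> s" using s by (simp add: power2_le_iff_abs_le)
    then have "sat (\<omega> * y) = \<omega> * y" using s by (intro sat_small) simp
    then have y: "\<bar>y\<bar> \<le> s * (1 / \<omega>)" using S assms by (simp add: abs_mult field_simps)
    have "\<bar>lin i c x\<bar> \<le> l1 i c * s"
      using lin_bound[of i c x] N by (meson l1_nonneg mult_left_mono order_trans)
    then have "\<bar>x i\<bar> \<le> s * (1 / \<omega>) + l1 i c * s" using y by (simp add: y_def)
    then have "l1 (Suc i) x \<le> s * B" using N by (simp add: l1_Suc B_def algebra_simps)
    then show "l1 (Suc i) x \<le> \<epsilon>" using s by simp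
  qed (use s in simp)
qed

section \<open>Choice of gain, region and step bound for one stage\<close>

context stage
begin

text \<open>Order of choice: \<open>M = R / K\<close> from balancing two rates on the boundary of
  the region, then \<open>K\<close> from the smallness condition of \<open>energy_decrease\<close>,
  then \<open>r\<close>. Both \<open>R\<close> and the bound on the saturated input scale with
  \<open>K\<close>, so shrinking \<open>K\<close> leaves the balance intact.\<close>

lemma stage_parameters:
  assumes C: "0 \<le> C"
  shows "\<exists>K>0. \<exists>R>0. \<exists>r>0. \<exists>\<beta>>0. \<exists>Cw. \<exists>W.
    (\<forall>x. \<beta> * diss i c \<omega> x \<le> W x \<and> W x \<le> Cw * ((l1 (Suc i) x)\<^sup>2 + l1 (Suc i) x)) \<and>
    (\<forall>h u x x'. 0 < h \<longrightarrow> h \<le> r \<longrightarrow> bil i P x x < R\<^sup>2 \<longrightarrow>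
       u = lin i p x - K * c 0 * sat (\<omega> * (x i + lin i c x)) \<longrightarrow> close_step C i h u x x' \<longrightarrow>
       bil i P x' x' < R\<^sup>2 \<and> W x' \<le> W x - h * (\<beta> * diss i c \<omega> x))"
proof -
  obtain C4 \<mu> e0 where C4: "0 < C4" and \<mu>: "0 < \<mu>" and e0: "0 < e0" "e0 \<le> 1"
    and dec': "\<forall>K h e u v m x x'. 0 < K \<longrightarrow> K \<le> 1 \<longrightarrow> 0 < h \<longrightarrow> h \<le> e \<longrightarrow> m \<le> e \<longrightarrow> e \<le> e0 \<longrightarrow>
      u = lin i p x + v \<longrightarrow> v = - K * c 0 * sat (\<omega> * y x) \<longrightarrow> m = l1 i x + \<bar>u\<bar> \<longrightarrow>
      (\<forall>j\<le>i. \<bar>x' j - x j - h * shift u x j\<bar> \<le> h * (C * m * e)) \<longrightarrow>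
      V x' \<le> V x + h * (- 2 * a * (l1 i x)\<^sup>2 + C4 * v\<^sup>2) \<and>
      V x' + \<mu> * (K * huber \<omega> (y x')) \<le>
        V x + \<mu> * (K * huber \<omega> (y x)) - h * (a * (l1 i x)\<^sup>2 + v\<^sup>2 / 2)"
    using energy_decrease[OF C] by (elim exE conjE) (rule that)
  note dec = dec'[THEN spec, THEN spec, THEN spec, THEN spec, THEN spec, THEN spec, THEN spec, THEN spec,
      THEN mp, THEN mp, THEN mp, THEN mp, THEN mp, THEN mp, THEN mp, THEN mp, THEN mp, THEN mp]
  \<comment> \<open>The \<open>+ 1\<close> only ensures positivity, since \<open>CV\<close> is a
    divisor below.\<close>
  define CV where "CV = bP + 1"
  have CV: "0 < CV" using bP_nonneg by (simp add: CV_def)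
  have VCV: "V x \<le> CV * (l1 i x)\<^sup>2" for x
    using V_le[of x] by (simp add: CV_def algebra_simps add.commute add_increasing)
  \<comment> \<open>On the boundary \<open>V x = (M * K)\<^sup>2\<close> the decay of
    \<open>V\<close> is at least \<open>2 * a / CV * (M * K)\<^sup>2\<close>, while the saturated
    input contributes at most \<open>C4 * (c 0)\<^sup>2 * K\<^sup>2\<close>. This \<open>M\<close>
    makes the two equal.\<close>
  define M where "M = sqrt (C4 * (c 0)\<^sup>2 * CV / (2 * a))"
  have M: "0 < M" using C4 CV a c0 by (simp add: M_def)
  have M2: "M\<^sup>2 * (2 * a / CV) = C4 * (c 0)\<^sup>2"
    using C4 CV a by (simp add: M_def field_simps)
  define q where "q = M / sqrt aP"
  have q: "0 < q" using M aP by (simp add: q_def)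
  define C1 where "C1 = 1 + l1 i p"
  have C1: "1 \<le> C1" by (simp add: C1_def)
  define B1 where "B1 = C1 * (q + \<bar>c 0\<bar>)"
  have B1: "0 \<le> B1" using C1 q by (simp add: B1_def)
  \<comment> \<open>In the region \<open>l1 i x \<le> q * K\<close>, hence
    \<open>m \<le> B1 * K\<close>; with \<open>h \<le> K\<close> this choice gives
    \<open>h + m \<le> e0\<close>.\<close>
  define K where "K = min 1 (e0 / (1 + B1))"
  have K: "0 < K" "K \<le> 1" using e0 B1 by (auto simp: K_def)
  have "K \<le> e0 / (1 + B1)" by (simp add: K_def)
  then have KB: "K + B1 * K \<le> e0" using B1 by (simp add: field_simps)
  define r where "r = min K (CV / (4 * a))"
  have r: "0 < r" using K CV a by (simp add: r_def)
  \<comment> \<open>The first pair compares \<open>\<beta>\<close> with the rate of decrease, the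
    second with the energy itself, so that one constant serves both conclusions.\<close>
  define \<beta> where "\<beta> = min (min a (K\<^sup>2 * (c 0)\<^sup>2 / 2)) (min aP (\<mu> * K / (2 * \<omega>)))"
  have \<beta>: "0 < \<beta>" using a K c0 aP \<mu> \<omega> by (simp add: \<beta>_def)
  define Cw where "Cw = bP + \<mu> * K * (1 + l1 i c)"
  define W where "W x = V x + \<mu> * (K * huber \<omega> (y x))" for x
  define S where "S x = sat (\<omega> * y x)" for x
  have diss: "diss i c \<omega> x = (l1 i x)\<^sup>2 + (S x)\<^sup>2" for x
    by (simp add: diss_def S_def y_def)
  show ?thesis
  proof (rule exI[of _ K], rule conjI[OF K(1)], rule exI[of _ "M * K"], rule conjI[OF mult_pos_pos[OF M K(1)]],
      rule exI[of _ r], rule conjI[OF r], rule exI[of _ \<beta>], rule conjI[OF \<beta>],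
      rule exI[of _ Cw], rule exI[of _ W], intro conjI allI impI)
    fix x
    show "\<beta> * diss i c \<omega> x \<le> W x"
    proof -
      have "\<beta> * (l1 i x)\<^sup>2 \<le> aP * (l1 i x)\<^sup>2" by (intro mult_right_mono) (auto simp: \<beta>_def)
      also have "\<dots> \<le> V x" using posP by (simp add: V_def)
      finally have 1: "\<beta> * (l1 i x)\<^sup>2 \<le> V x" .
      have "\<beta> * (S x)\<^sup>2 \<le> \<mu> * K / (2 * \<omega>) * (S x)\<^sup>2" by (intro mult_right_mono) (auto simp: \<beta>_def)
      also have "\<dots> = \<mu> * (K * ((S x)\<^sup>2 / (2 * \<omega>)))" by simp
      also have "\<dots> \<le> \<mu> * (K * huber \<omega> (y x))"
        unfolding S_def using \<mu> K by (intro mult_left_mono huber_ge_sat \<omega>) auto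
      finally show ?thesis using 1 by (simp add: W_def diss algebra_simps)
    qed
    show "W x \<le> Cw * ((l1 (Suc i) x)\<^sup>2 + l1 (Suc i) x)"
    proof -
      define N where "N = l1 (Suc i) x"
      have N: "0 \<le> N" "l1 i x \<le> N" "\<bar>x i\<bar> \<le> N"
        unfolding N_def by (auto intro: l1_mono abs_le_l1)
      have 1: "V x \<le> bP * N\<^sup>2"
        using N by (intro order_trans[OF V_le] mult_left_mono power_mono bP_nonneg) auto
      have "\<bar>y x\<bar> \<le> \<bar>x i\<bar> + l1 i c * l1 i x" using lin_bound[of i c x] unfolding y_def by linarith
      also have "\<dots> \<le> N + l1 i c * N" using N by (intro add_mono mult_left_mono) auto
      finally have "huber \<omega> (y x) \<le> (1 + l1 i c) * N"
        using huber_le_abs[OF \<omega>, of "y x"] by (simp add: algebra_simps)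
      then have "\<mu> * (K * huber \<omega> (y x)) \<le> \<mu> * (K * ((1 + l1 i c) * N))"
        using \<mu> K by (intro mult_left_mono) auto
      moreover have "0 \<le> bP * N" "0 \<le> \<mu> * K * (1 + l1 i c) * N\<^sup>2"
        using bP_nonneg N \<mu> K by auto
      ultimately show ?thesis using 1 by (simp add: W_def Cw_def N_def[symmetric] algebra_simps)
    qed
    fix h u x'
    assume h: "0 < h" "h \<le> r" and Vx: "bil i P x x < (M * K)\<^sup>2"
      and u: "u = lin i p x - K * c 0 * sat (\<omega> * (x i + lin i c x))"
      and step: "close_step C i h u x x'"
    define N where "N = l1 i x"
    define v where "v = - K * c 0 * sat (\<omega> * y x)"
    define m where "m = N + \<bar>u\<bar>"
    have uv: "u = lin i p x + v" by (simp add: u v_def y_def)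
    have vS: "v\<^sup>2 = K\<^sup>2 * (c 0)\<^sup>2 * (S x)\<^sup>2" by (simp add: v_def S_def power_mult_distrib)
    have "\<bar>v\<bar> = K * \<bar>c 0\<bar> * \<bar>S x\<bar>" using K by (simp add: v_def S_def abs_mult)
    also have "\<dots> \<le> K * \<bar>c 0\<bar> * 1" using K by (intro mult_left_mono) (auto simp: S_def abs_sat_le_1)
    finally have v: "\<bar>v\<bar> \<le> K * \<bar>c 0\<bar>" by simp
    have "aP * N\<^sup>2 \<le> (M * K)\<^sup>2" using posP[of x] Vx by (simp add: N_def)
    then have "N\<^sup>2 \<le> (q * K)\<^sup>2" using aP by (simp add: q_def field_simps)
    then have N: "N \<le> q * K" using q K by (simp add: power2_le_iff_abs_le abs_le_iff)
    have "m \<le> N + l1 i p * N + \<bar>v\<bar>" using lin_bound[of i p x] by (simp add: m_def uv N_def)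
    also have "\<dots> = C1 * N + \<bar>v\<bar>" by (simp add: C1_def algebra_simps)
    also have "\<dots> \<le> C1 * (q * K) + C1 * (K * \<bar>c 0\<bar>)"
    proof (intro add_mono mult_left_mono N)
      have "1 * (K * \<bar>c 0\<bar>) \<le> C1 * (K * \<bar>c 0\<bar>)" using C1 K by (intro mult_right_mono) auto
      then show "\<bar>v\<bar> \<le> C1 * (K * \<bar>c 0\<bar>)" using v by simp
    qed (use C1 in simp)
    finally have m: "m \<le> B1 * K" by (simp add: B1_def algebra_simps)
    have hK: "h \<le> K" using h by (simp add: r_def)
    have e: "h + m \<le> e0" using hK m KB by simp
    have m0: "0 \<le> m" by (simp add: m_def N_def)
    have he: "h \<le> h + m" and me: "m \<le> h + m" and mu: "m = l1 i x + \<bar>u\<bar>"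
      using m0 h by (auto simp: m_def N_def)
    have "m \<le> 1" using e e0 h by simp
    then have st: "\<forall>j\<le>i. \<bar>x' j - x j - h * shift u x j\<bar> \<le> h * (C * m * (h + m))"
      using step by (simp add: close_step_def m_def N_def)
    have D: "V x' \<le> V x + h * (- 2 * a * N\<^sup>2 + C4 * v\<^sup>2)" "W x' \<le> W x - h * (a * N\<^sup>2 + v\<^sup>2 / 2)"
      using dec[OF K h(1) he me e uv v_def mu st] unfolding W_def N_def by auto
    show "W x' \<le> W x - h * (\<beta> * diss i c \<omega> x)"
    proof -
      have "\<beta> * N\<^sup>2 \<le> a * N\<^sup>2" by (intro mult_right_mono) (auto simp: \<beta>_def)
      moreover have "\<beta> * (S x)\<^sup>2 \<le> K\<^sup>2 * (c 0)\<^sup>2 / 2 * (S x)\<^sup>2" by (intro mult_right_mono) (auto simp: \<beta>_def)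
      ultimately have "\<beta> * diss i c \<omega> x \<le> a * N\<^sup>2 + v\<^sup>2 / 2"
        unfolding diss vS N_def by (simp add: algebra_simps)
      then have "h * (\<beta> * diss i c \<omega> x) \<le> h * (a * N\<^sup>2 + v\<^sup>2 / 2)" using h by (intro mult_left_mono) auto
      with D(2) show ?thesis by simp
    qed
    show "bil i P x' x' < (M * K)\<^sup>2"
    proof -
      \<comment> \<open>\<open>V x'\<close> is bounded by the convex combination of
        \<open>V x\<close> and \<open>(M * K)\<^sup>2\<close> with weight \<open>t\<close> on the
        latter; \<open>t < 1\<close>, from \<open>r \<le> CV / (4 * a)\<close>, keeps the inequality
        strict.\<close>
      define t where "t = h * (2 * a / CV)"
      have "h \<le> CV / (4 * a)" using h by (simp add: r_def)
      then have t: "0 < t" "t < 1" using h a CV by (auto simp: t_def field_simps)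
      have "t * V x \<le> t * (CV * N\<^sup>2)" using t VCV by (intro mult_left_mono) (auto simp: N_def)
      also have "\<dots> = h * (2 * a * N\<^sup>2)" using CV by (simp add: t_def)
      finally have 1: "t * V x \<le> h * (2 * a * N\<^sup>2)" .
      have "v\<^sup>2 \<le> K\<^sup>2 * (c 0)\<^sup>2"
        using power_mono[OF v, of 2] by (simp add: power_mult_distrib)
      then have "h * (C4 * v\<^sup>2) \<le> h * (C4 * (K\<^sup>2 * (c 0)\<^sup>2))" using h C4 by (intro mult_left_mono) auto
      also have "\<dots> = h * K\<^sup>2 * (C4 * (c 0)\<^sup>2)" by simp
      also have "\<dots> = t * (M * K)\<^sup>2" unfolding M2[symmetric] by (simp add: t_def power_mult_distrib)
      finally have 2: "h * (C4 * v\<^sup>2) \<le> t * (M * K)\<^sup>2" .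
      have "V x' \<le> V x - h * (2 * a * N\<^sup>2) + h * (C4 * v\<^sup>2)" using D(1) by (simp add: algebra_simps)
      also have "\<dots> \<le> (1 - t) * V x + t * (M * K)\<^sup>2" using 1 2 by (simp add: algebra_simps)
      also have "\<dots> < (1 - t) * (M * K)\<^sup>2 + t * (M * K)\<^sup>2"
        using t Vx by (intro add_strict_right_mono mult_strict_left_mono) (auto simp: V_def)
      finally show ?thesis by (simp add: V_def algebra_simps)
    qed
  qed
qed

end

text \<open>Stage 0, where the first equation is integrated exactly. The step bound prevents
  \<open>x 0\<close> from changing sign, so \<open>\<bar>x 0\<bar>\<close> itself serves as energy.
  Its decay rate \<open>K0 * \<bar>S\<bar>\<close> dominates \<open>K0 * S\<^sup>2\<close> because
  \<open>\<bar>S\<bar> \<le> 1\<close>, which brings stage 0 into the common form with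
  \<open>diss\<close>.\<close>

lemma first_coordinate_step:
  assumes "0 < K0" "0 < \<omega>" "0 < h" "h \<le> 1 / (K0 * \<omega>)"
    and "x' 0 = x 0 - h * (K0 * sat (\<omega> * x 0))"
  shows "\<bar>x' 0\<bar> \<le> \<bar>x 0\<bar> - h * (K0 * diss 0 c \<omega> x)"
proof -
  define S where "S = sat (\<omega> * x 0)"
  have S1: "\<bar>S\<bar> \<le> 1" by (simp add: S_def abs_sat_le_1)
  have sgn: "\<bar>x 0 - h * (K0 * S)\<bar> = \<bar>x 0\<bar> - h * (K0 * \<bar>S\<bar>)"
  proof -
    have "h * (K0 * \<bar>S\<bar>) \<le> 1 / (K0 * \<omega>) * (K0 * (\<omega> * \<bar>x 0\<bar>))"
      using assms abs_sat_le[of "\<omega> * x 0"] by (intro mult_mono) (auto simp: S_def abs_mult)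
    also have "\<dots> = \<bar>x 0\<bar>" using assms by simp
    finally have 1: "h * (K0 * \<bar>S\<bar>) \<le> \<bar>x 0\<bar>" .
    show ?thesis
    proof (cases "0 \<le> x 0")
      case True
      then have "0 \<le> S" using assms by (simp add: S_def sat_def)
      then show ?thesis using 1 True by simp
    next
      case False
      then have "\<omega> * x 0 \<le> 0" using assms by (simp add: mult_le_0_iff)
      then have "S \<le> 0" by (simp add: S_def sat_def divide_nonpos_pos)
      then show ?thesis using 1 False by simp
    qed
  qed
  have "\<bar>S\<bar> * \<bar>S\<bar> \<le> \<bar>S\<bar>" by (rule mult_left_le[OF S1]) simp
  then have "S\<^sup>2 \<le> \<bar>S\<bar>" by (simp add: power2_eq_square)
  then have "h * (K0 * S\<^sup>2) \<le> h * (K0 * \<bar>S\<bar>)" using assms by (intro mult_left_mono) auto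
  then show ?thesis using sgn assms(5) by (simp add: diss_def S_def)
qed

section \<open>Solutions on one sampling interval\<close>

text \<open>Forgets the plant, the disturbance and the feedback law: integrability, the integral
  equations and the growth bound remain. Constants derived from it depend on \<open>L\<close> and
  \<open>i\<close> alone and are therefore uniform over all inputs.\<close>

definition chain_on ::
  "(real \<Rightarrow> real) \<Rightarrow> nat \<Rightarrow> real \<Rightarrow> real \<Rightarrow> real \<Rightarrow> (nat \<Rightarrow> real \<Rightarrow> real) \<Rightarrow> (nat \<Rightarrow> real \<Rightarrow> real) \<Rightarrow> bool" where
  "chain_on L i u a b Y f \<longleftrightarrow> (\<forall>j\<le>i. \<forall>t\<in>{a..b}. f j integrable_on {a..t} \<and>
     Y j t = Y j a + integral {a..t} (f j) \<and>
     \<bar>f j t - shift u (\<lambda>k. Y k t) j\<bar> \<le>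
       (if j = 0 then 0 else L (l1 j (\<lambda>k. Y k t) + \<bar>u\<bar>) * (l1 j (\<lambda>k. Y k t) + \<bar>u\<bar>)\<^sup>2))"

lemma chain_onD:
  assumes "chain_on L i u a b Y f" "j \<le> i" "t \<in> {a..b}"
  shows "f j integrable_on {a..t}" "Y j t = Y j a + integral {a..t} (f j)"
    "j = 0 \<Longrightarrow> f j t = u"
    "j \<noteq> 0 \<Longrightarrow> \<bar>f j t - Y (j - 1) t\<bar> \<le> L (l1 j (\<lambda>k. Y k t) + \<bar>u\<bar>) * (l1 j (\<lambda>k. Y k t) + \<bar>u\<bar>)\<^sup>2"
proof -
  have "f j integrable_on {a..t} \<and> Y j t = Y j a + integral {a..t} (f j) \<and>
     \<bar>f j t - shift u (\<lambda>k. Y k t) j\<bar> \<le>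
       (if j = 0 then 0 else L (l1 j (\<lambda>k. Y k t) + \<bar>u\<bar>) * (l1 j (\<lambda>k. Y k t) + \<bar>u\<bar>)\<^sup>2)"
    using assms unfolding chain_on_def by blast
  then show "f j integrable_on {a..t}" "Y j t = Y j a + integral {a..t} (f j)"
    "j = 0 \<Longrightarrow> f j t = u"
    "j \<noteq> 0 \<Longrightarrow> \<bar>f j t - Y (j - 1) t\<bar> \<le> L (l1 j (\<lambda>k. Y k t) + \<bar>u\<bar>) * (l1 j (\<lambda>k. Y k t) + \<bar>u\<bar>)\<^sup>2"
    by (simp_all add: shift_def)
qed

lemma integral_near_const:
  fixes f :: "real \<Rightarrow> real"
  assumes "f integrable_on {a..t}" "a \<le> t" "\<And>s. s \<in> {a..t} \<Longrightarrow> \<bar>f s - z\<bar> \<le> B"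
  shows "\<bar>integral {a..t} f - (t - a) * z\<bar> \<le> (t - a) * B"
proof -
  have "integral {a..t} f - (t - a) * z = integral {a..t} (\<lambda>s. f s - z)"
    using assms by (subst integral_diff) auto
  moreover have "norm (integral {a..t} (\<lambda>s. f s - z)) \<le> integral {a..t} (\<lambda>s. B)"
    using assms by (intro integral_norm_bound_integral integrable_diff) auto
  ultimately show ?thesis using assms(2) by simp
qed

lemma image_nonneg: "L ` {0..} \<subseteq> {0..} \<Longrightarrow> 0 \<le> s \<Longrightarrow> 0 \<le> L s"
  for L :: "real \<Rightarrow> real"
  by (auto simp: image_subset_iff)

text \<open>Freezes the growth function at \<open>B\<close>: for data of size
  \<open>m \<le> 1\<close> the nonlinearity is at most a constant times
  \<open>m\<^sup>2\<close>.\<close>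

lemma growth_bound:
  assumes L: "mono_on {0..} L" "L ` {0..} \<subseteq> {0..}"
    and "0 \<le> s" "s \<le> B * m" "0 \<le> B" "0 \<le> m" "m \<le> (1 :: real)"
  shows "L s * s\<^sup>2 \<le> L B * B\<^sup>2 * m\<^sup>2"
proof -
  have "B * m \<le> B * 1" using assms by (intro mult_left_mono) auto
  then have "s \<le> B" using assms by simp
  then have "L s \<le> L B" using assms by (intro mono_onD[OF L(1)]) auto
  moreover have "s\<^sup>2 \<le> (B * m)\<^sup>2" using assms by (intro power_mono) auto
  moreover have "0 \<le> L B" using image_nonneg[OF L(2)] assms by simp
  ultimately have "L s * s\<^sup>2 \<le> L B * (B * m)\<^sup>2" by (intro mult_mono) auto
  then show ?thesis by (simp add: power_mult_distrib)
qed

lemma l1_near: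
  assumes "\<And>k. k < i \<Longrightarrow> \<bar>x k - x0 k\<bar> \<le> b"
  shows "l1 i x \<le> l1 i x0 + real i * b"
proof -
  have "l1 i x = l1 i (\<lambda>k. x0 k + (x k - x0 k))" by simp
  also have "\<dots> \<le> l1 i x0 + l1 i (\<lambda>k. x k - x0 k)" by (rule l1_add)
  also have "l1 i (\<lambda>k. x k - x0 k) \<le> real i * b" by (rule l1_bound) (rule assms)
  finally show ?thesis by simp
qed

text \<open>Induction along the chain takes the place of a Gronwall argument: the right-hand side of
  coordinate \<open>j\<close> contains only earlier coordinates, whose variation is already known,
  so each coordinate is the integral of a bounded function.\<close>

lemma chain_variation:
  assumes L: "mono_on {0..} L" "L ` {0..} \<subseteq> {0..}"
  shows "\<exists>C\<ge>0. \<forall>Y f a b u. a \<le> b \<longrightarrow> b - a \<le> 1 \<longrightarrow> chain_on L i u a b Y f \<longrightarrow>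
    l1 i (\<lambda>k. Y k a) + \<bar>u\<bar> \<le> 1 \<longrightarrow>
    (\<forall>j\<le>i. \<forall>t\<in>{a..b}. \<bar>Y j t - Y j a\<bar> \<le> C * (l1 i (\<lambda>k. Y k a) + \<bar>u\<bar>) * (t - a))"
proof (induction i)
  case 0
  show ?case
  proof (intro exI[of _ 1] conjI allI impI ballI)
    fix Y f :: "nat \<Rightarrow> real \<Rightarrow> real" and a b u t :: real and j :: nat
    assume *: "chain_on L 0 u a b Y f" "j \<le> 0" "t \<in> {a..b}"
    have "\<bar>integral {a..t} (f 0) - (t - a) * u\<bar> \<le> (t - a) * 0"
    proof (rule integral_near_const)
      show "f 0 integrable_on {a..t}" "a \<le> t" using chain_onD(1)[OF *(1) le0 *(3)] *(3) by auto
      show "\<bar>f 0 s - u\<bar> \<le> 0" if "s \<in> {a..t}" for s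
        using chain_onD(3)[OF *(1) le0, of s] that *(3) by simp
    qed
    then have "Y 0 t - Y 0 a = (t - a) * u" using chain_onD(2)[OF *(1) le0 *(3)] by simp
    then show "\<bar>Y j t - Y j a\<bar> \<le> 1 * (l1 0 (\<lambda>k. Y k a) + \<bar>u\<bar>) * (t - a)"
      using * by (simp add: abs_mult)
  qed simp
next
  case (Suc i)
  then obtain C where C: "0 \<le> C" and IH:
    "\<forall>Y f a b u. a \<le> b \<longrightarrow> b - a \<le> 1 \<longrightarrow> chain_on L i u a b Y f \<longrightarrow>
      l1 i (\<lambda>k. Y k a) + \<bar>u\<bar> \<le> 1 \<longrightarrow>
      (\<forall>j\<le>i. \<forall>t\<in>{a..b}. \<bar>Y j t - Y j a\<bar> \<le> C * (l1 i (\<lambda>k. Y k a) + \<bar>u\<bar>) * (t - a))"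
    by blast
  \<comment> \<open>By the induction hypothesis the coordinates up to \<open>i\<close> together with
    \<open>u\<close> stay below \<open>B * m\<close> on the whole interval, whose length is at most
    1.\<close>
  define B where "B = 1 + real (Suc i) * C"
  define C' where "C' = C + (B + L B * B\<^sup>2)"
  have B: "1 \<le> B" using C by (simp add: B_def)
  then have LB: "0 \<le> L B * B\<^sup>2" using image_nonneg[OF L(2), of B] by simp
  show ?case
  proof (intro exI[of _ C'] conjI allI impI ballI)
    show "0 \<le> C'" using C B LB by (simp add: C'_def)
    fix Y f :: "nat \<Rightarrow> real \<Rightarrow> real" and a b u t :: real and j :: nat
    assume ab: "a \<le> b" "b - a \<le> 1" and ch: "chain_on L (Suc i) u a b Y f"
      and m1: "l1 (Suc i) (\<lambda>k. Y k a) + \<bar>u\<bar> \<le> 1" and j: "j \<le> Suc i" and t: "t \<in> {a..b}"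
    define m where "m = l1 (Suc i) (\<lambda>k. Y k a) + \<bar>u\<bar>"
    have m: "0 \<le> m" "m \<le> 1" "l1 i (\<lambda>k. Y k a) + \<bar>u\<bar> \<le> m"
      using m1 l1_mono[of i "Suc i" "\<lambda>k. Y k a"] by (auto simp: m_def)
    have chi: "chain_on L i u a b Y f" 
      unfolding chain_on_def using ch[unfolded chain_on_def, rule_format, OF le_SucI] by blast
    have near: "\<bar>Y k s - Y k a\<bar> \<le> C * m * (s - a)" if "k \<le> i" "s \<in> {a..b}" for k s
    proof -
      have "\<bar>Y k s - Y k a\<bar> \<le> C * (l1 i (\<lambda>k. Y k a) + \<bar>u\<bar>) * (s - a)"
        using IH[rule_format, OF ab chi _ that] m by simp
      also have "\<dots> \<le> C * m * (s - a)"
        using that m C by (intro mult_right_mono mult_left_mono) auto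
      finally show ?thesis .
    qed
    have near1: "\<bar>Y k s - Y k a\<bar> \<le> C * m" if "k \<le> i" "s \<in> {a..b}" for k s
    proof -
      have "C * m * (s - a) \<le> C * m * 1" using that ab m C by (intro mult_left_mono) auto
      then show ?thesis using near[OF that] by simp
    qed
    show "\<bar>Y j t - Y j a\<bar> \<le> C' * (l1 (Suc i) (\<lambda>k. Y k a) + \<bar>u\<bar>) * (t - a)"
    proof (cases "j \<le> i")
      case True
      have "C * m * (t - a) \<le> C' * m * (t - a)"
        using m t B LB by (intro mult_right_mono) (auto simp: C'_def)
      then show ?thesis using near[OF True t] by (simp add: m_def)
    next
      case False
      with j have j: "j = Suc i" by simp
      have f: "\<bar>f j s - 0\<bar> \<le> (B + L B * B\<^sup>2) * m" if s: "s \<in> {a..t}" for s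
      proof -
        have s': "s \<in> {a..b}" using s t by auto
        define z where "z = l1 (Suc i) (\<lambda>k. Y k s) + \<bar>u\<bar>"
        have "l1 (Suc i) (\<lambda>k. Y k s) \<le> l1 (Suc i) (\<lambda>k. Y k a) + real (Suc i) * (C * m)"
          by (rule l1_near) (use near1 s' in auto)
        then have z: "z \<le> B * m" by (simp add: z_def m_def B_def algebra_simps)
        have "L z * z\<^sup>2 \<le> L B * B\<^sup>2 * m\<^sup>2"
          by (rule growth_bound[OF L]) (use z B m in \<open>auto simp: z_def\<close>)
        also have "\<dots> \<le> L B * B\<^sup>2 * m"
          using LB m by (intro mult_left_mono) (auto simp: power2_eq_square mult_left_le)
        finally have 1: "L z * z\<^sup>2 \<le> L B * B\<^sup>2 * m" .
        have "\<bar>Y i s\<bar> \<le> z" using abs_le_l1[of i "Suc i" "\<lambda>k. Y k s"] by (simp add: z_def)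
        moreover have "\<bar>f j s - Y i s\<bar> \<le> L z * z\<^sup>2"
          using chain_onD(4)[OF ch _ s', of j] j by (simp add: z_def)
        ultimately show ?thesis using 1 z by (simp add: algebra_simps)
      qed
      have "\<bar>integral {a..t} (f j) - (t - a) * 0\<bar> \<le> (t - a) * ((B + L B * B\<^sup>2) * m)"
        by (rule integral_near_const) (use chain_onD(1)[OF ch _ t, of j] t j f in auto)
      then have "\<bar>Y j t - Y j a\<bar> \<le> (t - a) * ((B + L B * B\<^sup>2) * m)"
        using chain_onD(2)[OF ch _ t, of j] j by simp
      also have "\<dots> \<le> (t - a) * (C' * m)"
        using t m C by (intro mult_left_mono mult_right_mono) (auto simp: C'_def)
      finally show ?thesis by (simp add: m_def mult_ac)
    qed
  qed
qed

text \<open>Bootstraps \<open>chain_variation\<close>: the integrand of coordinate \<open>j\<close>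
  differs from its linear value at the start by the drift of \<open>Y (j - 1)\<close>, of order
  \<open>m * (b - a)\<close>, and by the nonlinearity, of order \<open>m\<^sup>2\<close>. Together
  they give the factor \<open>m * (h + m)\<close> of \<open>close_step\<close>.\<close>

lemma chain_estimates:
  assumes L: "mono_on {0..} L" "L ` {0..} \<subseteq> {0..}"
  shows "\<exists>C\<ge>0. \<forall>Y f a b u. a \<le> b \<longrightarrow> b - a \<le> 1 \<longrightarrow> chain_on L i u a b Y f \<longrightarrow>
    close_step C i (b - a) u (\<lambda>k. Y k a) (\<lambda>k. Y k b) \<and>
    (l1 i (\<lambda>k. Y k a) + \<bar>u\<bar> \<le> 1 \<longrightarrow>
      (\<forall>j\<le>i. \<bar>Y j b - Y j a\<bar> \<le> C * (l1 i (\<lambda>k. Y k a) + \<bar>u\<bar>)))"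
proof -
  obtain C where C: "0 \<le> C" and var:
    "\<forall>Y f a b u. a \<le> b \<longrightarrow> b - a \<le> 1 \<longrightarrow> chain_on L i u a b Y f \<longrightarrow>
      l1 i (\<lambda>k. Y k a) + \<bar>u\<bar> \<le> 1 \<longrightarrow>
      (\<forall>j\<le>i. \<forall>t\<in>{a..b}. \<bar>Y j t - Y j a\<bar> \<le> C * (l1 i (\<lambda>k. Y k a) + \<bar>u\<bar>) * (t - a))"
    using chain_variation[OF L, of i] by blast
  define B where "B = 1 + real i * C"
  define C' where "C' = C + L B * B\<^sup>2"
  have B: "1 \<le> B" using C by (simp add: B_def)
  then have LB: "0 \<le> L B * B\<^sup>2" using image_nonneg[OF L(2), of B] by simp
  show ?thesis
  proof (intro exI[of _ C'] conjI allI impI)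
    show "0 \<le> C'" using C LB by (simp add: C'_def)
    fix Y f :: "nat \<Rightarrow> real \<Rightarrow> real" and a b u :: real
    assume ab: "a \<le> b" "b - a \<le> 1" and ch: "chain_on L i u a b Y f"
    define m where "m = l1 i (\<lambda>k. Y k a) + \<bar>u\<bar>"
    have m0: "0 \<le> m" by (simp add: m_def)
    have near: "\<bar>Y k s - Y k a\<bar> \<le> C * m * (s - a)" if "k \<le> i" "s \<in> {a..b}" "m \<le> 1" for k s
      using var[rule_format, OF ab ch _ that(1,2)] that(3) by (simp add: m_def)
    have near1: "\<bar>Y k s - Y k a\<bar> \<le> C * m" if "k \<le> i" "s \<in> {a..b}" "m \<le> 1" for k s
    proof -
      have "C * m * (s - a) \<le> C * m * 1" using that ab m0 C by (intro mult_left_mono) auto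
      then show ?thesis using near[OF that] by simp
    qed
    {
      fix j assume "l1 i (\<lambda>k. Y k a) + \<bar>u\<bar> \<le> 1" "j \<le> i"
      then have "\<bar>Y j b - Y j a\<bar> \<le> C * m" using ab by (intro near1) (auto simp: m_def)
      also have "\<dots> \<le> C' * m" using LB m0 by (intro mult_right_mono) (auto simp: C'_def)
      finally show "\<bar>Y j b - Y j a\<bar> \<le> C' * (l1 i (\<lambda>k. Y k a) + \<bar>u\<bar>)" by (simp add: m_def)
    }
    show "close_step C' i (b - a) u (\<lambda>k. Y k a) (\<lambda>k. Y k b)"
      unfolding close_step_def m_def[symmetric]
    proof (intro impI allI)
      fix j assume m1: "m \<le> 1" and j: "j \<le> i"
      have f: "\<bar>f j s - shift u (\<lambda>k. Y k a) j\<bar> \<le> C' * m * ((b - a) + m)" if s: "s \<in> {a..b}" for s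
      proof (cases "j = 0")
        case True
        then have "f j s = shift u (\<lambda>k. Y k a) j"
          using chain_onD(3)[OF ch j s] by (simp add: shift_def)
        then show ?thesis using C LB m0 ab by (simp add: C'_def)
      next
        case False
        define z where "z = l1 j (\<lambda>k. Y k s) + \<bar>u\<bar>"
        have "z \<le> l1 i (\<lambda>k. Y k s) + \<bar>u\<bar>" using l1_mono[OF j] by (simp add: z_def)
        moreover have "l1 i (\<lambda>k. Y k s) \<le> l1 i (\<lambda>k. Y k a) + real i * (C * m)"
          by (rule l1_near) (use near1 s m1 in auto)
        ultimately have z: "z \<le> B * m" by (simp add: m_def B_def algebra_simps)
        have 1: "L z * z\<^sup>2 \<le> L B * B\<^sup>2 * m\<^sup>2"
          by (rule growth_bound[OF L]) (use z B m0 m1 in \<open>auto simp: z_def\<close>)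
        have 2: "\<bar>f j s - Y (j - 1) s\<bar> \<le> L z * z\<^sup>2"
          using chain_onD(4)[OF ch j s False] by (simp add: z_def)
        have "\<bar>Y (j - 1) s - Y (j - 1) a\<bar> \<le> C * m * (s - a)" using j m1 by (intro near s) auto
        also have "\<dots> \<le> C * m * (b - a)" using C m0 s by (intro mult_left_mono) auto
        finally have "\<bar>f j s - Y (j - 1) a\<bar> \<le> C * m * (b - a) + L B * B\<^sup>2 * m\<^sup>2" using 1 2 by linarith
        also have "\<dots> \<le> C' * m * (b - a) + C' * m * m"
          unfolding power2_eq_square[of m] mult.assoc[symmetric]
          using C LB m0 ab by (intro add_mono mult_right_mono) (auto simp: C'_def)
        finally show ?thesis using False by (simp add: shift_def algebra_simps)
      qed
      have "\<bar>integral {a..b} (f j) - (b - a) * shift u (\<lambda>k. Y k a) j\<bar> \<le> (b - a) * (C' * m * ((b - a) + m))"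
        by (rule integral_near_const) (use chain_onD(1)[OF ch j, of b] ab f in auto)
      then show "\<bar>Y j b - Y j a - (b - a) * shift u (\<lambda>k. Y k a) j\<bar> \<le> (b - a) * (C' * m * ((b - a) + m))"
        using chain_onD(2)[OF ch j, of b] ab by simp
    qed
  qed
qed

section \<open>Solutions of the closed loop\<close>

lemma abs_le_vnorm:
  assumes "x \<in> carrier_vec n" "k < n"
  shows "\<bar>x $ k\<bar> \<le> vnorm x"
proof -
  have "(x $ k)\<^sup>2 \<le> (\<Sum>j<n. (x $ j)\<^sup>2)" using assms by (intro member_le_sum) auto
  also have "\<dots> = x \<bullet> x"
    using assms by (simp add: scalar_prod_def power2_eq_square lessThan_atLeast0)
  finally show ?thesis unfolding vnorm_def by (simp add: real_le_rsqrt)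
qed

lemma vnorm_le_l1:
  assumes "x \<in> carrier_vec n"
  shows "vnorm x \<le> l1 n (\<lambda>k. x $ k)"
proof -
  have "x \<bullet> x = (\<Sum>j<n. \<bar>x $ j\<bar> * \<bar>x $ j\<bar>)"
    using assms by (simp add: scalar_prod_def lessThan_atLeast0)
  also have "\<dots> \<le> (\<Sum>j<n. \<bar>x $ j\<bar> * l1 n (\<lambda>k. x $ k))"
    by (intro sum_mono mult_left_mono) (auto intro: abs_le_l1)
  also have "\<dots> = (l1 n (\<lambda>k. x $ k))\<^sup>2"
    by (simp add: sum_distrib_right[symmetric] l1_def power2_eq_square)
  finally show ?thesis unfolding vnorm_def by (simp add: real_le_lsqrt)
qed

lemma l1_le_vnorm:
  assumes "x \<in> carrier_vec n"
  shows "l1 n (\<lambda>k. x $ k) \<le> real n * vnorm x"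
  using assms by (intro l1_bound abs_le_vnorm)

lemma vnorm_nonneg: "0 \<le> vnorm x"
  by (simp add: vnorm_def scalar_prod_def sum_nonneg)

lemma Linf_loc_mem: "d \<in> Linf_loc D \<Longrightarrow> 0 \<le> t \<Longrightarrow> d t \<in> D"
  by (simp add: Linf_loc_def)

lemma sample_time_nonneg: "0 \<le> r \<Longrightarrow> 0 \<le> sample_time r w i"
  by (induction i) auto

lemma sample_time_less: "0 < r \<Longrightarrow> sample_time r w i < sample_time r w (Suc i)"
  by simp

lemma sample_time_step:
  assumes "0 < r" "w \<in> Linf_loc {0..}"
  shows "sample_time r w (Suc i) - sample_time r w i \<le> r"
  using Linf_loc_mem[OF assms(2) sample_time_nonneg[of r w i]] assms(1) by simp

lemma sample_time_mono: "0 < r \<Longrightarrow> i \<le> j \<Longrightarrow> sample_time r w i \<le> sample_time r w j"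
  by (rule lift_Suc_mono_le[of "sample_time r w"]) (auto intro: less_imp_le sample_time_less)

lemma sample_interval:
  assumes "0 < r" "0 \<le> t" "ereal t < sample_horizon r w"
  obtains i where "sample_time r w i \<le> t" "t < sample_time r w (Suc i)"
proof -
  obtain k where k: "t < sample_time r w k"
    using assms(3) by (auto simp: sample_horizon_def less_SUP_iff)
  define m where "m = (LEAST k. t < sample_time r w k)"
  have m: "t < sample_time r w m" unfolding m_def using k by (rule LeastI)
  with assms(2) have "m \<noteq> 0" by (cases m) auto
  then obtain i where i: "m = Suc i" by (cases m) auto
  then have "\<not> t < sample_time r w i" using not_less_Least[of i "\<lambda>k. t < sample_time r w k"] by (simp add: m_def)
  with m i show ?thesis by (intro that[of i]) auto
qed

section \<open>The triangular system and its bounds over finite time\<close>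

locale chain_system =
  fixes n :: nat and D :: "'d::euclidean_space set"
    and g :: "nat \<Rightarrow> 'd \<Rightarrow> rvec \<Rightarrow> real \<Rightarrow> real" and L :: "real \<Rightarrow> real"
  assumes n: "2 \<le> n" and D: "compact D"
    and lip: "\<And>j. 1 \<le> j \<Longrightarrow> j < n \<Longrightarrow> locally_Lipschitz D j (g (j + 1))"
    and L: "mono_on {0..} L" "L ` {0..} \<subseteq> {0..}"
    and g: "\<And>j d x u. 1 \<le> j \<Longrightarrow> j < n \<Longrightarrow> d \<in> D \<Longrightarrow> x \<in> carrier_vec n \<Longrightarrow>
      \<bar>g (j + 1) d (vec_first x j) u\<bar> \<le>
        L (l1 j (\<lambda>k. x $ k) + \<bar>u\<bar>) * (l1 j (\<lambda>k. x $ k) + \<bar>u\<bar>)\<^sup>2"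
begin

lemma closed_loop_near:
  assumes "j < n" "d \<in> D" "x \<in> carrier_vec n"
  shows "\<bar>closed_loop n g k d x xs $ j - shift (k xs) (\<lambda>l. x $ l) j\<bar> \<le>
    (if j = 0 then 0 else L (l1 j (\<lambda>l. x $ l) + \<bar>k xs\<bar>) * (l1 j (\<lambda>l. x $ l) + \<bar>k xs\<bar>)\<^sup>2)"
  using assms g[of j d x "k xs"] by (auto simp: closed_loop_def shift_def)

lemma solution_chain:
  assumes sol: "sd_solution (closed_loop n g k) n r d w \<xi>0 T \<xi>" and "0 < r" "d \<in> Linf_loc D"
    and t: "sample_time r w i \<le> t" "t \<le> sample_time r w (Suc i)" "ereal t < T"
  shows "chain_on L (n - 1) (k (\<xi> (sample_time r w i))) (sample_time r w i) t (\<lambda>j s. \<xi> s $ j)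
    (\<lambda>j s. closed_loop n g k (d s) (\<xi> s) (\<xi> (sample_time r w i)) $ j)"
  unfolding chain_on_def
proof (intro allI impI ballI)
  fix j s assume j: "j \<le> n - 1" and s: "s \<in> {sample_time r w i..t}"
  then have s': "sample_time r w i \<le> s" "s \<le> sample_time r w (Suc i)" "ereal s < T"
    using t by (auto intro: le_less_trans[OF _ t(3)])
  have s0: "0 \<le> s" using s'(1) sample_time_nonneg[of r w i] assms(2) by simp
  have jn: "j < n" using j n by simp
  have "\<bar>closed_loop n g k (d s) (\<xi> s) (\<xi> (sample_time r w i)) $ j - shift (k (\<xi> (sample_time r w i))) (\<lambda>l. \<xi> s $ l) j\<bar> \<le>
    (if j = 0 then 0 else L (l1 j (\<lambda>l. \<xi> s $ l) + \<bar>k (\<xi> (sample_time r w i))\<bar>) * (l1 j (\<lambda>l. \<xi> s $ l) + \<bar>k (\<xi> (sample_time r w i))\<bar>)\<^sup>2)"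
    using sol s0 s'(3) by (intro closed_loop_near jn Linf_loc_mem[OF assms(3)]) (auto simp: sd_solution_def)
  moreover have "(\<lambda>s. closed_loop n g k (d s) (\<xi> s) (\<xi> (sample_time r w i)) $ j) absolutely_integrable_on {sample_time r w i..s} \<and>
    \<xi> s $ j = \<xi> (sample_time r w i) $ j + integral {sample_time r w i..s} (\<lambda>s. closed_loop n g k (d s) (\<xi> s) (\<xi> (sample_time r w i)) $ j)"
    using sol s' jn unfolding sd_solution_def Let_def by blast
  ultimately show "(\<lambda>s. closed_loop n g k (d s) (\<xi> s) (\<xi> (sample_time r w i)) $ j) integrable_on {sample_time r w i..s} \<and>
    \<xi> s $ j = \<xi> (sample_time r w i) $ j + integral {sample_time r w i..s} (\<lambda>s. closed_loop n g k (d s) (\<xi> s) (\<xi> (sample_time r w i)) $ j) \<and>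
    \<bar>closed_loop n g k (d s) (\<xi> s) (\<xi> (sample_time r w i)) $ j - shift (k (\<xi> (sample_time r w i))) (\<lambda>l. \<xi> s $ l) j\<bar> \<le>
    (if j = 0 then 0 else L (l1 j (\<lambda>l. \<xi> s $ l) + \<bar>k (\<xi> (sample_time r w i))\<bar>) * (l1 j (\<lambda>l. \<xi> s $ l) + \<bar>k (\<xi> (sample_time r w i))\<bar>)\<^sup>2)"
    by (simp add: set_lebesgue_integral_eq_integral(1))
qed

text \<open>A bounded control rules out escape in finite time without any Lyapunov function. Once
  the coordinates before \<open>j\<close> are bounded on \<open>[0, Tm]\<close>, the derivative of
  coordinate \<open>j\<close> is bounded by some \<open>G\<close>, and its growth accumulates in
  elapsed time, so the bound does not depend on the number of samples.\<close>

lemma finite_time_bound: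
  assumes r: "0 < r" and U: "\<And>x. x \<in> carrier_vec n \<Longrightarrow> \<bar>k x\<bar> \<le> U" and Tm: "0 \<le> Tm"
  shows "\<exists>B. \<forall>d w \<xi>0 T \<xi> t. d \<in> Linf_loc D \<longrightarrow> \<xi>0 \<in> carrier_vec n \<longrightarrow> l1 n (\<lambda>k. \<xi>0 $ k) \<le> R0 \<longrightarrow>
    sd_solution (closed_loop n g k) n r d w \<xi>0 T \<xi> \<longrightarrow> 0 \<le> t \<longrightarrow> t \<le> Tm \<longrightarrow> ereal t < T \<longrightarrow>
    l1 n (\<lambda>k. \<xi> t $ k) \<le> B"
proof -
  have U0: "0 \<le> U" using U[of "0\<^sub>v n"] by simp
  have "\<exists>B\<ge>0. \<forall>d w \<xi>0 T \<xi> t. d \<in> Linf_loc D \<longrightarrow> \<xi>0 \<in> carrier_vec n \<longrightarrow> l1 n (\<lambda>k. \<xi>0 $ k) \<le> R0 \<longrightarrow>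
    sd_solution (closed_loop n g k) n r d w \<xi>0 T \<xi> \<longrightarrow> 0 \<le> t \<longrightarrow> t \<le> Tm \<longrightarrow> ereal t < T \<longrightarrow>
    l1 j (\<lambda>k. \<xi> t $ k) \<le> B" if "j \<le> n" for j
    using that
  proof (induction j)
    case 0
    show ?case by (intro exI[of _ 0]) simp
  next
    case (Suc j)
    then obtain B where B: "0 \<le> B" and IH: "\<And>d w \<xi>0 T \<xi> t. d \<in> Linf_loc D \<Longrightarrow> \<xi>0 \<in> carrier_vec n \<Longrightarrow> l1 n (\<lambda>k. \<xi>0 $ k) \<le> R0 \<Longrightarrow>
      sd_solution (closed_loop n g k) n r d w \<xi>0 T \<xi> \<Longrightarrow> 0 \<le> t \<Longrightarrow> t \<le> Tm \<Longrightarrow> ereal t < T \<Longrightarrow>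
      l1 j (\<lambda>k. \<xi> t $ k) \<le> B" by auto
    define G where "G = B + U + L (B + U) * (B + U)\<^sup>2"
    have "0 \<le> L (B + U)" using image_nonneg[OF L(2)] B U0 by simp
    then have G0: "0 \<le> G" using B U0 by (simp add: G_def)
    show ?case
    proof (intro exI[of _ "B + (\<bar>R0\<bar> + G * Tm)"] conjI allI impI)
      show "0 \<le> B + (\<bar>R0\<bar> + G * Tm)" using B G0 Tm by simp
      fix d w \<xi>0 T \<xi> t
      assume d: "d \<in> Linf_loc D" and \<xi>0: "\<xi>0 \<in> carrier_vec n" "l1 n (\<lambda>k. \<xi>0 $ k) \<le> R0"
        and sol: "sd_solution (closed_loop n g k) n r d w \<xi>0 T \<xi>" and t: "0 \<le> t" "t \<le> Tm" "ereal t < T"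
      have car: "\<xi> s \<in> carrier_vec n" if "0 \<le> s" "ereal s < T" for s
        using sol that by (simp add: sd_solution_def)
      have int: "\<bar>\<xi> s $ j - \<xi> (sample_time r w i) $ j\<bar> \<le> (s - sample_time r w i) * G"
        if s: "sample_time r w i \<le> s" "s \<le> sample_time r w (Suc i)" "ereal s < T" "s \<le> Tm" for i s
      proof -
        define a where "a = sample_time r w i"
        define u where "u = k (\<xi> a)"
        define f where "f = (\<lambda>j s. closed_loop n g k (d s) (\<xi> s) (\<xi> (sample_time r w i)) $ j)"
        have a0: "0 \<le> a" unfolding a_def using r by (intro sample_time_nonneg) simp
        have ch: "chain_on L (n - 1) u a s (\<lambda>j s. \<xi> s $ j) f"
          unfolding a_def u_def f_def by (rule solution_chain[OF sol r d s(1-3)])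
        have "ereal a < T" using s by (auto simp: a_def intro: le_less_trans[OF _ s(3)])
        then have u: "\<bar>u\<bar> \<le> U" unfolding u_def by (intro U car a0)
        have jn: "j \<le> n - 1" using Suc by simp
        have "\<bar>f j v - 0\<bar> \<le> G" if v: "v \<in> {a..s}" for v
        proof -
          have vT: "ereal v < T" "v \<le> Tm" "0 \<le> v" using v s a0 by (auto intro: le_less_trans[OF _ s(3)])
          define z where "z = l1 j (\<lambda>k. \<xi> v $ k) + \<bar>u\<bar>"
          have z: "0 \<le> z" "z \<le> B + U" using IH[OF d \<xi>0 sol vT(3,2,1)] u by (auto simp: z_def)
          have "L z * z\<^sup>2 \<le> L (B + U) * (B + U)\<^sup>2 * 1\<^sup>2"
            by (rule growth_bound[OF L]) (use z B U0 in auto)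
          moreover have "\<bar>f j v - shift u (\<lambda>l. \<xi> v $ l) j\<bar> \<le> (if j = 0 then 0 else L z * z\<^sup>2)"
            using chain_onD(3,4)[OF ch jn v] by (simp add: z_def shift_def)
          moreover have "\<bar>shift u (\<lambda>l. \<xi> v $ l) j\<bar> \<le> B + U"
            using u B z abs_le_l1[of "j - 1" j "\<lambda>k. \<xi> v $ k"] by (auto simp: shift_def z_def)
          moreover have "0 \<le> L (B + U) * (B + U)\<^sup>2" using \<open>0 \<le> L (B + U)\<close> by simp
          ultimately show ?thesis unfolding G_def by (simp split: if_splits)
        qed
        then have "\<bar>integral {a..s} (f j) - (s - a) * 0\<bar> \<le> (s - a) * G"
          using chain_onD(1)[OF ch jn, of s] s by (intro integral_near_const) (auto simp: a_def)
        then show ?thesis using chain_onD(2)[OF ch jn, of s] s by (simp add: a_def)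
      qed
      \<comment> \<open>The increments are added sample by sample, because the right-hand side
        changes with the control at each of them; the rate \<open>G\<close> is common to all
        intervals.\<close>
      have samp: "\<bar>\<xi> (sample_time r w i) $ j\<bar> \<le> \<bar>R0\<bar> + G * sample_time r w i"
        if "sample_time r w i \<le> Tm" "ereal (sample_time r w i) < T" for i
        using that
      proof (induction i)
        case 0
        have "\<xi> 0 = \<xi>0" using sol by (simp add: sd_solution_def)
        then show ?case using abs_le_l1[of j n "\<lambda>k. \<xi>0 $ k"] Suc.prems \<xi>0 by simp
      next
        case (Suc i)
        have le: "sample_time r w i \<le> sample_time r w (Suc i)" using sample_time_less[OF r] by (simp add: less_imp_le)
        then have "ereal (sample_time r w i) < T" using Suc.prems(2) by (meson ereal_less_eq(3) le_less_trans)
        then have "\<bar>\<xi> (sample_time r w i) $ j\<bar> \<le> \<bar>R0\<bar> + G * sample_time r w i"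
          using le Suc.prems by (intro Suc.IH) auto
        with int[OF le order_refl Suc.prems(2,1)] show ?case by (simp add: algebra_simps del: sample_time.simps)
      qed
      have "T \<le> sample_horizon r w" using sol by (simp add: sd_solution_def)
      then obtain i where i: "sample_time r w i \<le> t" "t < sample_time r w (Suc i)"
        using sample_interval[OF r t(1)] t(3) by (metis order_less_le_trans)
      then have "ereal (sample_time r w i) < T" using t(3) by (meson ereal_less_eq(3) le_less_trans)
      then have "\<bar>\<xi> t $ j\<bar> \<le> \<bar>R0\<bar> + G * t"
        using samp[of i] int[of i t] i t by (simp add: algebra_simps del: sample_time.simps)
      also have "\<dots> \<le> \<bar>R0\<bar> + G * Tm" using t G0 by (intro add_left_mono mult_left_mono) auto
      finally show "l1 (Suc j) (\<lambda>k. \<xi> t $ k) \<le> B + (\<bar>R0\<bar> + G * Tm)"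
        using IH[OF d \<xi>0 sol t] by (simp add: l1_Suc)
    qed
  qed
  then show ?thesis by blast
qed

end

section \<open>Existence of solutions\<close>

text \<open>Stated on sequences, whose product topology is the one used for measurability below. The
  control is a fixed \<open>u\<close> because it is constant on a sampling interval.\<close>

lemma locally_Lipschitz_continuous:
  assumes "locally_Lipschitz D m h"
  shows "continuous_on (D \<times> UNIV) (\<lambda>z :: 'd::euclidean_space \<times> (nat \<Rightarrow> real). h (fst z) (Matrix.vec m (snd z)) u)"
  unfolding continuous_on_def
proof
  fix z0 :: "'d \<times> (nat \<Rightarrow> real)"
  assume "z0 \<in> D \<times> UNIV"
  then have d0: "fst z0 \<in> D" by auto
  define H where "H z = h (fst z) (Matrix.vec m (snd z)) u" for z :: "'d \<times> (nat \<Rightarrow> real)"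
  define \<delta> where "\<delta> z = sqrt ((dist (fst z) (fst z0))\<^sup>2 + (\<Sum>k<m. (snd z k - snd z0 k)\<^sup>2))"
    for z :: "'d \<times> (nat \<Rightarrow> real)"
  have vn: "(vnorm (Matrix.vec m f - Matrix.vec m f0))\<^sup>2 = (\<Sum>k<m. (f k - f0 k)\<^sup>2)" for f f0
  proof -
    have "(Matrix.vec m f - Matrix.vec m f0) \<bullet> (Matrix.vec m f - Matrix.vec m f0) = (\<Sum>k<m. (f k - f0 k)\<^sup>2)"
      by (simp add: scalar_prod_def power2_eq_square lessThan_atLeast0)
    then show ?thesis by (simp add: vnorm_def sum_nonneg)
  qed
  have "\<exists>\<epsilon>>0. \<exists>C. \<forall>d\<in>D. \<forall>d'\<in>D. \<forall>y\<in>carrier_vec m. \<forall>y'\<in>carrier_vec m. \<forall>v v'.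
      sqrt ((dist d (fst z0))\<^sup>2 + (vnorm (y - Matrix.vec m (snd z0)))\<^sup>2 + (v - u)\<^sup>2) < \<epsilon> \<and>
      sqrt ((dist d' (fst z0))\<^sup>2 + (vnorm (y' - Matrix.vec m (snd z0)))\<^sup>2 + (v' - u)\<^sup>2) < \<epsilon> \<longrightarrow>
      \<bar>h d y v - h d' y' v'\<bar> \<le> C * sqrt ((dist d d')\<^sup>2 + (vnorm (y - y'))\<^sup>2 + (v - v')\<^sup>2)"
    using assms[unfolded locally_Lipschitz_def Let_def, THEN bspec[OF _ d0],
      THEN bspec[OF _ vec_carrier], THEN spec, of "snd z0" u] .
  then obtain \<epsilon> C where \<epsilon>: "0 < \<epsilon>" and lip:
    "\<forall>d\<in>D. \<forall>d'\<in>D. \<forall>y\<in>carrier_vec m. \<forall>y'\<in>carrier_vec m. \<forall>v v'.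
      sqrt ((dist d (fst z0))\<^sup>2 + (vnorm (y - Matrix.vec m (snd z0)))\<^sup>2 + (v - u)\<^sup>2) < \<epsilon> \<and>
      sqrt ((dist d' (fst z0))\<^sup>2 + (vnorm (y' - Matrix.vec m (snd z0)))\<^sup>2 + (v' - u)\<^sup>2) < \<epsilon> \<longrightarrow>
      \<bar>h d y v - h d' y' v'\<bar> \<le> C * sqrt ((dist d d')\<^sup>2 + (vnorm (y - y'))\<^sup>2 + (v - v')\<^sup>2)"
    by blast
  have vn0: "vnorm (0\<^sub>v m) = 0" by (simp add: vnorm_def)
  have bound: "\<bar>H z - H z0\<bar> \<le> C * \<delta> z" if "fst z \<in> D" "\<delta> z < \<epsilon>" for z
    using lip[THEN bspec[OF _ that(1)], THEN bspec[OF _ d0], THEN bspec[OF _ vec_carrier],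
        THEN bspec[OF _ vec_carrier], THEN spec, THEN spec, of "snd z" u "snd z0" u] that(2) \<epsilon>
    by (simp add: H_def \<delta>_def vn vn0)
  have coord: "continuous_on UNIV (\<lambda>z :: 'd \<times> (nat \<Rightarrow> real). snd z k)" for k
    by (rule continuous_on_product_then_coordinatewise) (rule continuous_on_snd[OF continuous_on_id])
  have "continuous_on UNIV \<delta>"
    unfolding \<delta>_def by (intro continuous_intros coord)
  then have "(\<delta> \<longlongrightarrow> \<delta> z0) (at z0 within D \<times> UNIV)"
    by (meson UNIV_I continuous_on_def continuous_on_subset subset_UNIV tendsto_within_subset)
  then have \<delta>0: "(\<delta> \<longlongrightarrow> 0) (at z0 within D \<times> UNIV)" by (simp add: \<delta>_def)
  have "\<forall>\<^sub>F z in at z0 within D \<times> UNIV. \<delta> z < \<epsilon>" using \<delta>0 \<epsilon> by (rule order_tendstoD)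
  moreover have "\<forall>\<^sub>F z in at z0 within D \<times> UNIV. z \<in> D \<times> UNIV" by (simp add: eventually_at_filter)
  ultimately have "\<forall>\<^sub>F z in at z0 within D \<times> UNIV. norm (H z - H z0) \<le> C * \<delta> z"
    by eventually_elim (auto intro: bound)
  moreover have "((\<lambda>z. C * \<delta> z) \<longlongrightarrow> 0) (at z0 within D \<times> UNIV)"
    by (rule tendsto_mult_right_zero[OF \<delta>0])
  ultimately have "((\<lambda>z. H z - H z0) \<longlongrightarrow> 0) (at z0 within D \<times> UNIV)"
    by (rule Lim_null_comparison)
  then have "(H \<longlongrightarrow> H z0) (at z0 within D \<times> UNIV)" by (simp add: LIM_zero_iff)
  then show "((\<lambda>z. h (fst z) (Matrix.vec m (snd z)) u) \<longlongrightarrow> h (fst z0) (Matrix.vec m (snd z0)) u) (at z0 within D \<times> UNIV)"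
    by (simp add: H_def[abs_def])
qed

context chain_system
begin

text \<open>The control is frozen and the state is a family of coordinate functions, so that the
  coordinates can be constructed one after another.\<close>

definition rhs :: "real \<Rightarrow> (real \<Rightarrow> 'd) \<Rightarrow> (nat \<Rightarrow> real \<Rightarrow> real) \<Rightarrow> nat \<Rightarrow> real \<Rightarrow> real" where
  "rhs u d Y j s = (if j = 0 then u else Y (j - 1) s + g (j + 1) (d s) (Matrix.vec j (\<lambda>k. Y k s)) u)"

text \<open>The disturbance is merely measurable in time, so the claim comes from composing a
  continuous function on \<open>D \<times> UNIV\<close> with a measurable map.\<close>

lemma g_measurable:
  assumes j: "1 \<le> j" "j < n" and d: "d \<in> Linf_loc D" and a: "0 \<le> a"
    and Y: "\<And>k. k < j \<Longrightarrow> continuous_on {a..b} (Y k)"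
  shows "(\<lambda>s. g (j + 1) (d s) (Matrix.vec j (\<lambda>k. Y k s)) u) \<in> borel_measurable (lebesgue_on {a..b})"
proof -
  define H where "H z = g (j + 1) (fst z) (Matrix.vec j (snd z)) u" for z :: "'d \<times> (nat \<Rightarrow> real)"
  \<comment> \<open>Coordinates from \<open>j\<close> on are set to 0: nothing is known about
    \<open>Y k\<close> there, and \<open>Matrix.vec j\<close> does not read them.\<close>
  define z where "z s = (d s, \<lambda>k. if k < j then Y k s else 0)" for s
  have H: "H \<in> borel_measurable (restrict_space borel (D \<times> UNIV))"
    unfolding H_def
    by (intro borel_measurable_continuous_on_restrict locally_Lipschitz_continuous lip j)
  have "d \<in> borel_measurable (lebesgue_on {0..})" using d by (simp add: Linf_loc_def)
  then have dm: "d \<in> borel_measurable (lebesgue_on {a..b})"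
    by (rule measurable_restrict_mono) (use a in auto)
  have Ym: "(\<lambda>s. if k < j then Y k s else 0) \<in> borel_measurable (lebesgue_on {a..b})" for k
    using continuous_imp_measurable_on_sets_lebesgue[OF Y[of k]] by (cases "k < j") auto
  have "z \<in> borel_measurable (lebesgue_on {a..b})"
    unfolding z_def by (intro borel_measurable_Pair dm measurable_coordinatewise_then_product Ym)
  then have "z \<in> lebesgue_on {a..b} \<rightarrow>\<^sub>M restrict_space borel (D \<times> UNIV)"
    using Linf_loc_mem[OF d] a by (intro measurable_restrict_space2) (auto simp: z_def)
  then have "(\<lambda>s. H (z s)) \<in> borel_measurable (lebesgue_on {a..b})"
    using H by (rule measurable_compose)
  moreover have "H (z s) = g (j + 1) (d s) (Matrix.vec j (\<lambda>k. Y k s)) u" for s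
  proof -
    have "Matrix.vec j (\<lambda>k. if k < j then Y k s else 0) = Matrix.vec j (\<lambda>k. Y k s)"
      by (rule eq_vecI) auto
    then show ?thesis by (simp add: H_def z_def)
  qed
  ultimately show ?thesis by simp
qed

lemma rhs_integrable:
  assumes j: "j < n" and d: "d \<in> Linf_loc D" and a: "0 \<le> a"
    and Y: "\<And>k. k < j \<Longrightarrow> continuous_on {a..b} (Y k)"
  shows "rhs u d Y j absolutely_integrable_on {a..b}"
proof (cases "j = 0")
  case True
  then have "rhs u d Y j = (\<lambda>s. u)" by (simp add: rhs_def fun_eq_iff)
  then show ?thesis by (simp add: absolutely_integrable_continuous_real)
next
  case False
  define G where "G s = g (j + 1) (d s) (Matrix.vec j (\<lambda>k. Y k s)) u" for s
  define z where "z s = l1 j (\<lambda>k. Y k s) + \<bar>u\<bar>" for s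
  have "continuous_on {a..b} z"
    unfolding z_def l1_def by (intro continuous_intros Y) auto
  then have "bounded (z ` {a..b})" by (intro compact_imp_bounded compact_continuous_image) auto
  then obtain B where "\<forall>x\<in>z ` {a..b}. norm x \<le> B" unfolding bounded_iff by blast
  then have B: "\<bar>z s\<bar> \<le> B" if "s \<in> {a..b}" for s using that by simp
  have "G absolutely_integrable_on {a..b}"
  proof (rule measurable_bounded_by_integrable_imp_absolutely_integrable)
    show "G \<in> borel_measurable (lebesgue_on {a..b})"
      unfolding G_def by (rule g_measurable) (use False j d a Y in auto)
    show "(\<lambda>s. L \<bar>B\<bar> * \<bar>B\<bar>\<^sup>2) integrable_on {a..b}" by (rule integrable_const_ivl)
    fix s assume s: "s \<in> {a..b}"
    \<comment> \<open>The growth hypothesis speaks of a full state in \<open>carrier_vec n\<close>,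
      of which the first \<open>j\<close> coordinates are then extracted.\<close>
    have "vec_first (Matrix.vec n (\<lambda>k. Y k s)) j = Matrix.vec j (\<lambda>k. Y k s)"
      using j by (intro eq_vecI) (auto simp: vec_first_def)
    moreover have "l1 j (\<lambda>k. Matrix.vec n (\<lambda>k. Y k s) $ k) = l1 j (\<lambda>k. Y k s)"
      using j by (intro l1_cong) auto
    ultimately have "\<bar>G s\<bar> \<le> L (z s) * (z s)\<^sup>2"
      using g[of j "d s" "Matrix.vec n (\<lambda>k. Y k s)" u] Linf_loc_mem[OF d, of s] False j a s
      by (simp add: G_def z_def)
    also have "\<dots> \<le> L \<bar>B\<bar> * \<bar>B\<bar>\<^sup>2 * 1\<^sup>2"
      by (rule growth_bound[OF L]) (use B[OF s] in \<open>auto simp: z_def\<close>)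
    finally show "norm (G s) \<le> L \<bar>B\<bar> * \<bar>B\<bar>\<^sup>2" by simp
  qed simp
  moreover have "Y (j - 1) absolutely_integrable_on {a..b}"
    using Y[of "j - 1"] False by (intro absolutely_integrable_continuous_real) auto
  ultimately have "(\<lambda>s. Y (j - 1) s + G s) absolutely_integrable_on {a..b}"
    by (intro set_integral_add(1))
  moreover have "rhs u d Y j = (\<lambda>s. Y (j - 1) s + G s)"
    using False by (simp add: rhs_def G_def fun_eq_iff)
  ultimately show ?thesis by simp
qed

text \<open>Triangularity makes existence elementary: coordinate \<open>m\<close> does not occur in
  its own right-hand side, so one integration of known functions produces it, with no fixed-point
  argument and no possible blow-up.\<close>

lemma interval_solution_coordinates:
  assumes d: "d \<in> Linf_loc D" and a: "0 \<le> a" "a \<le> b" and "m \<le> n"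
  shows "\<exists>Y. \<forall>j<m. continuous_on {a..b} (Y j) \<and>
    (\<forall>t\<in>{a..b}. rhs u d Y j absolutely_integrable_on {a..t} \<and> Y j t = x j + integral {a..t} (rhs u d Y j))"
  using \<open>m \<le> n\<close>
proof (induction m)
  case (Suc m)
  from Suc.IH[OF Suc_leD[OF Suc.prems]] obtain Y where Y': "\<forall>j<m. continuous_on {a..b} (Y j) \<and>
    (\<forall>t\<in>{a..b}. rhs u d Y j absolutely_integrable_on {a..t} \<and> Y j t = x j + integral {a..t} (rhs u d Y j))" ..
  note Y = Y'[rule_format, THEN conjunct1] Y'[rule_format, THEN conjunct2, rule_format]
  have int: "rhs u d Y m absolutely_integrable_on {a..b}"
    using Suc.prems by (intro rhs_integrable d a Y) auto
  define Y' where "Y' = Y(m := \<lambda>t. x m + integral {a..t} (rhs u d Y m))"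
  \<comment> \<open>These right-hand sides read only coordinates below \<open>m\<close>, so adding
    coordinate \<open>m\<close> leaves them, its own included, unchanged.\<close>
  have rhs: "rhs u d Y' j = rhs u d Y j" if "j \<le> m" for j
  proof
    fix s
    have "Matrix.vec j (\<lambda>k. Y' k s) = Matrix.vec j (\<lambda>k. Y k s)"
      using that by (intro eq_vecI) (auto simp: Y'_def)
    then show "rhs u d Y' j s = rhs u d Y j s" using that by (auto simp: rhs_def Y'_def)
  qed
  show ?case
  proof (intro exI[of _ Y'] allI impI)
    fix j assume "j < Suc m"
    then consider "j < m" | "j = m" by linarith
    then show "continuous_on {a..b} (Y' j) \<and>
      (\<forall>t\<in>{a..b}. rhs u d Y' j absolutely_integrable_on {a..t} \<and> Y' j t = x j + integral {a..t} (rhs u d Y' j))"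
    proof cases
      case 1
      then have "Y' j = Y j" by (simp add: Y'_def)
      then show ?thesis using Y 1 rhs[of j] by auto
    next
      case 2
      have "continuous_on {a..b} (Y' m)"
        unfolding Y'_def using set_lebesgue_integral_eq_integral(1)[OF int]
        by (auto intro!: continuous_intros indefinite_integral_continuous_1)
      moreover have "rhs u d Y m absolutely_integrable_on {a..t}" if "t \<in> {a..b}" for t
        by (rule absolutely_integrable_on_subinterval[OF int]) (use that in auto)
      ultimately show ?thesis using 2 rhs[of m] by (auto simp: Y'_def)
    qed
  qed
qed simp

lemma interval_solution:
  assumes d: "d \<in> Linf_loc D" and a: "0 \<le> a" "a \<le> b" and x: "x \<in> carrier_vec n"
  shows "\<exists>Y. Y a = x \<and> (\<forall>s. Y s \<in> carrier_vec n) \<and> (\<forall>t\<in>{a..b}. \<forall>j<n.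
    (\<lambda>s. closed_loop n g k (d s) (Y s) x $ j) absolutely_integrable_on {a..t} \<and>
    Y t $ j = x $ j + integral {a..t} (\<lambda>s. closed_loop n g k (d s) (Y s) x $ j))"
proof -
  obtain Y where Y: "\<And>j t. j < n \<Longrightarrow> t \<in> {a..b} \<Longrightarrow> rhs (k x) d Y j absolutely_integrable_on {a..t} \<and>
    Y j t = x $ j + integral {a..t} (rhs (k x) d Y j)"
    using interval_solution_coordinates[OF d a order_refl, of "k x" "\<lambda>j. x $ j"] by blast
  define Z where "Z s = Matrix.vec n (\<lambda>j. Y j s)" for s
  have cl: "closed_loop n g k (d s) (Z s) x $ j = rhs (k x) d Y j s" if "j < n" for s j
  proof -
    have "vec_first (Z s) j = Matrix.vec j (\<lambda>k. Y k s)"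
      using that by (intro eq_vecI) (auto simp: vec_first_def Z_def)
    then show ?thesis using that by (auto simp: closed_loop_def rhs_def Z_def)
  qed
  show ?thesis
  proof (intro exI[of _ Z] conjI ballI allI impI)
    show "Z a = x"
      using x Y[of _ a] a by (intro eq_vecI) (auto simp: Z_def)
    show "Z s \<in> carrier_vec n" for s by (simp add: Z_def)
    fix t j assume "t \<in> {a..b}" "j < n"
    then show "(\<lambda>s. closed_loop n g k (d s) (Z s) x $ j) absolutely_integrable_on {a..t}"
      "Z t $ j = x $ j + integral {a..t} (\<lambda>s. closed_loop n g k (d s) (Z s) x $ j)"
      using Y[of j t] by (simp_all add: cl) (simp add: Z_def)
  qed
qed

text \<open>Gluing: each interval is solved with the end state of the previous one as sampled state,
  so the solution reaches the horizon, finite or not.\<close>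

lemma solution_exists:
  assumes r: "0 < r" and d: "d \<in> Linf_loc D" and \<xi>0: "\<xi>0 \<in> carrier_vec n"
  shows "\<exists>\<xi>. sd_solution (closed_loop n g k) n r d w \<xi>0 (sample_horizon r w) \<xi>"
proof -
  define \<tau> where "\<tau> = sample_time r w"
  have \<tau>0: "0 \<le> \<tau> i" for i unfolding \<tau>_def using r by (intro sample_time_nonneg) simp
  have \<tau>: "\<tau> i < \<tau> (Suc i)" for i unfolding \<tau>_def by (rule sample_time_less[OF r])
  have \<tau>mono: "\<tau> i \<le> \<tau> j" if "i \<le> j" for i j unfolding \<tau>_def by (rule sample_time_mono[OF r that])
  have "\<forall>i x. \<exists>Y. x \<in> carrier_vec n \<longrightarrow> Y (\<tau> i) = x \<and> (\<forall>s. Y s \<in> carrier_vec n) \<and> (\<forall>t\<in>{\<tau> i..\<tau> (Suc i)}. \<forall>j<n.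
    (\<lambda>s. closed_loop n g k (d s) (Y s) x $ j) absolutely_integrable_on {\<tau> i..t} \<and>
    Y t $ j = x $ j + integral {\<tau> i..t} (\<lambda>s. closed_loop n g k (d s) (Y s) x $ j))"
    using interval_solution[OF d \<tau>0 less_imp_le[OF \<tau>]] by blast
  then obtain \<Phi> where \<Phi>': "\<forall>i x. x \<in> carrier_vec n \<longrightarrow> \<Phi> i x (\<tau> i) = x \<and> (\<forall>s. \<Phi> i x s \<in> carrier_vec n) \<and> (\<forall>t\<in>{\<tau> i..\<tau> (Suc i)}. \<forall>j<n.
    (\<lambda>s. closed_loop n g k (d s) (\<Phi> i x s) x $ j) absolutely_integrable_on {\<tau> i..t} \<and>
    \<Phi> i x t $ j = x $ j + integral {\<tau> i..t} (\<lambda>s. closed_loop n g k (d s) (\<Phi> i x s) x $ j))"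
    unfolding choice_iff by blast
  define xs where "xs = rec_nat \<xi>0 (\<lambda>i x. \<Phi> i x (\<tau> (Suc i)))"
  have xs0: "xs 0 = \<xi>0" and xsS: "xs (Suc i) = \<Phi> i (xs i) (\<tau> (Suc i))" for i by (auto simp: xs_def)
  have xs: "xs i \<in> carrier_vec n" for i
    by (induction i) (use \<xi>0 \<Phi>' xs0 xsS in auto)
  note \<Phi> = \<Phi>'[rule_format, OF xs]
  \<comment> \<open>The strict inequality assigns a sampling time to the interval that starts there.
    The closed interval ending there agrees with it, because its end value is the next sampled
    state.\<close>
  define I where "I t = (LEAST i. t < \<tau> (Suc i))" for t
  define \<xi> where "\<xi> t = \<Phi> (I t) (xs (I t)) t" for t
  have I: "I t = i" if "\<tau> i \<le> t" "t < \<tau> (Suc i)" for i t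
    unfolding I_def
  proof (rule Least_equality[where x = i])
    fix j assume "t < \<tau> (Suc j)"
    then have "\<not> Suc j \<le> i" using \<tau>mono[of "Suc j" i] that by linarith
    then show "i \<le> j" by simp
  qed (rule that)
  have \<xi>\<tau>: "\<xi> (\<tau> i) = xs i" for i
    using I[of i "\<tau> i"] \<tau>[of i] \<Phi>[of i] by (simp add: \<xi>_def)
  have \<xi>: "\<xi> s = \<Phi> i (xs i) s" if "s \<in> {\<tau> i..\<tau> (Suc i)}" for i s
  proof (cases "s = \<tau> (Suc i)")
    case True
    then show ?thesis using \<xi>\<tau>[of "Suc i"] xsS[of i] by simp
  next
    case False
    then show ?thesis using I[of i s] that by (simp add: \<xi>_def)
  qed
  have "ereal (\<tau> 1) \<le> sample_horizon r w" unfolding sample_horizon_def \<tau>_def by (rule SUP_upper) simp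
  moreover have "0 < \<tau> 1" using \<tau>[of 0] \<tau>0[of 0] by (simp add: \<tau>_def)
  ultimately have hor: "0 < sample_horizon r w"
    using less_le_trans[of 0 "ereal (\<tau> 1)"] by simp
  show ?thesis
    unfolding sd_solution_def Let_def \<tau>_def[symmetric]
  proof (intro exI[of _ \<xi>] conjI allI impI hor order_refl)
    show "\<xi> 0 = \<xi>0" using \<xi>\<tau>[of 0] xs0 by (simp add: \<tau>_def)
    show "\<xi> t \<in> carrier_vec n" for t using \<Phi> by (simp add: \<xi>_def)
    fix i t j assume *: "\<tau> i \<le> t \<and> t \<le> \<tau> (Suc i) \<and> ereal t < sample_horizon r w \<and> j < n"
    then have t: "t \<in> {\<tau> i..\<tau> (Suc i)}" and j: "j < n" by auto
    have eq: "closed_loop n g k (d s) (\<Phi> i (xs i) s) (xs i) $ j = closed_loop n g k (d s) (\<xi> s) (\<xi> (\<tau> i)) $ j"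
      if "s \<in> {\<tau> i..t}" for s
      using \<xi>[of s i] that t by (simp add: \<xi>\<tau>)
    have P: "(\<lambda>s. closed_loop n g k (d s) (\<Phi> i (xs i) s) (xs i) $ j) absolutely_integrable_on {\<tau> i..t}"
      "\<Phi> i (xs i) t $ j = xs i $ j + integral {\<tau> i..t} (\<lambda>s. closed_loop n g k (d s) (\<Phi> i (xs i) s) (xs i) $ j)"
      using \<Phi>[of i] t j by auto
    show "(\<lambda>s. closed_loop n g k (d s) (\<xi> s) (\<xi> (\<tau> i)) $ j) absolutely_integrable_on {\<tau> i..t}"
      using P(1) by (rule absolutely_integrable_spike[where S = "{}"]) (use eq in auto)
    show "\<xi> t $ j = \<xi> (\<tau> i) $ j + integral {\<tau> i..t} (\<lambda>s. closed_loop n g k (d s) (\<xi> s) (\<xi> (\<tau> i)) $ j)"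
      using P(2) \<xi>[OF t] integral_cong[of "{\<tau> i..t}", OF eq] by (simp add: \<xi>\<tau>)
  qed
qed

end

section \<open>Convergence of the sampled states\<close>

text \<open>Since \<open>w\<close> is nonnegative, no step exceeds \<open>r\<close>, which limits
  the wait for the first sample after \<open>\<Theta>\<close>. At that sample the energy can be
  bounded by the finite-time estimate.\<close>

lemma first_sample:
  assumes "0 < r" "w \<in> Linf_loc {0..}" "0 \<le> \<Theta>" "\<Theta> \<le> sample_time r w k"
  obtains k0 where "k0 \<le> k" "\<Theta> \<le> sample_time r w k0" "sample_time r w k0 \<le> \<Theta> + r"
proof -
  define k0 where "k0 = (LEAST k. \<Theta> \<le> sample_time r w k)"
  have k0: "\<Theta> \<le> sample_time r w k0" unfolding k0_def using assms(4) by (rule LeastI)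
  have le: "k0 \<le> k" unfolding k0_def using assms(4) by (rule Least_le)
  have "sample_time r w k0 \<le> \<Theta> + r"
  proof (cases k0)
    case 0
    then show ?thesis using assms by simp
  next
    case (Suc j)
    then have "\<not> \<Theta> \<le> sample_time r w j"
      using not_less_Least[of j "\<lambda>k. \<Theta> \<le> sample_time r w k"] by (simp add: k0_def)
    then show ?thesis using sample_time_step[OF assms(1,2), of j] Suc by (simp del: sample_time.simps)
  qed
  with le k0 show ?thesis by (rule that)
qed

lemma quadratic_small:
  fixes C \<eta> :: real
  assumes "0 < \<eta>"
  obtains \<delta> where "0 < \<delta>" "\<And>N. 0 \<le> N \<Longrightarrow> N \<le> \<delta> \<Longrightarrow> C * (N\<^sup>2 + N) \<le> \<eta>"
proof
  define \<delta> where "\<delta> = min 1 (\<eta> / (2 * (\<bar>C\<bar> + 1)))"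
  show "0 < \<delta>" using assms by (simp add: \<delta>_def)
  fix N assume N: "0 \<le> N" "N \<le> \<delta>"
  then have "N\<^sup>2 \<le> N" by (simp add: \<delta>_def power2_eq_square mult_left_le)
  have "C * (N\<^sup>2 + N) \<le> (\<bar>C\<bar> + 1) * (N\<^sup>2 + N)" using N by (intro mult_right_mono) auto
  also have "\<dots> \<le> (\<bar>C\<bar> + 1) * (2 * (\<eta> / (2 * (\<bar>C\<bar> + 1))))"
    using N \<open>N\<^sup>2 \<le> N\<close> by (intro mult_left_mono) (auto simp: \<delta>_def)
  also have "\<dots> = \<eta>" by (simp add: field_simps)
  finally show "C * (N\<^sup>2 + N) \<le> \<eta>" .
qed

context chain_system
begin

text \<open>Fixed by choice from \<open>L\<close> and \<open>i\<close> only, before any feedback is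
  known: gains and step bounds are computed from it.\<close>

definition Cs :: "nat \<Rightarrow> real" where
  "Cs i = (SOME C. 0 \<le> C \<and> (\<forall>Y f a b u. a \<le> b \<longrightarrow> b - a \<le> 1 \<longrightarrow> chain_on L i u a b Y f \<longrightarrow>
    close_step C i (b - a) u (\<lambda>k. Y k a) (\<lambda>k. Y k b) \<and>
    (l1 i (\<lambda>k. Y k a) + \<bar>u\<bar> \<le> 1 \<longrightarrow>
      (\<forall>j\<le>i. \<bar>Y j b - Y j a\<bar> \<le> C * (l1 i (\<lambda>k. Y k a) + \<bar>u\<bar>)))))"

lemma Cs_nonneg: "0 \<le> Cs i"
  and Cs_step: "a \<le> b \<Longrightarrow> b - a \<le> 1 \<Longrightarrow> chain_on L i u a b Y f \<Longrightarrow>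
    close_step (Cs i) i (b - a) u (\<lambda>k. Y k a) (\<lambda>k. Y k b)"
  and Cs_near: "a \<le> b \<Longrightarrow> b - a \<le> 1 \<Longrightarrow> chain_on L i u a b Y f \<Longrightarrow>
    l1 i (\<lambda>k. Y k a) + \<bar>u\<bar> \<le> 1 \<Longrightarrow> j \<le> i \<Longrightarrow> \<bar>Y j b - Y j a\<bar> \<le> Cs i * (l1 i (\<lambda>k. Y k a) + \<bar>u\<bar>)"
  using someI_ex[OF chain_estimates[OF L, of i], folded Cs_def] by blast+

lemma chain_on_mono: "chain_on L i u a b Y f \<Longrightarrow> j \<le> i \<Longrightarrow> chain_on L j u a b Y f"
  unfolding chain_on_def by (meson le_trans)

lemma sample_step:
  assumes sol: "sd_solution (closed_loop n g k) n r d w \<xi>0 T \<xi>" and r: "0 < r" "r \<le> 1"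
    and d: "d \<in> Linf_loc D" and w: "w \<in> Linf_loc {0..}"
    and T: "ereal (sample_time r w (Suc i)) < T"
    and x: "x = \<xi> (sample_time r w i)" and x': "x' = \<xi> (sample_time r w (Suc i))"
    and h: "h = sample_time r w (Suc i) - sample_time r w i"
  shows "0 < h" "h \<le> r" "x' $ 0 = x $ 0 + h * k x"
    "s < n \<Longrightarrow> close_step (Cs s) s h (k x) (\<lambda>j. x $ j) (\<lambda>j. x' $ j)"
proof -
  show h0: "0 < h" using sample_time_less[OF r(1)] by (simp add: h del: sample_time.simps)
  show hr: "h \<le> r" unfolding h by (rule sample_time_step[OF r(1) w])
  have ab: "sample_time r w i \<le> sample_time r w (Suc i)" using h0 h by simp
  let ?f = "\<lambda>j s. closed_loop n g k (d s) (\<xi> s) (\<xi> (sample_time r w i)) $ j"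
  have ch: "chain_on L (n - 1) (k x) (sample_time r w i) (sample_time r w (Suc i)) (\<lambda>j s. \<xi> s $ j) ?f"
    unfolding x by (rule solution_chain[OF sol r(1) d ab order_refl T])
  have "\<bar>integral {sample_time r w i..sample_time r w (Suc i)} (?f 0) - h * k x\<bar> \<le> h * 0"
    unfolding h
  proof (rule integral_near_const)
    show "?f 0 integrable_on {sample_time r w i..sample_time r w (Suc i)}"
      using chain_onD(1)[OF ch, of 0 "sample_time r w (Suc i)"] ab by auto
    show "\<bar>?f 0 s - k x\<bar> \<le> 0" if "s \<in> {sample_time r w i..sample_time r w (Suc i)}" for s
      using chain_onD(3)[OF ch _ that, of 0] by simp
  qed (rule ab)
  then show "x' $ 0 = x $ 0 + h * k x"
    using chain_onD(2)[OF ch, of 0 "sample_time r w (Suc i)"] ab by (simp add: x x' del: sample_time.simps)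
  show "close_step (Cs s) s h (k x) (\<lambda>j. x $ j) (\<lambda>j. x' $ j)" if "s < n"
    using Cs_step[OF ab _ chain_on_mono[OF ch], of s] that hr r
    by (simp add: x x' h del: sample_time.simps)
qed

lemma between_samples:
  assumes sol: "sd_solution (closed_loop n g k) n r d w \<xi>0 T \<xi>" and r: "0 < r" "r \<le> 1"
    and d: "d \<in> Linf_loc D" and w: "w \<in> Linf_loc {0..}"
    and t: "sample_time r w i \<le> t" "t \<le> sample_time r w (Suc i)" "ereal t < T"
    and x: "x = \<xi> (sample_time r w i)" and small: "l1 n (\<lambda>j. x $ j) + \<bar>k x\<bar> \<le> 1"
  shows "l1 n (\<lambda>j. \<xi> t $ j) \<le> l1 n (\<lambda>j. x $ j) + n * (Cs (n - 1) * (l1 n (\<lambda>j. x $ j) + \<bar>k x\<bar>))"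
proof -
  let ?f = "\<lambda>j s. closed_loop n g k (d s) (\<xi> s) (\<xi> (sample_time r w i)) $ j"
  have ch: "chain_on L (n - 1) (k x) (sample_time r w i) t (\<lambda>j s. \<xi> s $ j) ?f"
    unfolding x by (rule solution_chain[OF sol r(1) d t])
  have l: "l1 (n - 1) (\<lambda>j. x $ j) \<le> l1 n (\<lambda>j. x $ j)" by (rule l1_mono) simp
  have h: "t - sample_time r w i \<le> 1" using sample_time_step[OF r(1) w, of i] t r by linarith
  show ?thesis
  proof (rule l1_near)
    fix j assume j: "j < n"
    have "\<bar>\<xi> t $ j - x $ j\<bar> \<le> Cs (n - 1) * (l1 (n - 1) (\<lambda>j. x $ j) + \<bar>k x\<bar>)"
      using Cs_near[OF t(1) h ch, of j] small l j by (simp add: x)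
    also have "\<dots> \<le> Cs (n - 1) * (l1 n (\<lambda>j. x $ j) + \<bar>k x\<bar>)"
      using l by (intro mult_left_mono Cs_nonneg) auto
    finally show "\<bar>\<xi> t $ j - x $ j\<bar> \<le> Cs (n - 1) * (l1 n (\<lambda>j. x $ j) + \<bar>k x\<bar>)" .
  qed
qed

end

text \<open>What remains of the closed loop once the parameters are chosen: \<open>idx\<close> is
  the active stage, with stage 0 included, and \<open>step\<close> gives its monotonicity and the
  loss of energy. By \<open>idx_top\<close>, below the top stage the coordinates up to
  \<open>idx x\<close> are not small, hence neither is the dissipation, and this forces the stage to
  change. \<open>\<rho>\<close> and \<open>B\<close> control the feedback near 0, \<open>U\<close>
  everywhere.\<close>

locale staged_loop = chain_system n D g L
  for n :: nat and D :: "'d::euclidean_space set" and g L +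
  fixes k :: "rvec \<Rightarrow> real" and r :: real and idx :: "(nat \<Rightarrow> real) \<Rightarrow> nat"
    and W :: "nat \<Rightarrow> (nat \<Rightarrow> real) \<Rightarrow> real" and \<beta> Cw \<omega> :: "nat \<Rightarrow> real" and c :: "nat \<Rightarrow> nat \<Rightarrow> real"
    and U \<rho> B :: real
  assumes r: "0 < r" "r \<le> 1"
    and U: "\<And>x. x \<in> carrier_vec n \<Longrightarrow> \<bar>k x\<bar> \<le> U"
    and \<rho>: "0 < \<rho>"
    and B: "0 \<le> B" "\<And>x. x \<in> carrier_vec n \<Longrightarrow> l1 n (\<lambda>j. x $ j) \<le> \<rho> \<Longrightarrow> \<bar>k x\<bar> \<le> B * l1 n (\<lambda>j. x $ j)"
    and idx_le: "\<And>x. idx x \<le> n - 1"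
    and idx_top: "\<And>x. l1 (Suc (idx x)) x \<le> \<rho> \<Longrightarrow> idx x = n - 1"
    and \<omega>: "\<And>s. s < n \<Longrightarrow> 0 < \<omega> s" and \<beta>: "\<And>s. s < n \<Longrightarrow> 0 < \<beta> s"
    and W_ge: "\<And>s x. s < n \<Longrightarrow> \<beta> s * diss s (c s) (\<omega> s) x \<le> W s x"
    and W_le: "\<And>s x. s < n \<Longrightarrow> W s x \<le> Cw s * ((l1 (Suc s) x)\<^sup>2 + l1 (Suc s) x)"
    and step: "\<And>h x x'. 0 < h \<Longrightarrow> h \<le> r \<Longrightarrow> x \<in> carrier_vec n \<Longrightarrow> x' 0 = x $ 0 + h * k x \<Longrightarrow>
      (\<And>s. s < n \<Longrightarrow> close_step (Cs s) s h (k x) (\<lambda>j. x $ j) x') \<Longrightarrow>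
      idx (\<lambda>j. x $ j) \<le> idx x' \<and>
      W (idx (\<lambda>j. x $ j)) x' \<le> W (idx (\<lambda>j. x $ j)) (\<lambda>j. x $ j) -
        h * (\<beta> (idx (\<lambda>j. x $ j)) * diss (idx (\<lambda>j. x $ j)) (c (idx (\<lambda>j. x $ j))) (\<omega> (idx (\<lambda>j. x $ j))) (\<lambda>j. x $ j))"
begin

definition traj :: "(real \<Rightarrow> 'd) \<Rightarrow> (real \<Rightarrow> real) \<Rightarrow> rvec \<Rightarrow> ereal \<Rightarrow> (real \<Rightarrow> rvec) \<Rightarrow> bool" where
  "traj d w \<xi>0 T \<xi> \<longleftrightarrow> d \<in> Linf_loc D \<and> w \<in> Linf_loc {0..} \<and> \<xi>0 \<in> carrier_vec n \<and>
     sd_solution (closed_loop n g k) n r d w \<xi>0 T \<xi>"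

abbreviation "\<tau> \<equiv> sample_time r"
abbreviation "X w \<xi> i \<equiv> (\<lambda>j. \<xi> (\<tau> w i) $ j)"

lemma W_nonneg: "s < n \<Longrightarrow> 0 \<le> W s x"
  using W_ge[of s x] \<beta>[of s] diss_nonneg[of s "c s" "\<omega> s" x] by (meson less_imp_le mult_nonneg_nonneg order_trans)

lemma sample_carrier:
  assumes "traj d w \<xi>0 T \<xi>" "ereal (\<tau> w i) < T"
  shows "\<xi> (\<tau> w i) \<in> carrier_vec n"
  using assms sample_time_nonneg[of r w i] r by (auto simp: traj_def sd_solution_def)

lemma sample_before:
  assumes "i \<le> j" "ereal (\<tau> w j) < T"
  shows "ereal (\<tau> w i) < T"
  using sample_time_mono[OF r(1) assms(1), of w] assms(2) by (meson ereal_less_eq(3) le_less_trans)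

lemma traj_step:
  assumes tr: "traj d w \<xi>0 T \<xi>" and T: "ereal (\<tau> w (Suc i)) < T"
  shows "idx (X w \<xi> i) \<le> idx (X w \<xi> (Suc i))"
    and "idx (X w \<xi> i) = s \<Longrightarrow> W s (X w \<xi> (Suc i)) \<le> W s (X w \<xi> i) -
      (\<tau> w (Suc i) - \<tau> w i) * (\<beta> s * diss s (c s) (\<omega> s) (X w \<xi> i))"
proof -
  have sol: "sd_solution (closed_loop n g k) n r d w \<xi>0 T \<xi>" and d: "d \<in> Linf_loc D" and w: "w \<in> Linf_loc {0..}"
    using tr by (auto simp: traj_def)
  note st = sample_step[OF sol r d w T refl refl refl]
  note s = step[OF st(1,2) sample_carrier[OF tr sample_before[OF _ T]] st(3,4)]
  show "idx (X w \<xi> i) \<le> idx (X w \<xi> (Suc i))" using s by (simp del: sample_time.simps)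
  show "W s (X w \<xi> (Suc i)) \<le> W s (X w \<xi> i) - (\<tau> w (Suc i) - \<tau> w i) * (\<beta> s * diss s (c s) (\<omega> s) (X w \<xi> i))"
    if "idx (X w \<xi> i) = s" using s that by (auto simp del: sample_time.simps)
qed

lemma idx_mono:
  assumes tr: "traj d w \<xi>0 T \<xi>" and "i \<le> j" "ereal (\<tau> w j) < T"
  shows "idx (X w \<xi> i) \<le> idx (X w \<xi> j)"
  using assms(2,3)
proof (induction rule: dec_induct)
  case (step j)
  then show ?case
    using traj_step(1)[OF tr step.prems] sample_before[of j "Suc j" w T] by (meson le_SucI le_refl order_trans)
qed simp

text \<open>The loss is proportional to elapsed time and so survives arbitrarily short steps. With
  \<open>\<epsilon> = 0\<close> the lemma serves as monotonicity of the energy.\<close>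

lemma W_decrease:
  assumes tr: "traj d w \<xi>0 T \<xi>" and "i \<le> j" "ereal (\<tau> w j) < T" and s: "s < n" and \<epsilon>: "0 \<le> \<epsilon>"
    and stay: "\<And>l. i \<le> l \<Longrightarrow> l < j \<Longrightarrow> idx (X w \<xi> l) = s \<and> \<epsilon> \<le> diss s (c s) (\<omega> s) (X w \<xi> l)"
  shows "W s (X w \<xi> j) \<le> W s (X w \<xi> i) - \<beta> s * \<epsilon> * (\<tau> w j - \<tau> w i)"
  using assms(2,3) stay
proof (induction rule: dec_induct)
  case (step j)
  have "W s (X w \<xi> j) \<le> W s (X w \<xi> i) - \<beta> s * \<epsilon> * (\<tau> w j - \<tau> w i)"
    using step.prems sample_before[of j "Suc j" w T] by (intro step.IH) auto
  moreover have "W s (X w \<xi> (Suc j)) \<le> W s (X w \<xi> j) - (\<tau> w (Suc j) - \<tau> w j) * (\<beta> s * diss s (c s) (\<omega> s) (X w \<xi> j))"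
    using step by (intro traj_step(2)[OF tr]) auto
  moreover have "(\<tau> w (Suc j) - \<tau> w j) * (\<beta> s * \<epsilon>) \<le> (\<tau> w (Suc j) - \<tau> w j) * (\<beta> s * diss s (c s) (\<omega> s) (X w \<xi> j))"
    using step.prems(2)[of j] step.hyps \<beta>[OF s] sample_time_less[OF r(1), of w j]
    by (intro mult_left_mono) (auto simp del: sample_time.simps)
  ultimately show ?case by (simp add: algebra_simps del: sample_time.simps)
qed simp

text \<open>While stage \<open>s\<close> is not active nothing makes \<open>W s\<close> decrease, so
  its value on entry is bounded through the state over finite time.\<close>

lemma sample_bound:
  assumes "0 \<le> Tm" and s: "s < n"
  shows "\<exists>M. \<forall>d w \<xi>0 T \<xi> i. traj d w \<xi>0 T \<xi> \<longrightarrow> l1 n (\<lambda>j. \<xi>0 $ j) \<le> R0 \<longrightarrow> \<tau> w i \<le> Tm \<longrightarrow>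
    ereal (\<tau> w i) < T \<longrightarrow> W s (X w \<xi> i) \<le> M"
proof -
  obtain B where B: "\<And>d w \<xi>0 T \<xi> t. d \<in> Linf_loc D \<Longrightarrow> \<xi>0 \<in> carrier_vec n \<Longrightarrow> l1 n (\<lambda>k. \<xi>0 $ k) \<le> R0 \<Longrightarrow>
    sd_solution (closed_loop n g k) n r d w \<xi>0 T \<xi> \<Longrightarrow> 0 \<le> t \<Longrightarrow> t \<le> Tm \<Longrightarrow> ereal t < T \<Longrightarrow>
    l1 n (\<lambda>k. \<xi> t $ k) \<le> B"
    using finite_time_bound[where k = k and U = U and ?R0.0 = R0, OF r(1) U assms(1)] by blast
  show ?thesis
  proof (intro exI[of _ "\<bar>Cw s\<bar> * (B\<^sup>2 + B)"] allI impI)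
    fix d w \<xi>0 T \<xi> i
    assume *: "traj d w \<xi>0 T \<xi>" "l1 n (\<lambda>j. \<xi>0 $ j) \<le> R0" "\<tau> w i \<le> Tm" "ereal (\<tau> w i) < T"
    define N where "N = l1 (Suc s) (X w \<xi> i)"
    have "l1 n (X w \<xi> i) \<le> B"
      using * r by (intro B) (auto simp: traj_def intro: sample_time_nonneg)
    then have N: "0 \<le> N" "N \<le> B" using l1_mono[of "Suc s" n "X w \<xi> i"] s by (auto simp: N_def)
    have "W s (X w \<xi> i) \<le> Cw s * (N\<^sup>2 + N)" unfolding N_def by (rule W_le[OF s])
    also have "\<dots> \<le> \<bar>Cw s\<bar> * (N\<^sup>2 + N)" using N by (intro mult_right_mono) auto
    also have "\<dots> \<le> \<bar>Cw s\<bar> * (B\<^sup>2 + B)" using N by (intro mult_left_mono add_mono power_mono) auto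
    finally show "W s (X w \<xi> i) \<le> \<bar>Cw s\<bar> * (B\<^sup>2 + B)" .
  qed
qed

text \<open>Stage \<open>s\<close> cannot stay active for longer than its energy on entry divided by
  the loss rate \<open>\<beta> s * \<epsilon>\<close>, where \<open>\<epsilon>\<close> comes from
  \<open>idx_top\<close> and \<open>diss_small\<close>. This time is uniform in the inputs, and the
  induction on \<open>s\<close> adds up finitely many such times.\<close>

lemma eventually_stage:
  assumes "s \<le> n - 1"
  shows "\<exists>\<Theta>\<ge>0. \<forall>d w \<xi>0 T \<xi> i. traj d w \<xi>0 T \<xi> \<longrightarrow> l1 n (\<lambda>j. \<xi>0 $ j) \<le> R0 \<longrightarrow> \<Theta> \<le> \<tau> w i \<longrightarrow>
    ereal (\<tau> w i) < T \<longrightarrow> s \<le> idx (X w \<xi> i)"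
  using assms
proof (induction s)
  case 0
  show ?case by (intro exI[of _ 0]) simp
next
  case (Suc s)
  have sn: "s < n" using Suc.prems by simp
  obtain \<Theta> where \<Theta>: "0 \<le> \<Theta>" and IH: "\<And>d w \<xi>0 T \<xi> i. traj d w \<xi>0 T \<xi> \<Longrightarrow> l1 n (\<lambda>j. \<xi>0 $ j) \<le> R0 \<Longrightarrow>
    \<Theta> \<le> \<tau> w i \<Longrightarrow> ereal (\<tau> w i) < T \<Longrightarrow> s \<le> idx (X w \<xi> i)"
    using Suc by (auto simp del: sample_time.simps)
  obtain \<epsilon> where \<epsilon>: "0 < \<epsilon>" "\<And>x. diss s (c s) (\<omega> s) x \<le> \<epsilon> \<Longrightarrow> l1 (Suc s) x \<le> \<rho>"
    using diss_small[OF \<omega>[OF sn] \<rho>] by blast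
  obtain M where M: "\<And>d w \<xi>0 T \<xi> i. traj d w \<xi>0 T \<xi> \<Longrightarrow> l1 n (\<lambda>j. \<xi>0 $ j) \<le> R0 \<Longrightarrow> \<tau> w i \<le> \<Theta> + r \<Longrightarrow>
    ereal (\<tau> w i) < T \<Longrightarrow> W s (X w \<xi> i) \<le> M"
    using sample_bound[of "\<Theta> + r" s R0, OF _ sn] \<Theta> r by (meson add_nonneg_nonneg less_imp_le)
  have \<beta>\<epsilon>: "0 < \<beta> s * \<epsilon>" using \<beta>[OF sn] \<epsilon> by simp
  \<comment> \<open>In the witness, \<open>r\<close> covers the wait for the first sample after
    \<open>\<Theta>\<close>, and the \<open>1\<close> makes the energy strictly negative in the
    contradiction.\<close>
  show ?case
  proof (intro exI[of _ "\<Theta> + r + (\<bar>M\<bar> + 1) / (\<beta> s * \<epsilon>)"] conjI allI impI)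
    show "0 \<le> \<Theta> + r + (\<bar>M\<bar> + 1) / (\<beta> s * \<epsilon>)" using \<Theta> r \<beta>\<epsilon> by simp
    fix d w \<xi>0 T \<xi> i
    assume tr: "traj d w \<xi>0 T \<xi>" and R0: "l1 n (\<lambda>j. \<xi>0 $ j) \<le> R0"
      and i: "\<Theta> + r + (\<bar>M\<bar> + 1) / (\<beta> s * \<epsilon>) \<le> \<tau> w i" and T: "ereal (\<tau> w i) < T"
    have w: "w \<in> Linf_loc {0..}" using tr by (simp add: traj_def)
    have "0 \<le> (\<bar>M\<bar> + 1) / (\<beta> s * \<epsilon>)" using \<beta>\<epsilon> by simp
    then have "\<Theta> \<le> \<tau> w i" using i r by linarith
    then obtain i0 where i0: "i0 \<le> i" "\<Theta> \<le> \<tau> w i0" "\<tau> w i0 \<le> \<Theta> + r"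
      using first_sample[OF r(1) w \<Theta>] by blast
    show "Suc s \<le> idx (X w \<xi> i)"
    proof (rule ccontr)
      assume "\<not> ?thesis"
      then have lt: "idx (X w \<xi> i) \<le> s" by simp
      have stay: "idx (X w \<xi> l) = s \<and> \<epsilon> \<le> diss s (c s) (\<omega> s) (X w \<xi> l)" if l: "i0 \<le> l" "l < i" for l
      proof -
        have lT: "ereal (\<tau> w l) < T" using l by (intro sample_before[OF _ T]) simp
        have "\<Theta> \<le> \<tau> w l" using i0(2) sample_time_mono[OF r(1) l(1), of w] by simp
        then have "s \<le> idx (X w \<xi> l)" by (rule IH[OF tr R0 _ lT])
        moreover have "idx (X w \<xi> l) \<le> idx (X w \<xi> i)" using l by (intro idx_mono[OF tr _ T]) simp
        ultimately have eq: "idx (X w \<xi> l) = s" using lt by simp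
        have "\<not> l1 (Suc s) (X w \<xi> l) \<le> \<rho>" using idx_top[of "X w \<xi> l"] eq Suc.prems by auto
        then show ?thesis using \<epsilon>(2)[of "X w \<xi> l"] eq by linarith
      qed
      have "W s (X w \<xi> i) \<le> W s (X w \<xi> i0) - \<beta> s * \<epsilon> * (\<tau> w i - \<tau> w i0)"
        by (rule W_decrease[OF tr i0(1) T sn less_imp_le[OF \<epsilon>(1)] stay])
      moreover have "W s (X w \<xi> i0) \<le> M" using i0 by (intro M[OF tr R0] sample_before[OF _ T])
      moreover have "\<beta> s * \<epsilon> * ((\<bar>M\<bar> + 1) / (\<beta> s * \<epsilon>)) \<le> \<beta> s * \<epsilon> * (\<tau> w i - \<tau> w i0)"
        using i i0 \<beta>\<epsilon> by (intro mult_left_mono) auto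
      moreover have "\<beta> s * \<epsilon> * ((\<bar>M\<bar> + 1) / (\<beta> s * \<epsilon>)) = \<bar>M\<bar> + 1"
        using \<beta>\<epsilon> by (metis less_irrefl nonzero_mult_div_cancel_left times_divide_eq_right)
      ultimately show False using W_nonneg[OF sn, of "X w \<xi> i"] by linarith
    qed
  qed
qed

section \<open>The top stage: its energy against the full state\<close>

lemma top_less: "n - 1 < n" using n by simp

lemma W_top_small:
  assumes "0 < \<epsilon>"
  obtains \<eta> where "0 < \<eta>" "\<And>x. W (n - 1) x \<le> \<eta> \<Longrightarrow> l1 n x \<le> \<epsilon>"
proof -
  obtain \<epsilon>' where \<epsilon>': "0 < \<epsilon>'" "\<And>x. diss (n - 1) (c (n - 1)) (\<omega> (n - 1)) x \<le> \<epsilon>' \<Longrightarrow> l1 (Suc (n - 1)) x \<le> \<epsilon>"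
    using diss_small[OF \<omega>[OF top_less] assms] by blast
  show ?thesis
  proof
    show "0 < \<beta> (n - 1) * \<epsilon>'" using \<beta>[OF top_less] \<epsilon>' by simp
    fix x assume "W (n - 1) x \<le> \<beta> (n - 1) * \<epsilon>'"
    then have "\<beta> (n - 1) * diss (n - 1) (c (n - 1)) (\<omega> (n - 1)) x \<le> \<beta> (n - 1) * \<epsilon>'"
      using W_ge[OF top_less] order_trans by blast
    then show "l1 n x \<le> \<epsilon>" using \<epsilon>'(2)[of x] \<beta>[OF top_less] n by simp
  qed
qed

lemma W_small_of_l1:
  assumes "0 < \<eta>"
  obtains \<delta> where "0 < \<delta>" "\<And>x. l1 n x \<le> \<delta> \<Longrightarrow> W (n - 1) x \<le> \<eta>"
proof -
  obtain \<delta> where "0 < \<delta>" and \<delta>: "\<And>N. 0 \<le> N \<Longrightarrow> N \<le> \<delta> \<Longrightarrow> Cw (n - 1) * (N\<^sup>2 + N) \<le> \<eta>"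
    using quadratic_small[OF assms, of "Cw (n - 1)"] by blast
  have "W (n - 1) x \<le> \<eta>" if "l1 n x \<le> \<delta>" for x
    using W_le[OF top_less, of x] \<delta>[OF l1_nonneg that] n by simp
  with \<open>0 < \<delta>\<close> show ?thesis by (rule that)
qed

text \<open>An initial state below \<open>\<rho>\<close> is in the top stage, which is then never
  left; its energy controls the full state and does not increase.\<close>

lemma samples_stable:
  assumes "0 < \<epsilon>"
  shows "\<exists>\<delta>>0. \<forall>d w \<xi>0 T \<xi> i. traj d w \<xi>0 T \<xi> \<longrightarrow> l1 n (\<lambda>j. \<xi>0 $ j) \<le> \<delta> \<longrightarrow>
    ereal (\<tau> w i) < T \<longrightarrow> l1 n (X w \<xi> i) \<le> \<epsilon>"
proof -
  obtain \<eta> where \<eta>: "0 < \<eta>" "\<And>x. W (n - 1) x \<le> \<eta> \<Longrightarrow> l1 n x \<le> \<epsilon>" using W_top_small[OF assms] by blast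
  obtain \<delta> where \<delta>: "0 < \<delta>" "\<And>x. l1 n x \<le> \<delta> \<Longrightarrow> W (n - 1) x \<le> \<eta>" using W_small_of_l1[OF \<eta>(1)] by blast
  show ?thesis
  proof (intro exI[of _ "min \<delta> \<rho>"] conjI allI impI)
    show "0 < min \<delta> \<rho>" using \<delta> \<rho> by simp
    fix d w \<xi>0 T \<xi> i
    assume tr: "traj d w \<xi>0 T \<xi>" and \<xi>0: "l1 n (\<lambda>j. \<xi>0 $ j) \<le> min \<delta> \<rho>" and T: "ereal (\<tau> w i) < T"
    have X0: "X w \<xi> 0 = (\<lambda>j. \<xi>0 $ j)" using tr by (simp add: traj_def sd_solution_def)
    have "l1 (Suc (idx (X w \<xi> 0))) (X w \<xi> 0) \<le> l1 n (X w \<xi> 0)"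
      using idx_le[of "X w \<xi> 0"] n by (intro l1_mono) simp
    then have "idx (X w \<xi> 0) = n - 1" using \<xi>0 X0 by (intro idx_top) (simp del: sample_time.simps)
    then have stay: "idx (X w \<xi> l) = n - 1" if "l < i" for l
      using idx_mono[OF tr le0 sample_before[OF less_imp_le[OF that] T]] idx_le[of "X w \<xi> l"]
      by (simp del: sample_time.simps)
    have "W (n - 1) (X w \<xi> i) \<le> W (n - 1) (X w \<xi> 0) - \<beta> (n - 1) * 0 * (\<tau> w i - \<tau> w 0)"
      using stay by (intro W_decrease[OF tr le0 T top_less]) (auto intro: diss_nonneg)
    also have "\<dots> \<le> \<eta>" using \<delta>(2)[of "X w \<xi> 0"] \<xi>0 X0 by (simp del: sample_time.simps)
    finally show "l1 n (X w \<xi> i) \<le> \<epsilon>" by (rule \<eta>(2))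
  qed
qed

text \<open>Once the top stage is active there is an alternative: either the energy has already
  fallen to \<open>\<eta>\<close>, below which it stays, or the state is bounded away from 0, the
  dissipation has a lower bound, and the energy would become negative.\<close>

lemma samples_attracted:
  assumes "0 < \<epsilon>"
  shows "\<exists>\<Theta>\<ge>0. \<forall>d w \<xi>0 T \<xi> i. traj d w \<xi>0 T \<xi> \<longrightarrow> l1 n (\<lambda>j. \<xi>0 $ j) \<le> R0 \<longrightarrow> \<Theta> \<le> \<tau> w i \<longrightarrow>
    ereal (\<tau> w i) < T \<longrightarrow> l1 n (X w \<xi> i) \<le> \<epsilon>"
proof -
  let ?s = "n - 1"
  obtain \<eta> where \<eta>: "0 < \<eta>" "\<And>x. W ?s x \<le> \<eta> \<Longrightarrow> l1 n x \<le> \<epsilon>" using W_top_small[OF assms] by blast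
  obtain \<delta> where \<delta>: "0 < \<delta>" "\<And>x. l1 n x \<le> \<delta> \<Longrightarrow> W ?s x \<le> \<eta>" using W_small_of_l1[OF \<eta>(1)] by blast
  obtain \<epsilon>' where \<epsilon>': "0 < \<epsilon>'" "\<And>x. diss ?s (c ?s) (\<omega> ?s) x \<le> \<epsilon>' \<Longrightarrow> l1 (Suc ?s) x \<le> \<delta>"
    using diss_small[OF \<omega>[OF top_less] \<delta>(1)] by blast
  obtain \<Theta> where \<Theta>: "0 \<le> \<Theta>" and top: "\<And>d w \<xi>0 T \<xi> i. traj d w \<xi>0 T \<xi> \<Longrightarrow> l1 n (\<lambda>j. \<xi>0 $ j) \<le> R0 \<Longrightarrow>
    \<Theta> \<le> \<tau> w i \<Longrightarrow> ereal (\<tau> w i) < T \<Longrightarrow> ?s \<le> idx (X w \<xi> i)"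
    using eventually_stage[OF order_refl, of R0] by (auto simp del: sample_time.simps)
  obtain M where M: "\<And>d w \<xi>0 T \<xi> i. traj d w \<xi>0 T \<xi> \<Longrightarrow> l1 n (\<lambda>j. \<xi>0 $ j) \<le> R0 \<Longrightarrow> \<tau> w i \<le> \<Theta> + r \<Longrightarrow>
    ereal (\<tau> w i) < T \<Longrightarrow> W ?s (X w \<xi> i) \<le> M"
    using sample_bound[of "\<Theta> + r" ?s R0, OF _ top_less] \<Theta> r by (meson add_nonneg_nonneg less_imp_le)
  have \<beta>\<epsilon>: "0 < \<beta> ?s * \<epsilon>'" using \<beta>[OF top_less] \<epsilon>' by simp
  show ?thesis
  proof (intro exI[of _ "\<Theta> + r + (\<bar>M\<bar> + 1) / (\<beta> ?s * \<epsilon>')"] conjI allI impI)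
    show "0 \<le> \<Theta> + r + (\<bar>M\<bar> + 1) / (\<beta> ?s * \<epsilon>')" using \<Theta> r \<beta>\<epsilon> by simp
    fix d w \<xi>0 T \<xi> i
    assume tr: "traj d w \<xi>0 T \<xi>" and R0: "l1 n (\<lambda>j. \<xi>0 $ j) \<le> R0"
      and i: "\<Theta> + r + (\<bar>M\<bar> + 1) / (\<beta> ?s * \<epsilon>') \<le> \<tau> w i" and T: "ereal (\<tau> w i) < T"
    have w: "w \<in> Linf_loc {0..}" using tr by (simp add: traj_def)
    have "0 \<le> (\<bar>M\<bar> + 1) / (\<beta> ?s * \<epsilon>')" using \<beta>\<epsilon> by simp
    then have "\<Theta> \<le> \<tau> w i" using i r by linarith
    then obtain i0 where i0: "i0 \<le> i" "\<Theta> \<le> \<tau> w i0" "\<tau> w i0 \<le> \<Theta> + r"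
      using first_sample[OF r(1) w \<Theta>] by blast
    have stay: "idx (X w \<xi> l) = ?s" if l: "i0 \<le> l" "l \<le> i" for l
    proof -
      have "\<Theta> \<le> \<tau> w l" using i0(2) sample_time_mono[OF r(1) l(1), of w] by simp
      then have "?s \<le> idx (X w \<xi> l)" by (rule top[OF tr R0 _ sample_before[OF l(2) T]])
      then show ?thesis using idx_le[of "X w \<xi> l"] by simp
    qed
    have "W ?s (X w \<xi> i) \<le> \<eta>"
    proof (cases "\<exists>l. i0 \<le> l \<and> l \<le> i \<and> W ?s (X w \<xi> l) \<le> \<eta>")
      case True
      then obtain l where l: "i0 \<le> l" "l \<le> i" "W ?s (X w \<xi> l) \<le> \<eta>" by blast
      have "W ?s (X w \<xi> i) \<le> W ?s (X w \<xi> l) - \<beta> ?s * 0 * (\<tau> w i - \<tau> w l)"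
        using stay l by (intro W_decrease[OF tr l(2) T top_less]) (auto intro: diss_nonneg)
      then show ?thesis using l by simp
    next
      case False
      have "\<epsilon>' \<le> diss ?s (c ?s) (\<omega> ?s) (X w \<xi> l)" if "i0 \<le> l" "l < i" for l
      proof -
        have "\<not> W ?s (X w \<xi> l) \<le> \<eta>" using False that by auto
        then have "\<not> l1 (Suc ?s) (X w \<xi> l) \<le> \<delta>" using \<delta>(2)[of "X w \<xi> l"] n by auto
        then show ?thesis using \<epsilon>'(2)[of "X w \<xi> l"] by linarith
      qed
      then have "W ?s (X w \<xi> i) \<le> W ?s (X w \<xi> i0) - \<beta> ?s * \<epsilon>' * (\<tau> w i - \<tau> w i0)"
        using stay \<epsilon>' by (intro W_decrease[OF tr i0(1) T top_less]) auto
      moreover have "W ?s (X w \<xi> i0) \<le> M" using i0 by (intro M[OF tr R0] sample_before[OF _ T])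
      moreover have "\<beta> ?s * \<epsilon>' * ((\<bar>M\<bar> + 1) / (\<beta> ?s * \<epsilon>')) \<le> \<beta> ?s * \<epsilon>' * (\<tau> w i - \<tau> w i0)"
        using i i0 \<beta>\<epsilon> by (intro mult_left_mono) auto
      moreover have "\<beta> ?s * \<epsilon>' * ((\<bar>M\<bar> + 1) / (\<beta> ?s * \<epsilon>')) = \<bar>M\<bar> + 1"
        using \<beta>\<epsilon> by (metis less_irrefl nonzero_mult_div_cancel_left times_divide_eq_right)
      ultimately show ?thesis using W_nonneg[OF top_less, of "X w \<xi> i"] by linarith
    qed
    then show "l1 n (X w \<xi> i) \<le> \<epsilon>" by (rule \<eta>(2))
  qed
qed

text \<open>Near 0 the feedback is at most \<open>B\<close> times the state, so the motion within
  one interval is proportional to the sampled state.\<close>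

lemma state_small_of_sample:
  assumes "0 < \<epsilon>"
  shows "\<exists>\<delta>>0. \<forall>d w \<xi>0 T \<xi> i t. traj d w \<xi>0 T \<xi> \<longrightarrow> \<tau> w i \<le> t \<longrightarrow> t \<le> \<tau> w (Suc i) \<longrightarrow> ereal t < T \<longrightarrow>
    l1 n (X w \<xi> i) \<le> \<delta> \<longrightarrow> vnorm (\<xi> t) \<le> \<epsilon>"
proof -
  define A where "A = 1 + n * (Cs (n - 1) * (1 + B))"
  have A: "1 \<le> A" using Cs_nonneg B by (simp add: A_def)
  \<comment> \<open>\<open>\<rho>\<close> is for the linear bound on \<open>k\<close>,
    \<open>1 / (1 + B)\<close> brings state and control below 1 as the intersample estimate
    requires, and \<open>\<epsilon> / A\<close> yields the conclusion.\<close>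
  define \<delta> where "\<delta> = min \<rho> (min (1 / (1 + B)) (\<epsilon> / A))"
  have \<delta>: "0 < \<delta>" using \<rho> B A assms by (simp add: \<delta>_def)
  show ?thesis
  proof (intro exI[of _ \<delta>] conjI \<delta> allI impI)
    fix d w \<xi>0 T \<xi> i t
    assume tr: "traj d w \<xi>0 T \<xi>" and t: "\<tau> w i \<le> t" "t \<le> \<tau> w (Suc i)" "ereal t < T"
      and X: "l1 n (X w \<xi> i) \<le> \<delta>"
    have sol: "sd_solution (closed_loop n g k) n r d w \<xi>0 T \<xi>" and d: "d \<in> Linf_loc D" and w: "w \<in> Linf_loc {0..}"
      using tr by (auto simp: traj_def)
    define x where "x = \<xi> (\<tau> w i)"
    define N where "N = l1 n (\<lambda>j. x $ j)"
    have N: "0 \<le> N" "N \<le> \<delta>" using X by (auto simp: N_def x_def)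
    have "ereal (\<tau> w i) < T" using t by (meson ereal_less_eq(3) le_less_trans)
    then have "x \<in> carrier_vec n" unfolding x_def by (rule sample_carrier[OF tr])
    then have k: "\<bar>k x\<bar> \<le> B * N" using B(2)[of x] N by (simp add: N_def \<delta>_def)
    then have m: "N + \<bar>k x\<bar> \<le> (1 + B) * N" by (simp add: algebra_simps)
    have "N \<le> 1 / (1 + B)" using N by (simp add: \<delta>_def)
    then have "(1 + B) * N \<le> 1" using B by (simp add: field_simps)
    then have "l1 n (\<lambda>j. \<xi> t $ j) \<le> N + n * (Cs (n - 1) * (N + \<bar>k x\<bar>))"
      using between_samples[OF sol r d w t x_def] m by (simp add: N_def)
    also have "\<dots> \<le> N + n * (Cs (n - 1) * ((1 + B) * N))"
      using m Cs_nonneg by (intro add_left_mono mult_left_mono) auto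
    also have "\<dots> = A * N" by (simp add: A_def algebra_simps)
    also have "\<dots> \<le> A * (\<epsilon> / A)" using N A by (intro mult_left_mono) (auto simp: \<delta>_def)
    also have "\<dots> = \<epsilon>" using A by simp
    finally have "l1 n (\<lambda>j. \<xi> t $ j) \<le> \<epsilon>" .
    moreover have "0 \<le> t" using t(1) sample_time_nonneg[of r w i] r by simp
    then have "\<xi> t \<in> carrier_vec n" using sol t by (simp add: sd_solution_def)
    ultimately show "vnorm (\<xi> t) \<le> \<epsilon>" using vnorm_le_l1[of "\<xi> t" n] by simp
  qed
qed

section \<open>From sampled states to robust global asymptotic stability\<close>

lemma traj_sample:
  assumes "traj d w \<xi>0 T \<xi>" "0 \<le> t" "ereal t < T"
  obtains i where "\<tau> w i \<le> t" "t \<le> \<tau> w (Suc i)" "ereal (\<tau> w i) < T" "t - r \<le> \<tau> w i"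
proof -
  have w: "w \<in> Linf_loc {0..}" and T: "T \<le> sample_horizon r w" using assms(1) by (auto simp: traj_def sd_solution_def)
  obtain i where i: "\<tau> w i \<le> t" "t < \<tau> w (Suc i)"
    using sample_interval[OF r(1) assms(2) less_le_trans[OF assms(3) T]] by blast
  moreover have "ereal (\<tau> w i) < T" using i assms(3) by (meson ereal_less_eq(3) le_less_trans)
  moreover have "t - r \<le> \<tau> w i" using sample_time_step[OF r(1) w, of i] i by (simp del: sample_time.simps)
  ultimately show ?thesis by (intro that[of i]) auto
qed

lemma attraction:
  assumes "0 < \<epsilon>" "0 \<le> R0"
  shows "\<exists>\<Theta>\<ge>0. \<forall>d w \<xi>0 T \<xi> t. traj d w \<xi>0 T \<xi> \<longrightarrow> vnorm \<xi>0 \<le> R0 \<longrightarrow> \<Theta> \<le> t \<longrightarrow>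
    ereal t < T \<longrightarrow> vnorm (\<xi> t) \<le> \<epsilon>"
proof -
  obtain \<delta> where \<delta>: "0 < \<delta>" and small: "\<And>d w \<xi>0 T \<xi> i t. traj d w \<xi>0 T \<xi> \<Longrightarrow> \<tau> w i \<le> t \<Longrightarrow>
    t \<le> \<tau> w (Suc i) \<Longrightarrow> ereal t < T \<Longrightarrow> l1 n (X w \<xi> i) \<le> \<delta> \<Longrightarrow> vnorm (\<xi> t) \<le> \<epsilon>"
    using state_small_of_sample[OF assms(1)] by (auto simp del: sample_time.simps)
  obtain \<Theta> where \<Theta>: "0 \<le> \<Theta>" and att: "\<And>d w \<xi>0 T \<xi> i. traj d w \<xi>0 T \<xi> \<Longrightarrow> l1 n (\<lambda>j. \<xi>0 $ j) \<le> n * R0 \<Longrightarrow>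
    \<Theta> \<le> \<tau> w i \<Longrightarrow> ereal (\<tau> w i) < T \<Longrightarrow> l1 n (X w \<xi> i) \<le> \<delta>"
    using samples_attracted[OF \<delta>, of "n * R0"] by (auto simp del: sample_time.simps)
  \<comment> \<open>The last sample before \<open>t\<close> may lie up to \<open>r\<close> earlier,
    hence \<open>\<Theta> + r\<close>.\<close>
  show ?thesis
  proof (intro exI[of _ "\<Theta> + r"] conjI allI impI)
    show "0 \<le> \<Theta> + r" using \<Theta> r by simp
    fix d w \<xi>0 T \<xi> t
    assume tr: "traj d w \<xi>0 T \<xi>" and R0: "vnorm \<xi>0 \<le> R0" and t: "\<Theta> + r \<le> t" "ereal t < T"
    have "l1 n (\<lambda>j. \<xi>0 $ j) \<le> n * vnorm \<xi>0" using tr by (intro l1_le_vnorm) (simp add: traj_def)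
    also have "\<dots> \<le> n * R0" using R0 by (intro mult_left_mono) auto
    finally have l: "l1 n (\<lambda>j. \<xi>0 $ j) \<le> n * R0" .
    have "0 \<le> t" using t \<Theta> r by simp
    then obtain i where i: "\<tau> w i \<le> t" "t \<le> \<tau> w (Suc i)" "ereal (\<tau> w i) < T" "t - r \<le> \<tau> w i"
      using traj_sample[OF tr _ t(2)] by blast
    have "l1 n (X w \<xi> i) \<le> \<delta>" using i t by (intro att[OF tr l]) auto
    then show "vnorm (\<xi> t) \<le> \<epsilon>" by (rule small[OF tr i(1,2) t(2)])
  qed
qed

lemma stability:
  assumes "0 < \<epsilon>"
  shows "\<exists>\<delta>>0. \<forall>d w \<xi>0 T \<xi> t. traj d w \<xi>0 T \<xi> \<longrightarrow> vnorm \<xi>0 \<le> \<delta> \<longrightarrow> 0 \<le> t \<longrightarrow>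
    ereal t < T \<longrightarrow> vnorm (\<xi> t) \<le> \<epsilon>"
proof -
  obtain \<delta> where \<delta>: "0 < \<delta>" and small: "\<And>d w \<xi>0 T \<xi> i t. traj d w \<xi>0 T \<xi> \<Longrightarrow> \<tau> w i \<le> t \<Longrightarrow>
    t \<le> \<tau> w (Suc i) \<Longrightarrow> ereal t < T \<Longrightarrow> l1 n (X w \<xi> i) \<le> \<delta> \<Longrightarrow> vnorm (\<xi> t) \<le> \<epsilon>"
    using state_small_of_sample[OF assms] by (auto simp del: sample_time.simps)
  obtain \<delta>' where \<delta>': "0 < \<delta>'" and st: "\<And>d w \<xi>0 T \<xi> i. traj d w \<xi>0 T \<xi> \<Longrightarrow> l1 n (\<lambda>j. \<xi>0 $ j) \<le> \<delta>' \<Longrightarrow>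
    ereal (\<tau> w i) < T \<Longrightarrow> l1 n (X w \<xi> i) \<le> \<delta>"
    using samples_stable[OF \<delta>] by (auto simp del: sample_time.simps)
  show ?thesis
  proof (intro exI[of _ "\<delta>' / n"] conjI allI impI)
    show "0 < \<delta>' / n" using \<delta>' n by simp
    fix d w \<xi>0 T \<xi> t
    assume tr: "traj d w \<xi>0 T \<xi>" and \<xi>0: "vnorm \<xi>0 \<le> \<delta>' / n" and t: "0 \<le> t" "ereal t < T"
    have "l1 n (\<lambda>j. \<xi>0 $ j) \<le> n * vnorm \<xi>0" using tr by (intro l1_le_vnorm) (simp add: traj_def)
    also have "\<dots> \<le> n * (\<delta>' / n)" using \<xi>0 by (intro mult_left_mono) auto
    also have "\<dots> = \<delta>'" using n by simp
    finally have l: "l1 n (\<lambda>j. \<xi>0 $ j) \<le> \<delta>'" .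
    obtain i where i: "\<tau> w i \<le> t" "t \<le> \<tau> w (Suc i)" "ereal (\<tau> w i) < T"
      using traj_sample[OF tr t] by blast
    show "vnorm (\<xi> t) \<le> \<epsilon>" by (rule small[OF tr i(1,2) t(2) st[OF tr l i(3)]])
  qed
qed

theorem RGAS_closed_loop:
  assumes ex: "\<And>\<xi>0 d w. \<xi>0 \<in> carrier_vec n \<Longrightarrow> d \<in> Linf_loc D \<Longrightarrow>
    \<exists>\<xi>. sd_solution (closed_loop n g k) n r d w \<xi>0 (sample_horizon r w) \<xi>"
  shows "RGAS (closed_loop n g k) n r D"
  unfolding RGAS_def
proof (intro conjI ballI allI impI)
  fix \<xi>0 :: rvec and d w assume "\<xi>0 \<in> carrier_vec n" "d \<in> Linf_loc D"
  then show "\<exists>\<xi>. sd_solution (closed_loop n g k) n r d w \<xi>0 (sample_horizon r w) \<xi>" by (rule ex)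
next
  fix \<epsilon> :: real assume \<epsilon>: "0 < \<epsilon>"
  \<comment> \<open>Uniform boundedness combines two facts: from \<open>\<Theta>\<close> on the
    state has norm at most 1, and before \<open>\<Theta>\<close> the finite-time bound
    applies.\<close>
  obtain \<Theta> where \<Theta>: "0 \<le> \<Theta>" and att: "\<And>d w \<xi>0 T \<xi> t. traj d w \<xi>0 T \<xi> \<Longrightarrow> vnorm \<xi>0 \<le> \<epsilon> \<Longrightarrow> \<Theta> \<le> t \<Longrightarrow>
    ereal t < T \<Longrightarrow> vnorm (\<xi> t) \<le> 1"
    using attraction[of 1 \<epsilon>] \<epsilon> by auto
  obtain M where M: "\<And>d w \<xi>0 T \<xi> t. d \<in> Linf_loc D \<Longrightarrow> \<xi>0 \<in> carrier_vec n \<Longrightarrow> l1 n (\<lambda>k. \<xi>0 $ k) \<le> n * \<epsilon> \<Longrightarrow>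
    sd_solution (closed_loop n g k) n r d w \<xi>0 T \<xi> \<Longrightarrow> 0 \<le> t \<Longrightarrow> t \<le> \<Theta> \<Longrightarrow> ereal t < T \<Longrightarrow>
    l1 n (\<lambda>k. \<xi> t $ k) \<le> M"
    using finite_time_bound[where k = k and U = U and ?R0.0 = "n * \<epsilon>", OF r(1) U \<Theta>] by blast
  show "bdd_above {vnorm (\<xi> t) | \<xi> t \<xi>0 d w T.
        0 \<le> t \<and> ereal t < T \<and> \<xi>0 \<in> carrier_vec n \<and> vnorm \<xi>0 \<le> \<epsilon> \<and>
        d \<in> Linf_loc D \<and> w \<in> Linf_loc {0..} \<and> sd_solution (closed_loop n g k) n r d w \<xi>0 T \<xi>}"
  proof (rule bdd_aboveI[of _ "max 1 M"], clarify)
    fix \<xi> t \<xi>0 d w T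
    assume *: "0 \<le> t" "ereal t < T" "\<xi>0 \<in> carrier_vec n" "vnorm \<xi>0 \<le> \<epsilon>"
      "d \<in> Linf_loc D" "w \<in> Linf_loc {0..}" "sd_solution (closed_loop n g k) n r d w \<xi>0 T \<xi>"
    show "vnorm (\<xi> t) \<le> max 1 M"
    proof (cases "\<Theta> \<le> t")
      case True
      then have "vnorm (\<xi> t) \<le> 1" using * by (intro att) (auto simp: traj_def)
      then show ?thesis by simp
    next
      case False
      have "l1 n (\<lambda>j. \<xi>0 $ j) \<le> n * vnorm \<xi>0" using * by (intro l1_le_vnorm)
      also have "\<dots> \<le> n * \<epsilon>" using * by (intro mult_left_mono) auto
      finally have "l1 n (\<lambda>k. \<xi> t $ k) \<le> M" using False * by (intro M) auto
      moreover have "\<xi> t \<in> carrier_vec n" using * by (simp add: sd_solution_def)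
      ultimately show ?thesis using vnorm_le_l1[of "\<xi> t" n] by simp
    qed
  qed
next
  fix \<epsilon> :: real assume \<epsilon>: "0 < \<epsilon>"
  show "\<exists>\<delta>>0. \<forall>\<xi>0\<in>carrier_vec n :: rvec set. vnorm \<xi>0 \<le> \<delta> \<longrightarrow>
        (\<forall>d\<in>Linf_loc D. \<forall>w\<in>Linf_loc {0..}. \<forall>T \<xi>. sd_solution (closed_loop n g k) n r d w \<xi>0 T \<xi> \<longrightarrow>
           (\<forall>t\<ge>0. ereal t < T \<longrightarrow> vnorm (\<xi> t) \<le> \<epsilon>))"
    using stability[OF \<epsilon>] unfolding traj_def by blast
next
  fix \<epsilon> R0 :: real assume \<epsilon>: "0 < \<epsilon>" "0 \<le> R0"
  show "\<exists>\<tau>\<ge>0. \<forall>\<xi>0\<in>carrier_vec n :: rvec set. vnorm \<xi>0 \<le> R0 \<longrightarrow>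
        (\<forall>d\<in>Linf_loc D. \<forall>w\<in>Linf_loc {0..}. \<forall>T \<xi>. sd_solution (closed_loop n g k) n r d w \<xi>0 T \<xi> \<longrightarrow>
           (\<forall>t\<ge>\<tau>. ereal t < T \<longrightarrow> vnorm (\<xi> t) \<le> \<epsilon>))"
    using attraction[OF \<epsilon>] unfolding traj_def by blast
qed

end

section \<open>The matrices of the feedback\<close>

definition entries :: "rmat \<Rightarrow> nat \<Rightarrow> nat \<Rightarrow> real" where
  "entries P k l = P $$ (k, l)"

lemma scalar_prod_lin:
  assumes "v \<in> carrier_vec i"
  shows "p \<bullet> v = lin i (\<lambda>k. p $ k) (\<lambda>k. v $ k)"
  using assms by (simp add: scalar_prod_def lin_def lessThan_atLeast0)

lemma quadratic_form_bil:
  assumes "P \<in> carrier_mat i i" "v \<in> carrier_vec i" "w \<in> carrier_vec i"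
  shows "v \<bullet> (P *\<^sub>v w) = bil i (entries P) (\<lambda>k. v $ k) (\<lambda>k. w $ k)"
  using assms
  by (simp add: scalar_prod_def bil_def entries_def lessThan_atLeast0 sum_distrib_left mult_ac)

definition cmat :: "nat \<Rightarrow> rvec \<Rightarrow> rmat" where
  "cmat i p = Amat i + outer i (bvec i) p"

lemma outer_carrier: "outer i u v \<in> carrier_mat i i"
  by (rule carrier_matI) (simp_all add: outer_def)

lemma outer_index:
  assumes "u \<in> carrier_vec i" "v \<in> carrier_vec i" "k < i" "l < i"
  shows "outer i u v $$ (k, l) = u $ k * v $ l"
  using assms by (simp add: outer_def scalar_prod_def mat_of_cols_def mat_of_rows_def)

lemma cmat_carrier: "cmat i p \<in> carrier_mat i i"
  by (simp add: cmat_def outer_carrier Amat_def)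

text \<open>Identifies the closed-loop matrix with \<open>shift\<close> under linear feedback, so
  that the matrix hypotheses can be read as inequalities for \<open>bil\<close>.\<close>

lemma cmat_mult:
  assumes "1 \<le> i" "p \<in> carrier_vec i" "v \<in> carrier_vec i"
  shows "cmat i p *\<^sub>v v = Matrix.vec i (shift (lin i (\<lambda>k. p $ k) (\<lambda>k. v $ k)) (\<lambda>k. v $ k))"
proof (rule eq_vecI)
  fix j assume "j < dim_vec (Matrix.vec i (shift (lin i (\<lambda>k. p $ k) (\<lambda>k. v $ k)) (\<lambda>k. v $ k)))"
  then have j: "j < i" by simp
  have b: "bvec i \<in> carrier_vec i" by (simp add: bvec_def)
  have "(cmat i p *\<^sub>v v) $ j = (\<Sum>l<i. cmat i p $$ (j, l) * v $ l)"
    using j assms cmat_carrier[of i p] by (simp add: scalar_prod_def lessThan_atLeast0)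
  also have "\<dots> = (\<Sum>l<i. (if j = Suc l then v $ l else 0) + (if j = 0 then p $ l * v $ l else 0))"
    using j assms outer_carrier[of i "bvec i" p]
    by (intro sum.cong) (auto simp: cmat_def Amat_def outer_index[OF b assms(2), unfolded bvec_def] bvec_def)
  also have "\<dots> = shift (lin i (\<lambda>k. p $ k) (\<lambda>k. v $ k)) (\<lambda>k. v $ k) j"
  proof (cases j)
    case 0
    then show ?thesis by (simp add: shift_def lin_def)
  next
    case (Suc j')
    then have "(\<Sum>l<i. (if j = Suc l then v $ l else 0) + (if j = 0 then p $ l * v $ l else 0)) =
        (\<Sum>l<i. if l = j' then v $ l else 0)"
      by (intro sum.cong) auto
    then show ?thesis using Suc j by (simp add: shift_def)
  qed
  finally show "(cmat i p *\<^sub>v v) $ j = Matrix.vec i (shift (lin i (\<lambda>k. p $ k) (\<lambda>k. v $ k)) (\<lambda>k. v $ k)) $ j"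
    using j by simp
qed (use cmat_carrier[of i p] in simp)

lemma cmat_transpose:
  assumes "p \<in> carrier_vec i"
  shows "(Amat i)\<^sup>T + outer i p (bvec i) = (cmat i p)\<^sup>T"
proof (rule eq_matI)
  have b: "bvec i \<in> carrier_vec i" by (simp add: bvec_def)
  fix k l assume "k < dim_row (cmat i p)\<^sup>T" "l < dim_col (cmat i p)\<^sup>T"
  then have "k < i" "l < i" using cmat_carrier[of i p] by auto
  then show "((Amat i)\<^sup>T + outer i p (bvec i)) $$ (k, l) = (cmat i p)\<^sup>T $$ (k, l)"
    using assms outer_carrier[of i p "bvec i"] outer_carrier[of i "bvec i" p]
    by (simp add: cmat_def Amat_def outer_index[OF assms b] outer_index[OF b assms])
qed (use cmat_carrier[of i p] outer_carrier[of i p "bvec i"] in auto)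

text \<open>Both summands of the Lyapunov matrix give the same form because \<open>P\<close> is
  symmetric; hence the factor 2.\<close>

lemma lyap_form:
  assumes i: "1 \<le> i" and P: "P\<^sup>T = P" "P \<in> carrier_mat i i" and p: "p \<in> carrier_vec i" and v: "v \<in> carrier_vec i"
  shows "v \<bullet> (lyap_mat i P p *\<^sub>v v) =
    2 * bil i (entries P) (\<lambda>k. v $ k) (shift (lin i (\<lambda>k. p $ k) (\<lambda>k. v $ k)) (\<lambda>k. v $ k))"
proof -
  let ?M = "cmat i p"
  define w where "w = ?M *\<^sub>v v"
  have w: "w \<in> carrier_vec i" unfolding w_def by (rule mult_mat_vec_carrier[OF cmat_carrier v])
  have sym: "entries P k l = entries P l k" if "k < i" "l < i" for k l
    using P that index_transpose_mat(1)[of l P k] by (simp add: entries_def)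
  have Pv: "P *\<^sub>v v \<in> carrier_vec i" using P v by simp
  have "lyap_mat i P p = P * ?M + ?M\<^sup>T * P"
    by (simp only: lyap_mat_def cmat_transpose[OF p]) (simp add: cmat_def)
  then have "lyap_mat i P p *\<^sub>v v = P *\<^sub>v w + ?M\<^sup>T *\<^sub>v (P *\<^sub>v v)"
    using P cmat_carrier[of i p] v
    by (simp add: w_def add_mult_distrib_mat_vec[where nr = i and nc = i] assoc_mult_mat_vec[where ?n\<^sub>1 = i and ?n\<^sub>2 = i and ?n\<^sub>3 = i])
  then have "v \<bullet> (lyap_mat i P p *\<^sub>v v) = v \<bullet> (P *\<^sub>v w) + v \<bullet> (?M\<^sup>T *\<^sub>v (P *\<^sub>v v))"
    using P w v Pv cmat_carrier[of i p] by (simp add: scalar_prod_add_distrib[where n = i])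
  also have "v \<bullet> (?M\<^sup>T *\<^sub>v (P *\<^sub>v v)) = (?M\<^sup>T *\<^sub>v (P *\<^sub>v v)) \<bullet> v"
    using v Pv cmat_carrier[of i p] by (intro comm_scalar_prod[of _ i]) auto
  also have "\<dots> = (P *\<^sub>v v) \<bullet> w"
    unfolding w_def by (rule transpose_vec_mult_scalar[OF cmat_carrier v Pv])
  also have "\<dots> = w \<bullet> (P *\<^sub>v v)" using w Pv by (intro comm_scalar_prod[of _ i])
  also have "v \<bullet> (P *\<^sub>v w) + w \<bullet> (P *\<^sub>v v) = 2 * bil i (entries P) (\<lambda>k. v $ k) (\<lambda>k. w $ k)"
    unfolding quadratic_form_bil[OF P(2) v w] quadratic_form_bil[OF P(2) w v]
    using bil_commute[where i = i and P = "entries P" and x = "\<lambda>k. w $ k" and y = "\<lambda>k. v $ k", OF sym] by simp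
  also have "bil i (entries P) (\<lambda>k. v $ k) (\<lambda>k. w $ k) =
      bil i (entries P) (\<lambda>k. v $ k) (shift (lin i (\<lambda>k. p $ k) (\<lambda>k. v $ k)) (\<lambda>k. v $ k))"
    by (intro bil_cong) (auto simp: w_def cmat_mult[OF i p v])
  finally show ?thesis .
qed

section \<open>From the matrix hypotheses to a stage\<close>

lemma mult_mat_vec_minus:
  fixes A :: rmat
  assumes "A \<in> carrier_mat m i" "v \<in> carrier_vec i"
  shows "A *\<^sub>v (- v) = - (A *\<^sub>v v)"
  using assms by (intro eq_vecI) (auto simp: scalar_prod_def sum_negf)

lemma vec_nonzero: "\<exists>k<i. x k \<noteq> 0 \<Longrightarrow> Matrix.vec i x \<noteq> 0\<^sub>v i"
  by (metis index_vec index_zero_vec(1))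

lemma lin_shift_vec: "lin i p (\<lambda>k. Matrix.vec i x $ k) = lin i p x"
  by (intro lin_cong) auto

lemma continuous_on_coordinate: "continuous_on UNIV (\<lambda>x :: nat \<Rightarrow> real. x k)"
  by (rule continuous_on_product_coordinates)

text \<open>Negative definiteness acts three times: made quantitative by compactness it gives the
  decay rate; it excludes a kernel of the closed-loop matrix, on which the form would vanish; and
  the inverse so obtained makes \<open>cvec\<close> satisfy the identity that cancels the
  drift.\<close>

lemma stage_of_matrices:
  assumes i: "1 \<le> i" and P: "P\<^sup>T = P" "pos_def i P" and p: "p \<in> carrier_vec i"
    and neg: "neg_def i (lyap_mat i P p)" and \<omega>: "0 < \<omega>"
  shows "cvec i p \<in> carrier_vec i"
    and "\<exists>a aP. stage i (entries P) (\<lambda>k. p $ k) (\<lambda>k. cvec i p $ k) \<omega> a aP"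
proof -
  have PC: "P \<in> carrier_mat i i" using P by (simp add: pos_def_def)
  have sym: "entries P k l = entries P l k" if "k < i" "l < i" for k l
    using P(1) PC that index_transpose_mat(1)[of l P k] by (simp add: entries_def)
  let ?p = "\<lambda>k. p $ k"
  have negf: "bil i (entries P) x (shift (lin i ?p x) x) < 0" if "\<exists>k<i. x k \<noteq> 0" for x
  proof -
    have "Matrix.vec i x \<bullet> (lyap_mat i P p *\<^sub>v Matrix.vec i x) < 0"
      using neg vec_nonzero[OF that] by (simp add: neg_def_def)
    then have "bil i (entries P) (\<lambda>k. Matrix.vec i x $ k)
        (shift (lin i ?p (\<lambda>k. Matrix.vec i x $ k)) (\<lambda>k. Matrix.vec i x $ k)) < 0"
      by (simp add: lyap_form[OF i P(1) PC p])
    also have "bil i (entries P) (\<lambda>k. Matrix.vec i x $ k)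
        (shift (lin i ?p (\<lambda>k. Matrix.vec i x $ k)) (\<lambda>k. Matrix.vec i x $ k)) =
        bil i (entries P) x (shift (lin i ?p x) x)"
      unfolding lin_shift_vec by (intro bil_cong) (auto simp: shift_def)
    finally show ?thesis .
  qed
  have posf: "0 < bil i (entries P) x x" if "\<exists>k<i. x k \<noteq> 0" for x
  proof -
    have "0 < Matrix.vec i x \<bullet> (P *\<^sub>v Matrix.vec i x)"
      using P vec_nonzero[OF that] by (simp add: pos_def_def)
    also have "\<dots> = bil i (entries P) x x"
      by (simp add: quadratic_form_bil[OF PC]) (intro bil_cong, auto)
    finally show ?thesis .
  qed
  define B where "B = (Amat i)\<^sup>T + outer i p (bvec i)"
  have B: "B = (cmat i p)\<^sup>T" by (simp add: B_def cmat_transpose[OF p])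
  have BC: "B \<in> carrier_mat i i" using cmat_carrier by (simp add: B)
  have "det (cmat i p) \<noteq> 0"
  proof
    assume "det (cmat i p) = 0"
    then obtain v where v: "v \<in> carrier_vec i" "v \<noteq> 0\<^sub>v i" "cmat i p *\<^sub>v v = 0\<^sub>v i"
      using det_0_iff_vec_prod_zero_field[OF cmat_carrier] by blast
    have "\<exists>k<i. v $ k \<noteq> 0"
    proof (rule ccontr)
      assume "\<not> ?thesis"
      then have "v = 0\<^sub>v i" using v(1) by (intro eq_vecI) auto
      with v(2) show False ..
    qed
    then have "bil i (entries P) (\<lambda>k. v $ k) (shift (lin i ?p (\<lambda>k. v $ k)) (\<lambda>k. v $ k)) < 0"
      by (rule negf)
    moreover have "shift (lin i ?p (\<lambda>k. v $ k)) (\<lambda>k. v $ k) l = 0" if "l < i" for l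
      using v(3) that unfolding cmat_mult[OF i p v(1)] by (metis index_vec index_zero_vec(1))
    then have "bil i (entries P) (\<lambda>k. v $ k) (shift (lin i ?p (\<lambda>k. v $ k)) (\<lambda>k. v $ k)) = 0"
      by (simp add: bil_def)
    ultimately show False by simp
  qed
  then have "det B \<noteq> 0" using det_transpose[OF cmat_carrier, of i p] by (simp add: B)
  then have "B \<in> Units (ring_mat TYPE(real) i ())" by (rule det_non_zero_imp_unit[OF BC])
  then obtain Bi where Bi: "mat_inverse B = Some Bi"
    using mat_inverse(1)[OF BC, of "()"] by (cases "mat_inverse B") auto
  then have BBi: "B * Bi = 1\<^sub>m i" "Bi \<in> carrier_mat i i" using mat_inverse(2)[OF BC] by auto
  define c where "c = cvec i p"
  have c: "c = - (Bi *\<^sub>v unit_vec i (i - 1))"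
    unfolding c_def cvec_def B_def[symmetric] Bi by simp
  show cC: "cvec i p \<in> carrier_vec i" using BBi(2) c by (simp add: c_def)
  then have cC: "c \<in> carrier_vec i" by (simp add: c_def)
  have uC: "unit_vec i (i - 1) \<in> carrier_vec i" by simp
  have "B *\<^sub>v (Bi *\<^sub>v unit_vec i (i - 1)) = unit_vec i (i - 1)"
    using assoc_mult_mat_vec[OF BC BBi(2) uC] BBi(1) by simp
  then have Bc: "B *\<^sub>v c = - unit_vec i (i - 1)"
    using mult_mat_vec_minus[OF BC mult_mat_vec_carrier[OF BBi(2) uC]] by (simp add: c)
  have cM: "x (i - 1) + lin i (\<lambda>k. c $ k) (shift (lin i ?p x) x) = 0" for x
  proof -
    define v where "v = Matrix.vec i x"
    have v: "v \<in> carrier_vec i" by (simp add: v_def)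
    have "(B *\<^sub>v c) \<bullet> v = c \<bullet> (cmat i p *\<^sub>v v)"
      unfolding B by (rule transpose_vec_mult_scalar[OF cmat_carrier v cC])
    also have "\<dots> = lin i (\<lambda>k. c $ k) (shift (lin i ?p x) x)"
      unfolding cmat_mult[OF i p v] scalar_prod_lin[OF vec_carrier] lin_shift_vec
      by (intro lin_cong) (auto simp: v_def lin_shift_vec shift_def)
    also have "(B *\<^sub>v c) \<bullet> v = - x (i - 1)"
      using i v by (simp add: Bc v_def)
    finally show ?thesis by simp
  qed
  \<comment> \<open>Tested on the last basis vector: \<open>shift\<close> moves its entry out of the
    range below \<open>i\<close>, so only the product with \<open>c $ 0\<close> could balance the 1
    in \<open>cM\<close>.\<close>
  have c0: "c $ 0 \<noteq> 0"
  proof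
    assume 0: "c $ 0 = 0"
    define x where "x k = (if k = i - 1 then 1 else 0 :: real)" for k
    have "c $ k * shift (lin i ?p x) x k = 0" if "k < i" for k
      using 0 that by (auto simp: shift_def x_def)
    then have "lin i (\<lambda>k. c $ k) (shift (lin i ?p x) x) = 0"
      unfolding lin_def[of i "\<lambda>k. c $ k"] by (intro sum.neutral) simp
    then show False using cM[of x] by (simp add: x_def)
  qed
  have cont: "continuous_on UNIV (\<lambda>x. bil i (entries P) x (f x))"
    if "\<And>l. continuous_on UNIV (\<lambda>x. f x l)" for f
    unfolding bil_def by (intro continuous_intros continuous_on_coordinate that)
  obtain aP where aP: "0 < aP" "\<And>x. aP * (l1 i x)\<^sup>2 \<le> bil i (entries P) x x"
  proof -
    have "\<exists>a>0. \<forall>x. a * (l1 i x)\<^sup>2 \<le> bil i (entries P) x x"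
    proof (rule homogeneous_lower_bound)
      show "continuous_on UNIV (\<lambda>x. bil i (entries P) x x)"
        by (intro cont continuous_on_coordinate)
      show "bil i (entries P) (\<lambda>k. t * x k) (\<lambda>k. t * x k) = t\<^sup>2 * bil i (entries P) x x" for t x
        by (simp add: bil_scale_left bil_scale_right power2_eq_square)
      show "bil i (entries P) x x = bil i (entries P) y y" if "\<And>k. k < i \<Longrightarrow> x k = y k" for x y
        using that by (intro bil_cong)
    qed (rule posf)
    then show ?thesis using that by blast
  qed
  obtain a where a: "0 < a" "\<And>x. a * (l1 i x)\<^sup>2 \<le> - bil i (entries P) x (shift (lin i ?p x) x)"
  proof -
    have "\<exists>a>0. \<forall>x. a * (l1 i x)\<^sup>2 \<le> - bil i (entries P) x (shift (lin i ?p x) x)"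
    proof (rule homogeneous_lower_bound)
      have "continuous_on UNIV (\<lambda>x. shift (lin i ?p x) x l)" for l
        by (cases "l = 0") (auto simp: shift_def lin_def intro!: continuous_intros continuous_on_coordinate)
      then show "continuous_on UNIV (\<lambda>x. - bil i (entries P) x (shift (lin i ?p x) x))"
        by (intro continuous_on_minus cont)
      have "shift (lin i ?p (\<lambda>k. t * x k)) (\<lambda>k. t * x k) = (\<lambda>k. t * shift (lin i ?p x) x k)" for t x
        by (simp add: fun_eq_iff shift_def lin_scale)
      then show "- bil i (entries P) (\<lambda>k. t * x k) (shift (lin i ?p (\<lambda>k. t * x k)) (\<lambda>k. t * x k)) =
          t\<^sup>2 * - bil i (entries P) x (shift (lin i ?p x) x)" for t x
        by (simp add: bil_scale_left bil_scale_right power2_eq_square)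
      show "- bil i (entries P) x (shift (lin i ?p x) x) = - bil i (entries P) y (shift (lin i ?p y) y)"
        if "\<And>k. k < i \<Longrightarrow> x k = y k" for x y
      proof -
        have "lin i ?p x = lin i ?p y" using that by (rule lin_cong)
        then have "bil i (entries P) x (shift (lin i ?p x) x) = bil i (entries P) y (shift (lin i ?p y) y)"
          using that by (intro bil_cong) (auto simp: shift_def)
        then show ?thesis by simp
      qed
      show "0 < - bil i (entries P) x (shift (lin i ?p x) x)" if "\<exists>k<i. x k \<noteq> 0" for x
        using negf[OF that] by simp
    qed
    then show ?thesis using that by blast
  qed
  \<comment> \<open>\<open>negP\<close> carries a factor 2, hence \<open>a / 2\<close>.\<close>
  have "stage i (entries P) ?p (\<lambda>k. c $ k) \<omega> (a / 2) aP"
  proof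
    show "bil i (entries P) x (shift (lin i ?p x) x) \<le> - 2 * (a / 2) * (l1 i x)\<^sup>2" for x
      using a(2)[of x] by simp
  qed (use i sym \<omega> a(1) aP cM c0 in auto)
  then show "\<exists>a aP. stage i (entries P) ?p (\<lambda>k. cvec i p $ k) \<omega> a aP" unfolding c_def by blast
qed

lemma matrices_of_forms:
  assumes i: "1 \<le> i" and sym: "\<And>k l. P k l = P l k"
    and pos: "\<And>x. \<exists>k<i. x k \<noteq> 0 \<Longrightarrow> 0 < bil i P x x"
    and neg: "\<And>x. \<exists>k<i. x k \<noteq> 0 \<Longrightarrow> bil i P x (shift (lin i p x) x) < 0"
  shows "\<exists>P p. P\<^sup>T = P \<and> pos_def i P \<and> p \<in> carrier_vec i \<and> neg_def i (lyap_mat i P p)"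
proof -
  define P' where "P' = Matrix.mat i i (\<lambda>(k, l). P k l)"
  define p' where "p' = Matrix.vec i p"
  have PC: "P' \<in> carrier_mat i i" and pC: "p' \<in> carrier_vec i" by (auto simp: P'_def p'_def)
  have tr: "P'\<^sup>T = P'" unfolding P'_def by (rule eq_matI) (auto simp: sym)
  have bil: "bil i (entries P') x y = bil i P x y" for x y
    unfolding bil_def by (intro sum.cong) (auto simp: P'_def entries_def)
  have lin: "lin i (\<lambda>k. p' $ k) x = lin i p x" for x
    unfolding lin_def by (intro sum.cong) (auto simp: p'_def)
  have nz: "\<exists>k<i. v $ k \<noteq> 0" if "v \<in> carrier_vec i" "v \<noteq> 0\<^sub>v i" for v :: rvec
  proof (rule ccontr)
    assume "\<not> ?thesis"
    then have "v = 0\<^sub>v i" using that(1) by (intro eq_vecI) auto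
    with that(2) show False ..
  qed
  have lC: "lyap_mat i P' p' \<in> carrier_mat i i"
    unfolding lyap_mat_def
    by (rule add_carrier_mat, rule mult_carrier_mat[of _ i i], rule add_carrier_mat, rule outer_carrier, rule PC)
  show ?thesis
  proof (intro exI[of _ P'] exI[of _ p'] conjI tr pC)
    show "pos_def i P'"
      unfolding pos_def_def using PC nz pos by (auto simp: quadratic_form_bil[OF PC] bil)
    show "neg_def i (lyap_mat i P' p')"
      unfolding neg_def_def using lC nz neg by (auto simp: lyap_form[OF i tr PC pC] bil lin)
  qed
qed

text \<open>
  Backstepping: the next control is \<open>u = p\<cdot>x - c 0 * y\<close> with \<open>y = x\<^sub>i + c\<cdot>x\<close>, and the next
  Lyapunov function is \<open>V + \<mu> y\<^sup>2\<close>.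
\<close>

lemma matrices_exist:
  assumes "1 \<le> i"
  shows "\<exists>P p. P\<^sup>T = P \<and> pos_def i P \<and> p \<in> carrier_vec i \<and> neg_def i (lyap_mat i P p)"
  using assms
proof (induction i rule: dec_induct)
  case base
  \<comment> \<open>In dimension 1 the entries 1 for \<open>P\<close> and -1 for \<open>p\<close>
    give the Lyapunov value -2.\<close>
  show ?case
    by (rule matrices_of_forms[where P = "\<lambda>k l. 1" and p = "\<lambda>k. -1"])
      (auto simp: bil_def lin_def shift_def zero_less_mult_iff mult_less_0_iff)
next
  case (step i)
  then obtain P0 p0 where "P0\<^sup>T = P0" "pos_def i P0" "p0 \<in> carrier_vec i" "neg_def i (lyap_mat i P0 p0)"
    by blast
  then obtain P p c a aP where "stage i P p c 1 a aP"
    using stage_of_matrices(2)[OF step.hyps(1), of P0 p0 1] by auto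
  then interpret stage i P p c 1 a aP .
  \<comment> \<open>\<open>bP\<^sup>2 / (4 * a)\<close> pays, by Young's inequality, for the
    coupling of \<open>V\<close> with the correction \<open>- c 0 * y\<close>, and the
    \<open>1\<close> leaves \<open>- (c 0 * y)\<^sup>2\<close>.\<close>
  define \<mu> where "\<mu> = bP\<^sup>2 / (4 * a) + 1"
  have \<mu>: "0 < \<mu>" unfolding \<mu>_def using a by (intro add_nonneg_pos) auto
  define c' where "c' k = (if k < i then c k else 1)" for k
  \<comment> \<open>The symmetrized entries agree with \<open>P\<close> below \<open>i\<close> and
    make \<open>P'\<close> symmetric for all indices, as \<open>matrices_of_forms\<close> requires.
    \<open>c'\<close> is \<open>c\<close> extended by 1, so that \<open>y x\<close> is its pairing
    with \<open>x\<close>.\<close>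
  define P' where "P' k l = (if k < i \<and> l < i then (P k l + P l k) / 2 else 0) + \<mu> * (c' k * c' l)" for k l
  define p' where "p' k = (if k < i then p k - c 0 * c k else - c 0)" for k
  have lin': "lin (Suc i) p' x = lin i p x - c 0 * y x" for x
  proof -
    have "lin i p' x = (\<Sum>k<i. p k * x k - c 0 * (c k * x k))"
      unfolding lin_def by (intro sum.cong) (auto simp: p'_def algebra_simps)
    then show ?thesis
      by (simp add: lin_def y_def p'_def sum_subtractf sum_distrib_left algebra_simps)
  qed
  have bil': "bil (Suc i) P' x z = bil i P x z + \<mu> * y x * y z" for x z
  proof -
    have yc: "y x = (\<Sum>k<Suc i. c' k * x k)" for x
      by (simp add: y_def lin_def c'_def)
    have "bil (Suc i) P' x z = (\<Sum>k<Suc i. \<Sum>l<Suc i. (if k < i \<and> l < i then P k l else 0) * x k * z l)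
        + (\<Sum>k<Suc i. \<Sum>l<Suc i. \<mu> * ((c' k * x k) * (c' l * z l)))"
      unfolding bil_def sum.distrib[symmetric]
      by (intro sum.cong) (auto simp: P'_def sym algebra_simps)
    also have "(\<Sum>k<Suc i. \<Sum>l<Suc i. (if k < i \<and> l < i then P k l else 0) * x k * z l) = bil i P x z"
      by (simp add: bil_def)
    also have "(\<Sum>k<Suc i. \<Sum>l<Suc i. \<mu> * ((c' k * x k) * (c' l * z l))) = \<mu> * (y x * y z)"
      unfolding yc sum_product by (simp only: sum_distrib_left)
    finally show ?thesis by simp
  qed
  show ?case
  proof (rule matrices_of_forms[where P = P' and p = p'])
    show "P' k l = P' l k" for k l by (simp add: P'_def algebra_simps)
    fix x :: "nat \<Rightarrow> real" assume x: "\<exists>k<Suc i. x k \<noteq> 0"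
    define N where "N = l1 i x"
    have nz: "N \<noteq> 0 \<or> y x \<noteq> 0"
    proof (rule ccontr)
      assume *: "\<not> ?thesis"
      then have z: "x k = 0" if "k < i" for k using abs_le_l1[OF that, of x] by (simp add: N_def)
      then have "lin i c x = 0" by (simp add: lin_def)
      then have "x i = 0" using * by (simp add: y_def)
      with x z show False by (metis less_Suc_eq)
    qed
    have "0 < aP * N\<^sup>2 + \<mu> * (y x)\<^sup>2"
      using nz aP \<mu> by (metis add_nonneg_pos add_pos_nonneg mult_nonneg_nonneg mult_pos_pos less_imp_le zero_le_power2 zero_less_power2)
    then show "0 < bil (Suc i) P' x x"
      using posP[of x] by (simp add: bil' N_def power2_eq_square algebra_simps)
    define z where "z = shift (lin (Suc i) p' x) x"
    define Mz where "Mz = shift (lin i p x) x"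
    define b where "b k = (if k = 0 then 1 else 0 :: real)" for k :: nat
    have z: "z k = Mz k + (- c 0 * y x) * b k" for k
      by (simp add: z_def Mz_def shift_def b_def lin')
    have lb: "l1 i b \<le> 1" using i by (simp add: l1_def b_def if_distrib cong: if_cong)
    have "lin i c b = c 0" using i by (simp add: lin_def b_def if_distrib cong: if_cong)
    moreover have "lin i c z = lin i c Mz + (- c 0 * y x) * lin i c b"
      unfolding z[abs_def] lin_add lin_scale ..
    moreover have "z i = x (i - 1)" using i by (simp add: z_def shift_def)
    \<comment> \<open>Along the new linear closed loop the drift cancels by \<open>cM\<close>, so
      \<open>y\<close> obeys a stable scalar equation of its own.\<close>
    ultimately have yz: "y z = - (c 0)\<^sup>2 * y x"
      using cM[of x] unfolding y_def[of z] by (simp add: Mz_def power2_eq_square)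
    have "\<bar>bil i P x b\<bar> \<le> bP * N * 1"
    proof -
      have "\<bar>bil i P x b\<bar> \<le> bP * N * l1 i b" unfolding bP_def N_def by (rule bil_bound)
      also have "\<dots> \<le> bP * N * 1" using bP_nonneg lb by (intro mult_left_mono) (auto simp: N_def)
      finally show ?thesis .
    qed
    then have "\<bar>- c 0 * y x * bil i P x b\<bar> \<le> \<bar>c 0 * y x\<bar> * (bP * N)"
      unfolding abs_mult by (auto intro: mult_left_mono)
    moreover have "\<bar>c 0 * y x\<bar> * (bP * N) \<le> a * N\<^sup>2 + bP\<^sup>2 / (4 * a) * (c 0 * y x)\<^sup>2"
    proof -
      have "0 \<le> (2 * a * N - bP * \<bar>c 0 * y x\<bar>)\<^sup>2 / (4 * a)" using a by simp
      also have "\<dots> = a * N\<^sup>2 + bP\<^sup>2 / (4 * a) * \<bar>c 0 * y x\<bar>\<^sup>2 - \<bar>c 0 * y x\<bar> * (bP * N)"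
        using a by (simp add: power2_eq_square field_simps)
      finally show ?thesis by simp
    qed
    moreover have "bil i P x z = bil i P x Mz + (- c 0 * y x) * bil i P x b"
      unfolding z[abs_def] bil_add_right bil_scale_right ..
    moreover have "bil i P x Mz \<le> - 2 * a * N\<^sup>2" unfolding Mz_def N_def by (rule negP)
    ultimately have "bil i P x z \<le> - a * N\<^sup>2 + bP\<^sup>2 / (4 * a) * (c 0 * y x)\<^sup>2" by linarith
    moreover have "\<mu> * y x * y z = - bP\<^sup>2 / (4 * a) * (c 0 * y x)\<^sup>2 - (c 0 * y x)\<^sup>2"
      by (simp add: \<mu>_def yz power2_eq_square algebra_simps)
    ultimately have "bil (Suc i) P' x z \<le> - (a * N\<^sup>2 + (c 0 * y x)\<^sup>2)" by (simp add: bil')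
    also have "\<dots> < 0"
    proof (cases "N = 0")
      case True
      then have "0 < (c 0 * y x)\<^sup>2" using nz c0 by simp
      then show ?thesis using True by simp
    next
      case False
      then have "0 < a * N\<^sup>2" using a by simp
      then show ?thesis by (smt (verit) zero_le_power2)
    qed
    finally show "bil (Suc i) P' x (shift (lin (Suc i) p' x) x) < 0" by (simp add: z_def)
  qed simp
qed

section \<open>The feedback as a function of the active stage\<close>

text \<open>The inserted 0 is the value when no region contains \<open>x\<close>, so that the
  fallback feedback in the first coordinate becomes stage 0.\<close>

definition active :: "nat \<Rightarrow> (nat \<Rightarrow> rmat) \<Rightarrow> (nat \<Rightarrow> real) \<Rightarrow> (nat \<Rightarrow> real) \<Rightarrow> nat" where
  "active n P R x = Max (insert 0 {i \<in> {1..n - 1}. bil i (entries (P i)) x x < (R i)\<^sup>2})"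

lemma active_le: "active n P R x \<le> n - 1"
  unfolding active_def by (subst Max_le_iff) auto

lemma active_ge: "1 \<le> i \<Longrightarrow> i \<le> n - 1 \<Longrightarrow> bil i (entries (P i)) x x < (R i)\<^sup>2 \<Longrightarrow> i \<le> active n P R x"
  unfolding active_def by (intro Max_ge) auto

lemma active_mem:
  assumes "active n P R x \<noteq> 0"
  shows "bil (active n P R x) (entries (P (active n P R x))) x x < (R (active n P R x))\<^sup>2"
proof -
  have "active n P R x \<in> insert 0 {i \<in> {1..n - 1}. bil i (entries (P i)) x x < (R i)\<^sup>2}"
    unfolding active_def by (rule Max_in) auto
  with assms show ?thesis by auto
qed

lemma Qmat_mult:
  assumes "i \<le> n" "x \<in> carrier_vec n"
  shows "Qmat n i *\<^sub>v x = Matrix.vec i (\<lambda>k. x $ k)"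
proof (rule eq_vecI)
  fix k assume "k < dim_vec (Matrix.vec i (\<lambda>k. x $ k))"
  then have k: "k < i" by simp
  have "(Qmat n i *\<^sub>v x) $ k = (\<Sum>j = 0..<n. (if k = j then 1 else 0) * x $ j)"
    using k assms by (simp add: Qmat_def scalar_prod_def)
  also have "\<dots> = (\<Sum>j = 0..<n. if k = j then x $ j else 0)" by (rule sum.cong) auto
  finally show "(Qmat n i *\<^sub>v x) $ k = Matrix.vec i (\<lambda>k. x $ k) $ k" using k assms by simp
qed (simp add: Qmat_def)

lemma Qmat_form:
  assumes i: "i \<le> n" and x: "x \<in> carrier_vec n" and P: "P \<in> carrier_mat i i"
  shows "x \<bullet> (((Qmat n i)\<^sup>T * P * Qmat n i) *\<^sub>v x) = bil i (entries P) (\<lambda>k. x $ k) (\<lambda>k. x $ k)"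
proof -
  let ?Q = "Qmat n i"
  have Q: "?Q \<in> carrier_mat i n" by (simp add: Qmat_def)
  have Qx: "?Q *\<^sub>v x \<in> carrier_vec i" using Q x by simp
  have PQx: "P *\<^sub>v (?Q *\<^sub>v x) \<in> carrier_vec i" using P Qx by simp
  have QT: "?Q\<^sup>T \<in> carrier_mat n i" using Q by simp
  have QTP: "?Q\<^sup>T * P \<in> carrier_mat n i" using QT P by simp
  have "(?Q\<^sup>T * P * ?Q) *\<^sub>v x = ?Q\<^sup>T *\<^sub>v (P *\<^sub>v (?Q *\<^sub>v x))"
    by (simp add: assoc_mult_mat_vec[OF QTP Q x] assoc_mult_mat_vec[OF QT P Qx])
  then have "x \<bullet> ((?Q\<^sup>T * P * ?Q) *\<^sub>v x) = (?Q\<^sup>T *\<^sub>v (P *\<^sub>v (?Q *\<^sub>v x))) \<bullet> x"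
    using QT PQx x by (simp add: comm_scalar_prod[of _ n])
  also have "\<dots> = (P *\<^sub>v (?Q *\<^sub>v x)) \<bullet> (?Q *\<^sub>v x)"
    by (rule transpose_vec_mult_scalar[OF Q x PQx])
  also have "\<dots> = (?Q *\<^sub>v x) \<bullet> (P *\<^sub>v (?Q *\<^sub>v x))"
    using Qx PQx by (intro comm_scalar_prod[of _ i])
  also have "\<dots> = bil i (entries P) (\<lambda>k. (?Q *\<^sub>v x) $ k) (\<lambda>k. (?Q *\<^sub>v x) $ k)"
    by (rule quadratic_form_bil[OF P Qx Qx])
  also have "\<dots> = bil i (entries P) (\<lambda>k. x $ k) (\<lambda>k. x $ k)"
    unfolding Qmat_mult[OF i x] by (intro bil_cong) auto
  finally show ?thesis .
qed

text \<open>The branch of \<open>feedback\<close> with nonnegative minimum is exactly the case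
  \<open>s = 0\<close>. Since components are numbered from 0, \<open>x $ s\<close> is the coordinate
  that follows the \<open>s\<close> coordinates of the stage.\<close>

lemma feedback_eq:
  assumes n: "2 \<le> n" and x: "x \<in> carrier_vec n"
    and P: "\<And>i. 1 \<le> i \<Longrightarrow> i \<le> n - 1 \<Longrightarrow> P i \<in> carrier_mat i i"
    and p: "\<And>i. 1 \<le> i \<Longrightarrow> i \<le> n - 1 \<Longrightarrow> p i \<in> carrier_vec i"
    and c: "\<And>i. 1 \<le> i \<Longrightarrow> i \<le> n - 1 \<Longrightarrow> cvec i (p i) \<in> carrier_vec i"
    and s_def: "s = active n P R (\<lambda>k. x $ k)"
  shows "feedback n K0 K R \<omega> P p x =
    (if s = 0 then - K0 * sat (\<omega> 0 * x $ 0)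
     else lin s (\<lambda>k. p s $ k) (\<lambda>k. x $ k) -
       K s * cvec s (p s) $ 0 * sat (\<omega> s * (x $ s + lin s (\<lambda>k. cvec s (p s) $ k) (\<lambda>k. x $ k))))"
proof -
  define q where "q i = x \<bullet> (((Qmat n i)\<^sup>T * P i * Qmat n i) *\<^sub>v x)" for i
  have q: "q i = bil i (entries (P i)) (\<lambda>k. x $ k) (\<lambda>k. x $ k)" if "i \<in> {1..n - 1}" for i
    unfolding q_def using that by (intro Qmat_form x P) auto
  define A where "A = {i \<in> {1..n - 1}. q i < (R i)\<^sup>2}"
  have A: "A = {i \<in> {1..n - 1}. bil i (entries (P i)) (\<lambda>k. x $ k) (\<lambda>k. x $ k) < (R i)\<^sup>2}"
    unfolding A_def using q by auto
  have fin: "finite A" by (simp add: A_def)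
  have min: "Min ((\<lambda>l. q l - (R l)\<^sup>2) ` {1..n - 1}) \<ge> 0 \<longleftrightarrow> A = {}"
    using n by (subst Min_ge_iff) (auto simp: A_def not_less)
  have fb: "feedback n K0 K R \<omega> P p x = (if A = {} then - K0 * sat (\<omega> 0 * x $ 0)
      else let i = Max A; c = cvec i (p i); Q = Qmat n i in
           p i \<bullet> (Q *\<^sub>v x) - K i * (c \<bullet> bvec i) * sat (\<omega> i * (x $ i + c \<bullet> (Q *\<^sub>v x))))"
    unfolding feedback_def Let_def q_def[symmetric] min A_def by simp
  show ?thesis
  proof (cases "A = {}")
    case True
    then have "s = 0" unfolding s_def active_def A[symmetric] by simp
    then show ?thesis using True fb by simp
  next
    case False
    have "s = max 0 (Max A)" unfolding s_def active_def A[symmetric] by (rule Max_insert[OF fin False])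
    then have sA: "s = Max A" by simp
    have "Max A \<in> A" using fin False by simp
    then have s: "1 \<le> s" "s \<le> n - 1" unfolding sA A_def by auto
    have sn: "s \<le> n" using s by simp
    have dot: "v \<bullet> (Qmat n s *\<^sub>v x) = lin s (\<lambda>k. v $ k) (\<lambda>k. x $ k)" for v
      unfolding Qmat_mult[OF sn x] scalar_prod_lin[OF vec_carrier] by (rule lin_shift_vec)
    have "cvec s (p s) \<bullet> bvec s = cvec s (p s) $ 0"
      using c[OF s] s by (simp add: bvec_def)
    then show ?thesis using False s fb unfolding Let_def sA[symmetric] dot by simp
  qed
qed

section \<open>Choice of the parameters\<close>

text \<open>Bounds the energy \<open>\<bar>x 0\<bar>\<close> of stage 0 below by its dissipation.
  The minimum with \<open>K0\<close> is there because the same constant must not exceed the decay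
  rate in \<open>first_coordinate_step\<close>.\<close>

lemma sat_sq_le_abs:
  assumes "0 < \<omega>"
  shows "min K0 (1 / \<omega>) * (sat (\<omega> * y))\<^sup>2 \<le> \<bar>y\<bar>"
proof -
  define S where "S = \<bar>sat (\<omega> * y)\<bar>"
  have S: "0 \<le> S" "S \<le> 1" "S \<le> \<omega> * \<bar>y\<bar>"
    using abs_sat_le_1[of "\<omega> * y"] abs_sat_le[of "\<omega> * y"] assms by (auto simp: S_def abs_mult)
  have "S * S \<le> S" by (rule mult_left_le[OF S(2,1)])
  then have S2: "S * S \<le> \<omega> * \<bar>y\<bar>" using S by linarith
  have "(sat (\<omega> * y))\<^sup>2 = S * S" by (simp add: S_def power2_eq_square)
  then have "min K0 (1 / \<omega>) * (sat (\<omega> * y))\<^sup>2 \<le> 1 / \<omega> * (S * S)"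
    by (simp only:) (intro mult_right_mono, use S in auto)
  also have "\<dots> \<le> 1 / \<omega> * (\<omega> * \<bar>y\<bar>)" using S2 assms by (intro mult_left_mono) auto
  finally show ?thesis using assms by simp
qed

context chain_system
begin

text \<open>Each stage is tuned by \<open>stage_parameters\<close> with its own \<open>Cs i\<close>,
  and only \<open>r\<close> has to be common. \<open>U\<close>, \<open>\<rho>\<close> and
  \<open>B\<close> are exported because boundedness, the value at 0 and continuity at 0 of the
  feedback follow from them.\<close>

lemma feedback_stabilizes:
  assumes K0: "0 < K0" and \<omega>: "\<And>i. i \<le> n - 1 \<Longrightarrow> 0 < \<omega> i"
    and P: "\<And>i. 1 \<le> i \<Longrightarrow> i \<le> n - 1 \<Longrightarrow> (P i)\<^sup>T = P i \<and> pos_def i (P i) \<and> p i \<in> carrier_vec i \<and>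
      neg_def i (lyap_mat i (P i) (p i))"
  shows "\<exists>r K R U \<rho> B. 0 < r \<and> (\<forall>i\<in>{1..n - 1}. 0 < K i \<and> 0 < R i) \<and>
    RGAS (closed_loop n g (feedback n K0 K R \<omega> P p)) n r D \<and> 0 < \<rho> \<and> 0 \<le> B \<and>
    (\<forall>x\<in>carrier_vec n. \<bar>feedback n K0 K R \<omega> P p x\<bar> \<le> U) \<and>
    (\<forall>x\<in>carrier_vec n. l1 n (\<lambda>j. x $ j) \<le> \<rho> \<longrightarrow>
      \<bar>feedback n K0 K R \<omega> P p x\<bar> \<le> B * l1 n (\<lambda>j. x $ j))"
proof -
  define c where "c i k = cvec i (p i) $ k" for i k
  define pf where "pf i k = p i $ k" for i k
  define V where "V i x = bil i (entries (P i)) x x" for i x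
  have cC: "cvec i (p i) \<in> carrier_vec i" if "1 \<le> i" "i \<le> n - 1" for i
    using stage_of_matrices(1)[of i "P i" "p i" "\<omega> i"] P[OF that] \<omega>[OF that(2)] that by blast
  have "\<forall>i\<in>{1..n - 1}. \<exists>a aP. stage i (entries (P i)) (pf i) (c i) (\<omega> i) a aP"
    unfolding c_def pf_def using stage_of_matrices(2) P \<omega> by auto
  then obtain a aP where st: "\<forall>i\<in>{1..n - 1}. stage i (entries (P i)) (pf i) (c i) (\<omega> i) (a i) (aP i)"
    by metis
  define Q where "Q i K R r \<beta> Cw W \<longleftrightarrow> 0 < K \<and> 0 < R \<and> 0 < r \<and> 0 < \<beta> \<and>
    (\<forall>x. \<beta> * diss i (c i) (\<omega> i) x \<le> W x \<and> W x \<le> Cw * ((l1 (Suc i) x)\<^sup>2 + l1 (Suc i) x)) \<and>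
    (\<forall>h u x x'. 0 < h \<longrightarrow> h \<le> r \<longrightarrow> V i x < R\<^sup>2 \<longrightarrow>
       u = lin i (pf i) x - K * c i 0 * sat (\<omega> i * (x i + lin i (c i) x)) \<longrightarrow> close_step (Cs i) i h u x x' \<longrightarrow>
       V i x' < R\<^sup>2 \<and> W x' \<le> W x - h * (\<beta> * diss i (c i) (\<omega> i) x))"
    for i and K R r \<beta> Cw :: real and W
  have "\<forall>i\<in>{1..n - 1}. \<exists>K R r \<beta> Cw W. Q i K R r \<beta> Cw W"
  proof
    fix i assume i: "i \<in> {1..n - 1}"
    have "stage i (entries (P i)) (pf i) (c i) (\<omega> i) (a i) (aP i)" using st i by blast
    from stage.stage_parameters[OF this Cs_nonneg[of i]]
    show "\<exists>K R r \<beta> Cw W. Q i K R r \<beta> Cw W" unfolding Q_def V_def by blast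
  qed
  then obtain K R ri \<beta> Cw W where Q: "\<forall>i\<in>{1..n - 1}. Q i (K i) (R i) (ri i) (\<beta> i) (Cw i) (W i)"
    by metis
  have Qi: "0 < K i" "0 < R i" "0 < ri i" "0 < \<beta> i"
    "\<beta> i * diss i (c i) (\<omega> i) x \<le> W i x" "W i x \<le> Cw i * ((l1 (Suc i) x)\<^sup>2 + l1 (Suc i) x)"
    if "1 \<le> i" "i \<le> n - 1" for i x
    using Q[THEN bspec, of i] that unfolding Q_def by auto
  have Qstep: "V i x' < (R i)\<^sup>2 \<and> W i x' \<le> W i x - h * (\<beta> i * diss i (c i) (\<omega> i) x)"
    if "1 \<le> i" "i \<le> n - 1" "0 < h" "h \<le> ri i" "V i x < (R i)\<^sup>2"
      "u = lin i (pf i) x - K i * c i 0 * sat (\<omega> i * (x i + lin i (c i) x))" "close_step (Cs i) i h u x x'"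
    for i h u x x'
    using Q[THEN bspec, of i] that unfolding Q_def by auto
  define k where "k = feedback n K0 K R \<omega> P p"
  define s where "s = active n P R"
  have k: "k x = (if s (\<lambda>j. x $ j) = 0 then - K0 * sat (\<omega> 0 * x $ 0)
     else lin (s (\<lambda>j. x $ j)) (pf (s (\<lambda>j. x $ j))) (\<lambda>j. x $ j) -
       K (s (\<lambda>j. x $ j)) * c (s (\<lambda>j. x $ j)) 0 *
       sat (\<omega> (s (\<lambda>j. x $ j)) * (x $ s (\<lambda>j. x $ j) + lin (s (\<lambda>j. x $ j)) (c (s (\<lambda>j. x $ j))) (\<lambda>j. x $ j))))"
    if "x \<in> carrier_vec n" for x
    unfolding k_def s_def c_def pf_def
    by (rule feedback_eq[OF n that _ _ cC refl]) (use P in \<open>auto simp: pos_def_def\<close>)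
  have s_le: "s x \<le> n - 1" for x unfolding s_def by (rule active_le)
  have s_V: "V (s x) x < (R (s x))\<^sup>2" if "s x \<noteq> 0" for x
    using active_mem[of n P R x] that by (simp add: s_def V_def)
  have s_ge: "i \<le> s x" if "1 \<le> i" "i \<le> n - 1" "V i x < (R i)\<^sup>2" for i x
    unfolding s_def by (rule active_ge) (use that in \<open>auto simp: V_def\<close>)
  \<comment> \<open>1 is the interval length allowed in the chain estimates,
    \<open>1 / (K0 * \<omega> 0)\<close> excludes overshoot in stage 0, and \<open>ri i\<close> are
    the bounds of the other stages.\<close>
  define r where "r = Min (insert 1 (insert (1 / (K0 * \<omega> 0)) (ri ` {1..n - 1})))"
  have r: "0 < r" "r \<le> 1" "r \<le> 1 / (K0 * \<omega> 0)"
  proof -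
    show "0 < r" using Qi(3) K0 \<omega>[of 0] by (simp add: r_def)
    show "r \<le> 1" "r \<le> 1 / (K0 * \<omega> 0)" unfolding r_def by (rule Min_le; simp)+
  qed
  have r_le: "r \<le> ri i" if "1 \<le> i" "i \<le> n - 1" for i
    unfolding r_def by (rule Min_le) (use that in auto)
  define b where "b i = (\<Sum>k<i. l1 i (entries (P i) k))" for i
  have b: "0 \<le> b i" for i by (simp add: b_def sum_nonneg)
  \<comment> \<open>With \<open>V i x \<le> b i * (l1 i x)\<^sup>2\<close>, this bound on
    \<open>l1 i x\<close> places the state strictly inside the region of stage
    \<open>i\<close>.\<close>
  define \<rho> where "\<rho> = Min ((\<lambda>i. R i / (1 + b i)) ` {1..n - 1})"
  have ne: "{1..n - 1} \<noteq> {}" using n by simp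
  have \<rho>: "0 < \<rho>"
    unfolding \<rho>_def using ne Qi(2) b by (subst Min_gr_iff) (auto intro!: divide_pos_pos add_pos_nonneg)
  have \<rho>_le: "\<rho> \<le> R i / (1 + b i)" if "1 \<le> i" "i \<le> n - 1" for i
    unfolding \<rho>_def by (rule Min_le) (use that in auto)
  have V_small: "V i x < (R i)\<^sup>2" if i: "1 \<le> i" "i \<le> n - 1" and x: "l1 i x \<le> \<rho>" for i x
  proof -
    have "l1 i x \<le> R i / (1 + b i)" using x \<rho>_le[OF i] by simp
    then have "(1 + b i) * l1 i x \<le> R i" using b[of i] by (simp add: field_simps)
    then have le: "((1 + b i) * l1 i x)\<^sup>2 \<le> (R i)\<^sup>2" using b[of i] by (intro power_mono) auto
    have V: "V i x \<le> b i * (l1 i x)\<^sup>2"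
      using bil_bound[of i "entries (P i)" x x] by (simp add: V_def b_def power2_eq_square algebra_simps)
    show ?thesis
    proof (cases "l1 i x = 0")
      case True
      then show ?thesis using V Qi(2)[OF i] by (simp add: order_le_less_trans)
    next
      case False
      have "(1 + b i)\<^sup>2 = 1 + 2 * b i + (b i)\<^sup>2" by (simp add: power2_eq_square algebra_simps)
      then have "b i < (1 + b i)\<^sup>2" using b[of i] zero_le_power2[of "b i"] by linarith
      then have "b i * (l1 i x)\<^sup>2 < (1 + b i)\<^sup>2 * (l1 i x)\<^sup>2"
        using False by (intro mult_strict_right_mono) auto
      then show ?thesis using V le by (simp add: power_mult_distrib)
    qed
  qed
  \<comment> \<open>If the first \<open>s x + 1\<close> coordinates are small, the state also lies
    in the region of the next stage, which contradicts maximality unless there is no next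
    stage.\<close>
  have top: "s x = n - 1" if "l1 (Suc (s x)) x \<le> \<rho>" for x
  proof (rule ccontr)
    assume "s x \<noteq> n - 1"
    then have "Suc (s x) \<le> s x" using s_le[of x] by (intro s_ge V_small that) auto
    then show False by simp
  qed
  \<comment> \<open>Bound on the control in stage \<open>i\<close>: the region limits
    \<open>l1 i x\<close> to \<open>R i / sqrt (aP i)\<close>, and the saturated term is at most
    \<open>K i * \<bar>c i 0\<bar>\<close>.\<close>
  define e where "e i = l1 i (pf i) * (R i / sqrt (aP i)) + K i * \<bar>c i 0\<bar>" for i
  have aP: "0 < aP i" "\<And>x. aP i * (l1 i x)\<^sup>2 \<le> V i x" if "1 \<le> i" "i \<le> n - 1" for i
    using st[THEN bspec, of i] that by (auto simp: stage_def V_def)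
  have e0: "0 \<le> e i" if "1 \<le> i" "i \<le> n - 1" for i
    unfolding e_def using Qi(1,2)[OF that] aP(1)[OF that] by (intro add_nonneg_nonneg mult_nonneg_nonneg) auto
  define U where "U = K0 + (\<Sum>i\<in>{1..n - 1}. e i)"
  have U: "\<bar>k x\<bar> \<le> U" if x: "x \<in> carrier_vec n" for x
  proof (cases "s (\<lambda>j. x $ j) = 0")
    case True
    have "\<bar>k x\<bar> \<le> K0 * 1"
      using k[OF x] True K0 abs_sat_le_1[of "\<omega> 0 * x $ 0"] by (simp add: abs_mult mult_left_le)
    also have "\<dots> \<le> U" using e0 by (auto simp: U_def intro!: sum_nonneg)
    finally show ?thesis .
  next
    case False
    define i where "i = s (\<lambda>j. x $ j)"
    have i: "1 \<le> i" "i \<le> n - 1" using False s_le by (auto simp: i_def)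
    let ?x = "\<lambda>j. x $ j"
    have "aP i * (l1 i ?x)\<^sup>2 \<le> (R i)\<^sup>2" using aP(2)[OF i, of ?x] s_V[OF False] by (simp add: i_def)
    then have "(l1 i ?x)\<^sup>2 \<le> (R i / sqrt (aP i))\<^sup>2" using aP(1)[OF i] by (simp add: field_simps)
    then have l: "l1 i ?x \<le> R i / sqrt (aP i)" by (rule power2_le_imp_le) (use Qi(2)[OF i] aP(1)[OF i] in simp)
    have "\<bar>lin i (pf i) ?x\<bar> \<le> l1 i (pf i) * (R i / sqrt (aP i))"
      by (rule order_trans[OF lin_bound mult_left_mono[OF l]]) simp
    moreover have "\<bar>K i * c i 0 * sat (\<omega> i * (x $ i + lin i (c i) ?x))\<bar> \<le> K i * \<bar>c i 0\<bar>"
      using Qi(1)[OF i] abs_sat_le_1 by (simp add: abs_mult mult_left_le)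
    ultimately have "\<bar>k x\<bar> \<le> e i" using k[OF x] False unfolding e_def i_def[symmetric] by simp
    also have "e i \<le> (\<Sum>i\<in>{1..n - 1}. e i)" by (rule member_le_sum) (use i e0 in auto)
    finally show ?thesis using K0 by (simp add: U_def)
  qed
  define i where "i = n - 1"
  have i: "1 \<le> i" "i \<le> n - 1" "Suc i = n" using n by (auto simp: i_def)
  define B where "B = l1 i (pf i) + K i * \<bar>c i 0\<bar> * (\<omega> i * (1 + l1 i (c i)))"
  have B0: "0 \<le> B" using Qi(1)[OF i(1,2)] \<omega>[OF i(2)] by (simp add: B_def)
  have B: "\<bar>k x\<bar> \<le> B * l1 n (\<lambda>j. x $ j)" if x: "x \<in> carrier_vec n" and small: "l1 n (\<lambda>j. x $ j) \<le> \<rho>" for x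
  proof -
    let ?x = "\<lambda>j. x $ j"
    define N where "N = l1 n ?x"
    have N: "0 \<le> N" "l1 i ?x \<le> N" "\<bar>x $ i\<bar> \<le> N"
      using i by (auto simp: N_def intro: l1_mono abs_le_l1)
    have "l1 (Suc (s ?x)) ?x \<le> l1 n ?x" using s_le[of ?x] n by (intro l1_mono) simp
    then have si: "s ?x = i" using top[of ?x] small by (simp add: i_def)
    have l1: "\<bar>lin i q ?x\<bar> \<le> l1 i q * N" for q
      by (rule order_trans[OF lin_bound mult_left_mono[OF N(2)]]) simp
    have "\<bar>sat (\<omega> i * (x $ i + lin i (c i) ?x))\<bar> \<le> \<bar>\<omega> i * (x $ i + lin i (c i) ?x)\<bar>" by (rule abs_sat_le)
    also have "\<dots> = \<omega> i * \<bar>x $ i + lin i (c i) ?x\<bar>" using \<omega>[OF i(2)] by (simp add: abs_mult)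
    also have "\<dots> \<le> \<omega> i * (N + l1 i (c i) * N)"
      using \<omega>[OF i(2)] N l1[of "c i"] by (intro mult_left_mono) auto
    finally have "K i * \<bar>c i 0\<bar> * \<bar>sat (\<omega> i * (x $ i + lin i (c i) ?x))\<bar> \<le> K i * \<bar>c i 0\<bar> * (\<omega> i * (N + l1 i (c i) * N))"
      using Qi(1)[OF i(1,2)] by (intro mult_left_mono) auto
    then have "\<bar>K i * c i 0 * sat (\<omega> i * (x $ i + lin i (c i) ?x))\<bar> \<le> K i * \<bar>c i 0\<bar> * (\<omega> i * (N + l1 i (c i) * N))"
      using Qi(1)[OF i(1,2)] by (simp add: abs_mult)
    moreover have "k x = lin i (pf i) ?x - K i * c i 0 * sat (\<omega> i * (x $ i + lin i (c i) ?x))"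
      using k[OF x] si i by simp
    ultimately have "\<bar>k x\<bar> \<le> l1 i (pf i) * N + K i * \<bar>c i 0\<bar> * (\<omega> i * (N + l1 i (c i) * N))"
      using l1[of "pf i"] by linarith
    then show ?thesis by (simp add: B_def N_def[symmetric] algebra_simps)
  qed
  \<comment> \<open>Index 0 is filled in with the data of the first coordinate, so that stage 0
    obeys the same axioms as the others.\<close>
  define W' where "W' i = (if i = 0 then \<lambda>x. \<bar>x 0\<bar> else W i)" for i
  define \<beta>' where "\<beta>' i = (if i = 0 then min K0 (1 / \<omega> 0) else \<beta> i)" for i
  define Cw' where "Cw' i = (if i = 0 then 1 else Cw i)" for i
  interpret staged_loop n D g L k r s W' \<beta>' Cw' \<omega> c U \<rho> B
  proof
    show "0 < r" "r \<le> 1" using r by auto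
    show "\<bar>k x\<bar> \<le> U" if "x \<in> carrier_vec n" for x by (rule U[OF that])
    show "0 < \<rho>" by (rule \<rho>)
    show "0 \<le> B" by (rule B0)
    show "\<bar>k x\<bar> \<le> B * l1 n (\<lambda>j. x $ j)" if "x \<in> carrier_vec n" "l1 n (\<lambda>j. x $ j) \<le> \<rho>" for x
      by (rule B[OF that])
    show "s x \<le> n - 1" for x by (rule s_le)
    show "s x = n - 1" if "l1 (Suc (s x)) x \<le> \<rho>" for x by (rule top[OF that])
    show "0 < \<omega> j" if "j < n" for j using \<omega>[of j] that by simp
    show "0 < \<beta>' j" if "j < n" for j
      using that K0 \<omega>[of 0] Qi(4)[of j] by (cases "j = 0") (auto simp: \<beta>'_def)
    show "\<beta>' j * diss j (c j) (\<omega> j) x \<le> W' j x" if "j < n" for j x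
    proof (cases "j = 0")
      case True
      then show ?thesis using sat_sq_le_abs[OF \<omega>[of 0], of K0 "x 0"] by (simp add: \<beta>'_def W'_def diss_def)
    next
      case False
      then show ?thesis using Qi(5)[of j x] that by (simp add: \<beta>'_def W'_def)
    qed
    show "W' j x \<le> Cw' j * ((l1 (Suc j) x)\<^sup>2 + l1 (Suc j) x)" if "j < n" for j x
    proof (cases "j = 0")
      case True
      then show ?thesis by (simp add: W'_def Cw'_def l1_Suc)
    next
      case False
      then show ?thesis using Qi(6)[of j x] that by (simp add: Cw'_def W'_def)
    qed
    fix h x x'
    assume h: "0 < h" "h \<le> r" and x: "x \<in> carrier_vec n" and x': "x' 0 = x $ 0 + h * k x"
      and close: "\<And>s. s < n \<Longrightarrow> close_step (Cs s) s h (k x) (\<lambda>j. x $ j) x'"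
    define j where "j = s (\<lambda>j. x $ j)"
    have "j \<le> s x' \<and> W' j x' \<le> W' j (\<lambda>j. x $ j) - h * (\<beta>' j * diss j (c j) (\<omega> j) (\<lambda>j. x $ j))"
    proof (cases "j = 0")
      case True
      have "x' 0 = x $ 0 - h * (K0 * sat (\<omega> 0 * x $ 0))" using x' k[OF x] True by (simp add: j_def)
      then have "\<bar>x' 0\<bar> \<le> \<bar>x $ 0\<bar> - h * (K0 * diss 0 (c 0) (\<omega> 0) (\<lambda>j. x $ j))"
        using h r K0 \<omega>[of 0] by (intro first_coordinate_step) auto
      moreover have "h * (\<beta>' 0 * diss 0 (c 0) (\<omega> 0) (\<lambda>j. x $ j)) \<le> h * (K0 * diss 0 (c 0) (\<omega> 0) (\<lambda>j. x $ j))"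
        using h by (intro mult_left_mono mult_right_mono diss_nonneg) (auto simp: \<beta>'_def)
      ultimately show ?thesis using True by (simp add: W'_def)
    next
      case False
      then have j: "1 \<le> j" "j \<le> n - 1" using s_le by (auto simp: j_def)
      have "V j x' < (R j)\<^sup>2 \<and> W j x' \<le> W j (\<lambda>j. x $ j) - h * (\<beta> j * diss j (c j) (\<omega> j) (\<lambda>j. x $ j))"
      proof (rule Qstep[OF j h(1)])
        show "h \<le> ri j" using h r_le[OF j] by simp
        show "V j (\<lambda>j. x $ j) < (R j)\<^sup>2" using s_V False by (simp add: j_def)
        show "k x = lin j (pf j) (\<lambda>j. x $ j) - K j * c j 0 * sat (\<omega> j * (x $ j + lin j (c j) (\<lambda>j. x $ j)))"
          using k[OF x] False by (simp add: j_def)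
        show "close_step (Cs j) j h (k x) (\<lambda>j. x $ j) x'" using j n by (intro close) simp
      qed
      then show ?thesis using s_ge[OF j] j by (simp add: W'_def \<beta>'_def)
    qed
    then show "s (\<lambda>j. x $ j) \<le> s x' \<and>
      W' (s (\<lambda>j. x $ j)) x' \<le> W' (s (\<lambda>j. x $ j)) (\<lambda>j. x $ j) -
        h * (\<beta>' (s (\<lambda>j. x $ j)) * diss (s (\<lambda>j. x $ j)) (c (s (\<lambda>j. x $ j))) (\<omega> (s (\<lambda>j. x $ j))) (\<lambda>j. x $ j))"
      by (simp add: j_def)
  qed
  have "RGAS (closed_loop n g k) n r D"
    by (rule RGAS_closed_loop) (rule solution_exists[OF r(1)])
  then have "0 < r \<and> (\<forall>i\<in>{1..n - 1}. 0 < K i \<and> 0 < R i) \<and>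
    RGAS (closed_loop n g k) n r D \<and> 0 < \<rho> \<and> 0 \<le> B \<and> (\<forall>x\<in>carrier_vec n. \<bar>k x\<bar> \<le> U) \<and>
    (\<forall>x\<in>carrier_vec n. l1 n (\<lambda>j. x $ j) \<le> \<rho> \<longrightarrow> \<bar>k x\<bar> \<le> B * l1 n (\<lambda>j. x $ j))"
    using r(1) Qi(1,2) \<rho> B0 U B by auto
  then show ?thesis unfolding k_def by blast
qed

text \<open>Admissible matrices come from backstepping, and the free constants are set to 1. The
  linear bound near 0 gives both \<open>k (0\<^sub>v n) = 0\<close> and continuity at 0.\<close>

lemma bounded_feedback_exists:
  "\<exists>k r. (\<exists>B. \<forall>x\<in>carrier_vec n. \<bar>k x\<bar> \<le> B) \<and> k (0\<^sub>v n) = 0 \<and>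
    (\<forall>\<epsilon>>0. \<exists>\<delta>>0. \<forall>x\<in>carrier_vec n. vnorm x < \<delta> \<longrightarrow> \<bar>k x - k (0\<^sub>v n)\<bar> < \<epsilon>) \<and>
    r > 0 \<and> RGAS (closed_loop n g k) n r D"
proof -
  have "\<forall>i\<in>{1..n - 1}. \<exists>P p. P\<^sup>T = P \<and> pos_def i P \<and> p \<in> carrier_vec i \<and> neg_def i (lyap_mat i P p)"
    using matrices_exist by auto
  then obtain P p where "\<forall>i\<in>{1..n - 1}. (P i)\<^sup>T = P i \<and> pos_def i (P i) \<and> p i \<in> carrier_vec i \<and>
    neg_def i (lyap_mat i (P i) (p i))"
    by metis
  then obtain r K R U \<rho> B where r: "0 < r"
    and rgas: "RGAS (closed_loop n g (feedback n 1 K R (\<lambda>_. 1) P p)) n r D" and \<rho>: "0 < \<rho>" and B: "0 \<le> B"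
    and U: "\<forall>x\<in>carrier_vec n. \<bar>feedback n 1 K R (\<lambda>_. 1) P p x\<bar> \<le> U"
    and near: "\<forall>x\<in>carrier_vec n. l1 n (\<lambda>j. x $ j) \<le> \<rho> \<longrightarrow>
      \<bar>feedback n 1 K R (\<lambda>_. 1) P p x\<bar> \<le> B * l1 n (\<lambda>j. x $ j)"
    using feedback_stabilizes[of 1 "\<lambda>_. 1" P p] by auto
  define k where "k = feedback n 1 K R (\<lambda>_. 1) P p"
  have "l1 n (\<lambda>j. 0\<^sub>v n $ j) = 0" by (simp add: l1_def)
  then have k0: "k (0\<^sub>v n) = 0" using near[THEN bspec, of "0\<^sub>v n"] \<rho> by (simp add: k_def)
  have "\<exists>\<delta>>0. \<forall>x\<in>carrier_vec n. vnorm x < \<delta> \<longrightarrow> \<bar>k x - k (0\<^sub>v n)\<bar> < \<epsilon>" if \<epsilon>: "0 < \<epsilon>" for \<epsilon>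
  proof (intro exI[of _ "min (\<rho> / n) (\<epsilon> / ((B + 1) * n))"] conjI ballI impI)
    show "0 < min (\<rho> / n) (\<epsilon> / ((B + 1) * n))" using \<rho> \<epsilon> B n by simp
    fix x :: rvec assume x: "x \<in> carrier_vec n" and v: "vnorm x < min (\<rho> / n) (\<epsilon> / ((B + 1) * n))"
    have l: "l1 n (\<lambda>j. x $ j) \<le> n * vnorm x" by (rule l1_le_vnorm[OF x])
    have "n * vnorm x < \<rho>" using v n by (simp add: field_simps)
    then have "\<bar>k x\<bar> \<le> B * l1 n (\<lambda>j. x $ j)" using near x l by (simp add: k_def)
    also have "\<dots> \<le> (B + 1) * (n * vnorm x)" using B l by (intro mult_mono) auto
    also have "\<dots> < \<epsilon>"
    proof -
      have "0 < (B + 1) * n" using B n by simp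
      then have "vnorm x * ((B + 1) * n) < \<epsilon>" using v by (simp only: min_less_iff_conj pos_less_divide_eq)
      then show ?thesis by (simp add: mult_ac)
    qed
    finally show "\<bar>k x - k (0\<^sub>v n)\<bar> < \<epsilon>" by (simp add: k0)
  qed
  then show ?thesis using k0 U r rgas unfolding k_def by blast
qed

end

text \<open>The bound factors as \<open>L\<close> times
  \<open>vnorm y * (vnorm y + \<bar>u\<bar>)\<close>, and both Euclidean norms are below the
  corresponding sum norms; monotonicity of \<open>L\<close> handles its argument.\<close>

lemma growth_hypothesis:
  assumes L: "mono_on {0..} L" "L ` {0..} \<subseteq> {0..}" and x: "x \<in> carrier_vec n" and j: "j < n"
    and y: "y = vec_first x j" and yu: "yu = y @\<^sub>v Matrix.vec 1 (\<lambda>_. u)"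
    and bound: "\<bar>G\<bar> \<le> L (vnorm yu) * (vnorm y)\<^sup>2 + L (vnorm yu) * vnorm y * \<bar>u\<bar>"
  shows "\<bar>G\<bar> \<le> L (l1 j (\<lambda>k. x $ k) + \<bar>u\<bar>) * (l1 j (\<lambda>k. x $ k) + \<bar>u\<bar>)\<^sup>2"
proof -
  define N where "N = l1 j (\<lambda>k. x $ k)"
  have N: "0 \<le> N" by (simp add: N_def)
  have yC: "y \<in> carrier_vec j" by (simp add: y vec_first_def)
  have yi: "y $ k = x $ k" if "k < j" for k using that by (simp add: y vec_first_def)
  have vy: "vnorm y \<le> N"
  proof -
    have "l1 j (\<lambda>k. y $ k) = N" unfolding N_def by (rule l1_cong) (rule yi)
    then show ?thesis using vnorm_le_l1[OF yC] by simp
  qed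
  have "dim_vec yu = Suc j" using carrier_vecD[OF yC] by (simp add: yu)
  then have "yu \<in> carrier_vec (Suc j)" by (rule carrier_vecI)
  then have "vnorm yu \<le> l1 (Suc j) (\<lambda>k. yu $ k)" by (rule vnorm_le_l1)
  also have "\<dots> = l1 j (\<lambda>k. yu $ k) + \<bar>u\<bar>" using yC by (simp add: l1_Suc yu)
  also have "l1 j (\<lambda>k. yu $ k) = N"
    unfolding N_def using yC yi by (intro l1_cong) (simp add: yu)
  finally have 1: "L (vnorm yu) \<le> L (N + \<bar>u\<bar>)"
    using vnorm_nonneg[of yu] N by (intro mono_onD[OF L(1)]) auto
  have 2: "vnorm y * (vnorm y + \<bar>u\<bar>) \<le> (N + \<bar>u\<bar>) * (N + \<bar>u\<bar>)"
    using vy N vnorm_nonneg[of y] by (intro mult_mono) auto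
  have "L (vnorm yu) * (vnorm y * (vnorm y + \<bar>u\<bar>)) \<le> L (N + \<bar>u\<bar>) * ((N + \<bar>u\<bar>) * (N + \<bar>u\<bar>))"
    by (rule mult_mono[OF 1 2]) (use vnorm_nonneg[of y] image_nonneg[OF L(2), of "N + \<bar>u\<bar>"] N in auto)
  then show ?thesis using bound by (simp add: N_def[symmetric] power2_eq_square algebra_simps)
qed

theorem theorem3p7:
  fixes n :: nat
    and D :: "'d::euclidean_space set"
    and g :: "nat \<Rightarrow> 'd \<Rightarrow> rvec \<Rightarrow> real \<Rightarrow> real"
    and L :: "real \<Rightarrow> real"
  assumes "n \<ge> 2"
    and "D \<noteq> {}" and "compact D"
    and "\<forall>i\<in>{2..n}. locally_Lipschitz D (i - 1) (g i)"
    and "smooth_on_nonneg L" and "mono_on {0..} L" and "L ` {0..} \<subseteq> {0..}"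
    and "\<forall>i\<in>{2..n}. \<forall>d\<in>D. \<forall>x\<in>carrier_vec n. \<forall>u.
           (let y = vec_first x (i - 1); yu = y @\<^sub>v Matrix.vec 1 (\<lambda>_. u) in
            \<bar>g i d y u\<bar> \<le> L (vnorm yu) * (vnorm y)\<^sup>2 + L (vnorm yu) * vnorm y * \<bar>u\<bar>)"
  shows "(\<exists>k r. (\<exists>B. \<forall>x\<in>carrier_vec n. \<bar>k x\<bar> \<le> B) \<and> k (0\<^sub>v n) = 0 \<and>
            (\<forall>\<epsilon>>0. \<exists>\<delta>>0. \<forall>x\<in>carrier_vec n. vnorm x < \<delta> \<longrightarrow> \<bar>k x - k (0\<^sub>v n)\<bar> < \<epsilon>) \<and>
            r > 0 \<and> RGAS (closed_loop n g k) n r D) \<and>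
         (\<forall>K0 \<omega> P p.
            K0 > 0 \<and> (\<forall>i\<in>{0..n - 1}. \<omega> i > 0) \<and>
            (\<forall>i\<in>{1..n - 1}. (P i)\<^sup>T = P i \<and> pos_def i (P i) \<and> p i \<in> carrier_vec i \<and>
               neg_def i (lyap_mat i (P i) (p i))) \<longrightarrow>
            (\<exists>r K R. r > 0 \<and> (\<forall>i\<in>{1..n - 1}. K i > 0 \<and> R i > 0) \<and>
               RGAS (closed_loop n g (feedback n K0 K R \<omega> P p)) n r D))"
proof -
  interpret chain_system n D g L
  proof
    show "locally_Lipschitz D j (g (j + 1))" if "1 \<le> j" "j < n" for j
      using assms(4)[THEN bspec, of "j + 1"] that by simp
    show "\<bar>g (j + 1) d (vec_first x j) u\<bar> \<le>
        L (l1 j (\<lambda>k. x $ k) + \<bar>u\<bar>) * (l1 j (\<lambda>k. x $ k) + \<bar>u\<bar>)\<^sup>2"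
      if "1 \<le> j" "j < n" "d \<in> D" "x \<in> carrier_vec n" for j d x u
      by (rule growth_hypothesis[OF assms(6,7) that(4,2) refl refl])
        (use assms(8)[THEN bspec, of "j + 1"] that in \<open>simp add: Let_def\<close>)
  qed (use assms in auto)
  have "\<exists>r K R. r > 0 \<and> (\<forall>i\<in>{1..n - 1}. K i > 0 \<and> R i > 0) \<and>
      RGAS (closed_loop n g (feedback n K0 K R \<omega> P p)) n r D"
    if "K0 > 0 \<and> (\<forall>i\<in>{0..n - 1}. \<omega> i > 0) \<and>
      (\<forall>i\<in>{1..n - 1}. (P i)\<^sup>T = P i \<and> pos_def i (P i) \<and> p i \<in> carrier_vec i \<and>
         neg_def i (lyap_mat i (P i) (p i)))" for K0 \<omega> P p
  proof -
    have "0 < K0" "\<And>i. i \<le> n - 1 \<Longrightarrow> 0 < \<omega> i" using that by auto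
    moreover have "(P i)\<^sup>T = P i \<and> pos_def i (P i) \<and> p i \<in> carrier_vec i \<and>
        neg_def i (lyap_mat i (P i) (p i))" if "1 \<le> i" "i \<le> n - 1" for i
      using \<open>K0 > 0 \<and> _\<close> that by auto
    ultimately show ?thesis using feedback_stabilizes[of K0 \<omega> P p] by blast
  qed
  with bounded_feedback_exists show ?thesis by blast
qed

end
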